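(* Define sequences $\{c_n\}$ and $\{d_n\}$ by $f_1^{10}=\sum_{n\ge0}c_nq^n$ and $f_1^5f_5=\sum_{n\ge0}d_nq^n$. Then for all $n\ge0$, $c_n\equiv0\pmod{25}$ if and only if $d_n\equiv 0\pmod{25}$.
   Context: $f_j:=\prod_{n=1}^{\infty}(1-q^{jn})$. *)

theory Defs
  imports
    "HOL-Analysis.Infinite_Products"
    "HOL-Computational_Algebra.Formal_Power_Series"
    "HOL-Number_Theory.Cong"
begin

text \<open>
  \<open>q\<close> is the indeterminate \<^const>\<open>fps_X\<close>, and the infinite product is taken in the
  \<open>q\<close>-adic topology on \<open>\<int>[[q]]\<close>; the index is shifted because \<^const>\<open>prodinf\<close> starts at 0.
  The product converges for \<open>j > 0\<close>, see \<open>has_prod_euler_f\<close>.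
\<close>

definition euler_f :: "nat \<Rightarrow> int fps" where
  "euler_f j = (\<Prod>n. 1 - fps_X ^ (j * Suc n))"

lemma has_prod_euler_f:
  assumes "j > 0"
  shows "(\<lambda>n. 1 - fps_X ^ (j * Suc n)) has_prod euler_f j"
proof -
  define P :: "nat \<Rightarrow> int fps" where "P = (\<lambda>n. \<Prod>i\<le>n. 1 - fps_X ^ (j * Suc i))"
  define L where "L = Abs_fps (\<lambda>k. fps_nth (P k) k)"
  have step: "fps_nth (P (Suc n)) k = fps_nth (P n) k" if "k \<le> n" for n k
  proof -
    have "k < j * Suc (Suc n)"
      using that assms by (cases j) auto
    moreover have "P (Suc n) = P n - P n * fps_X ^ (j * Suc (Suc n))"
      by (simp add: P_def right_diff_distrib)
    ultimately show ?thesis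
      by (simp only: fps_sub_nth fps_X_power_mult_right_nth) simp
  qed
  have stable: "fps_nth (P n) k = fps_nth (P k) k" if "k \<le> n" for n k
    using that by (induction n rule: dec_induct) (auto simp: step)
  have "P \<longlonglongrightarrow> L"
  proof (rule tendsto_fpsI)
    fix k
    show "\<forall>\<^sub>F n in sequentially. fps_nth (P n) k = fps_nth L k"
      unfolding L_def using eventually_ge_at_top[of k] by eventually_elim (auto intro: stable)
  qed
  moreover have "fps_nth L 0 = 1"
    using assms by (simp add: L_def P_def)
  then have "L \<noteq> 0" by auto
  ultimately have "(\<lambda>n. 1 - fps_X ^ (j * Suc n)) has_prod L"
    by (simp add: has_prod_def raw_has_prod_def P_def)
  then show ?thesis
    unfolding euler_f_def using has_prod_unique by metis
qed

end

theory Submission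
  imports Defs "HOL-Computational_Algebra.Formal_Laurent_Series"
begin

text \<open>
  Write \<open>f = f\<^sub>1\<close> and let \<open>a\<^sub>n\<close> be the coefficients of \<open>f\<^sup>2\<close>. Since \<open>f\<^sub>1\<^sup>5 \<equiv> f\<^sub>5 (mod 5)\<close>, the square
  \<open>(f\<^sub>1\<^sup>5 - f\<^sub>5)\<^sup>2\<close> vanishes modulo 25, that is, \<open>c\<^sub>n \<equiv> 2 d\<^sub>n - a\<^sub>n\<^sub>/\<^sub>5 (mod 25)\<close>. This settles
  \<open>5 \<nmid> n\<close>, and for \<open>n = 5 m\<close> it remains to compare \<open>c\<^sub>n\<close> with \<open>a\<^sub>m\<close>.

  Both \<open>f\<^sup>2\<close> and \<open>f\<^sup>1\<^sup>0\<close> have complex multiplication by the Gaussian integers: \<open>4 a\<^sub>m\<close> is the sum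
  of a character over the points of norm \<open>24 m + 2\<close>, and \<open>96 c\<^sub>n\<close> is a sum of the same type,
  weighted with the imaginary part of the fourth power, over the points of norm \<open>24 n + 10\<close>.
  For \<open>n = 5 m\<close>, dividing by a prime above 5 turns the latter into a sum over the points
  \<open>\<gamma>\<close> of norm \<open>24 m + 2\<close> weighted with \<open>Re \<gamma>\<^sup>4\<close>. If 5 does not divide the norm \<open>K\<close>, then
  \<open>\<gamma>\<^sup>4 \<equiv> 1 (mod 5)\<close>, hence \<open>2 Re \<gamma>\<^sup>4 \<equiv> 1 + K\<^sup>4 (mod 25)\<close>, so \<open>c\<^sub>n \<equiv> v a\<^sub>m\<close> with \<open>v \<equiv> 1 (mod 5)\<close>;
  powers of 5 in \<open>K\<close> are removed by means of the Gaussian primes above 5. As \<open>v\<close> and \<open>v + 1\<close> are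
  units modulo 25, the claim follows.

  The formula for \<open>f\<^sup>1\<^sup>0\<close> expresses it as a Wronskian of the weight \<open>3/2\<close> theta series in the
  3-dissection \<open>f(q)\<^sup>3 = T(q\<^sup>3) - 3 q U(q\<^sup>3)\<close>. It follows by differentiating
  \<open>T\<^sup>3 U = f\<^sup>1\<^sup>2 + 27 q U\<^sup>4\<close>, which is the product of the dissection over the cube roots of
  unity, once \<open>T\<^sup>2\<close> is known; this square is read off from the second logarithmic derivative of
  Jacobi's triple product in its elliptic variable.
\<close>

unbundle no vec_syntax

subsection \<open>Infinite products of formal power series\<close>

text \<open>Congruence modulo \<open>fps_X ^ N\<close>. It replaces the q-adic topology: limit
  arguments about infinite products become statements about finite ones.\<close>

definition fps_agree :: "nat \<Rightarrow> 'a::comm_ring_1 fps \<Rightarrow> 'a fps \<Rightarrow> bool" where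
  "fps_agree N F G \<longleftrightarrow> (\<forall>i<N. F $ i = G $ i)"

lemma fps_agree_refl [simp]: "fps_agree N F F"
  by (simp add: fps_agree_def)

lemma fps_agree_sym: "fps_agree N F G \<Longrightarrow> fps_agree N G F"
  by (simp add: fps_agree_def)

lemma fps_agree_trans [trans]: "fps_agree N F G \<Longrightarrow> fps_agree N G H \<Longrightarrow> fps_agree N F H"
  by (simp add: fps_agree_def)

lemma fps_agree_mono: "fps_agree N F G \<Longrightarrow> M \<le> N \<Longrightarrow> fps_agree M F G"
  by (simp add: fps_agree_def)

lemma fps_agree_add: "fps_agree N F G \<Longrightarrow> fps_agree N F' G' \<Longrightarrow> fps_agree N (F + F') (G + G')"
  by (simp add: fps_agree_def)

lemma fps_agree_mult: "fps_agree N F G \<Longrightarrow> fps_agree N F' G' \<Longrightarrow> fps_agree N (F * F') (G * G')"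
  by (auto simp: fps_agree_def fps_mult_nth intro!: sum.cong)

lemma fps_agree_power: "fps_agree N F G \<Longrightarrow> fps_agree N (F ^ k) (G ^ k)"
  by (induction k) (auto intro: fps_agree_mult)

lemma fps_agree_imp_eq: "(\<And>N. fps_agree N F G) \<Longrightarrow> F = G"
  by (metis fps_agree_def fps_ext lessI)

lemma fps_agree_one_minus: "N \<le> k \<Longrightarrow> fps_agree N (1 - F * fps_X ^ k) 1"
  by (auto simp: fps_agree_def fps_X_power_mult_right_nth)

text \<open>Multiplication by \<open>F\<close> is triangular on coefficients, with diagonal entry
  \<open>F $ 0\<close>, so the coefficients of \<open>G\<close> and \<open>H\<close> can be compared
  one after another.\<close>

lemma fps_agree_cancel_left:
  fixes F :: "'a::idom fps"
  assumes "fps_agree N (F * G) (F * H)" "F $ 0 \<noteq> 0"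
  shows "fps_agree N G H"
  unfolding fps_agree_def
proof (intro allI impI)
  fix i assume "i < N"
  then show "G $ i = H $ i"
  proof (induction i rule: less_induct)
    case (less i)
    have "(F * G) $ i = (F * H) $ i"
      using assms(1) less.prems by (simp add: fps_agree_def)
    moreover have "(F * K) $ i = F $ 0 * K $ i + (\<Sum>j=1..i. F $ j * K $ (i - j))" for K
      by (simp add: fps_mult_nth sum.atLeast_Suc_atMost)
    moreover have "(\<Sum>j=1..i. F $ j * G $ (i - j)) = (\<Sum>j=1..i. F $ j * H $ (i - j))"
      using less by (intro sum.cong) auto
    ultimately show ?case using assms(2) by simp
  qed
qed

text \<open>To read off coefficient \<open>m\<close>, the product is cut off after factor
  \<open>m\<close>. This is the true limit when each \<open>u n\<close> is 1 modulo
  \<open>fps_X ^ n\<close>. Every coefficient is a finite expression in the factors, which can be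
  differentiated or mapped to another ring.\<close>

definition fps_prodinf :: "(nat \<Rightarrow> 'a::comm_ring_1 fps) \<Rightarrow> 'a fps" where
  "fps_prodinf u = Abs_fps (\<lambda>m. (\<Prod>n<Suc m. u n) $ m)"

definition fps_suminf :: "(nat \<Rightarrow> 'a::comm_ring_1 fps) \<Rightarrow> 'a fps" where
  "fps_suminf l = Abs_fps (\<lambda>m. (\<Sum>n<Suc m. l n) $ m)"

lemma prod_agree_tail:
  assumes "\<And>n. fps_agree n (u n) 1" "N \<le> M"
  shows "fps_agree N (\<Prod>n<M. u n) (\<Prod>n<N. u n)"
  using assms(2)
proof (induction M rule: dec_induct)
  case (step M)
  have "fps_agree N ((\<Prod>n<M. u n) * u M) ((\<Prod>n<N. u n) * 1)"
    using step assms(1)[of M] by (intro fps_agree_mult) (auto intro: fps_agree_mono)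
  then show ?case by simp
qed auto

lemma fps_prodinf_agree:
  assumes "\<And>n. fps_agree n (u n) 1" "N \<le> M"
  shows "fps_agree N (fps_prodinf u) (\<Prod>n<M. u n)"
  unfolding fps_agree_def
proof (intro allI impI)
  fix i assume "i < N"
  then have "fps_agree (Suc i) (\<Prod>n<M. u n) (\<Prod>n<Suc i. u n)"
    using assms by (intro prod_agree_tail) auto
  then show "fps_prodinf u $ i = (\<Prod>n<M. u n) $ i"
    by (simp add: fps_prodinf_def fps_agree_def)
qed

lemma fps_suminf_agree:
  assumes "\<And>n. fps_agree n (l n) 0" "N \<le> M"
  shows "fps_agree N (fps_suminf l) (\<Sum>n<M. l n)"
  unfolding fps_agree_def
proof (intro allI impI)
  fix i assume i: "i < N"
  have "fps_agree (Suc i) (\<Sum>n<M. l n) (\<Sum>n<Suc i. l n)"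
  proof -
    have "Suc i \<le> M" using i assms(2) by simp
    then show ?thesis
    proof (induction M rule: dec_induct)
      case (step M)
      have "fps_agree (Suc i) ((\<Sum>n<M. l n) + l M) ((\<Sum>n<Suc i. l n) + 0)"
        using step assms(1)[of M] by (intro fps_agree_add) (auto intro: fps_agree_mono)
      then show ?case by simp
    qed auto
  qed
  then show "fps_suminf l $ i = (\<Sum>n<M. l n) $ i"
    by (simp add: fps_suminf_def fps_agree_def)
qed

text \<open>Agreement along arbitrarily long partial products is enough, which allows factors to be
  regrouped.\<close>

lemma fps_prodinf_eqI:
  assumes "\<And>n. fps_agree n (u n) 1" "\<And>N. \<exists>M\<ge>N. fps_agree N F (\<Prod>n<M. u n)"
  shows "fps_prodinf u = F"
proof (rule fps_agree_imp_eq)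
  fix N
  obtain M where "M \<ge> N" "fps_agree N F (\<Prod>n<M. u n)" using assms(2) by blast
  then show "fps_agree N (fps_prodinf u) F"
    using fps_prodinf_agree[OF assms(1), of N M] fps_agree_sym fps_agree_trans by blast
qed

lemma fps_prodinf_mult:
  assumes "\<And>n. fps_agree n (u n) 1" "\<And>n. fps_agree n (v n) 1"
  shows "fps_prodinf (\<lambda>n. u n * v n) = fps_prodinf u * fps_prodinf v"
proof (rule fps_prodinf_eqI)
  show "fps_agree n (u n * v n) 1" for n
    using fps_agree_mult[OF assms(1)[of n] assms(2)[of n]] by simp
  show "\<exists>M\<ge>N. fps_agree N (fps_prodinf u * fps_prodinf v) (\<Prod>n<M. u n * v n)" for N
    by (intro exI[of _ N])
      (auto simp: prod.distrib intro!: fps_agree_mult fps_prodinf_agree assms)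
qed

lemma fps_prodinf_power:
  assumes "\<And>n. fps_agree n (u n) 1"
  shows "fps_prodinf (\<lambda>n. u n ^ k) = fps_prodinf u ^ k"
proof (rule fps_prodinf_eqI)
  show "fps_agree n (u n ^ k) 1" for n
    using fps_agree_power[OF assms(1)[of n], of k] by simp
  show "\<exists>M\<ge>N. fps_agree N (fps_prodinf u ^ k) (\<Prod>n<M. u n ^ k)" for N
    by (intro exI[of _ N])
      (auto simp flip: prod_power_distrib intro!: fps_agree_power fps_prodinf_agree assms)
qed

lemma prod_lessThan_triple:
  fixes u :: "nat \<Rightarrow> 'a::comm_monoid_mult"
  shows "(\<Prod>n<3 * N. u n) = (\<Prod>n<N. u (3 * n) * u (3 * n + 1) * u (3 * n + 2))"
proof (induction N)
  case (Suc N)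
  have "3 * Suc N = Suc (Suc (Suc (3 * N)))" by simp
  then show ?case using Suc by (simp only: prod.lessThan_Suc) (simp add: mult.assoc)
qed simp

lemma fps_prodinf_triple:
  assumes "\<And>n. fps_agree n (u n) 1"
  shows "fps_prodinf (\<lambda>n. u (3 * n) * u (3 * n + 1) * u (3 * n + 2)) = fps_prodinf u"
proof (rule fps_prodinf_eqI)
  show "fps_agree n (u (3 * n) * u (3 * n + 1) * u (3 * n + 2)) 1" for n
    using fps_agree_mult[OF fps_agree_mult[OF fps_agree_mono[OF assms(1)[of "3*n"]]
        fps_agree_mono[OF assms(1)[of "3*n+1"]]] fps_agree_mono[OF assms(1)[of "3*n+2"]], of n] by simp
  show "\<exists>M\<ge>N. fps_agree N (fps_prodinf u) (\<Prod>n<M. u (3 * n) * u (3 * n + 1) * u (3 * n + 2))" for N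
    unfolding prod_lessThan_triple[symmetric] by (intro exI[of _ N]) (auto intro!: fps_prodinf_agree assms)
qed

lemma fps_prodinf_compose_X_power:
  fixes u :: "nat \<Rightarrow> 'a::idom fps"
  assumes "\<And>n. fps_agree n (u n) 1" "k > 0"
  shows "fps_prodinf u oo fps_X ^ k = fps_prodinf (\<lambda>n. u n oo fps_X ^ k)"
proof (rule sym, rule fps_prodinf_eqI)
  have *: "fps_agree N (F oo fps_X ^ k) (G oo fps_X ^ k)" if "fps_agree N F G" for N and F G :: "'a fps"
    unfolding fps_agree_def fps_nth_compose_X_power
  proof (intro allI impI)
    fix i assume "i < N"
    then have "i div k < N" by (meson div_le_dividend le_less_trans)
    then show "(if k dvd i then F $ (i div k) else 0) = (if k dvd i then G $ (i div k) else 0)"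
      using that by (simp add: fps_agree_def)
  qed
  show "fps_agree n (u n oo fps_X ^ k) 1" for n
    using *[OF assms(1)[of n]] by simp
  show "\<exists>M\<ge>N. fps_agree N (fps_prodinf u oo fps_X ^ k) (\<Prod>n<M. u n oo fps_X ^ k)" for N
    using assms(2) fps_prodinf_agree[OF assms(1), of N N]
    by (intro exI[of _ N]) (auto simp: fps_compose_prod_distrib[symmetric] intro!: *)
qed

lemma fps_prodinf_compose_linear:
  fixes u :: "nat \<Rightarrow> 'a::idom fps"
  assumes "\<And>n. fps_agree n (u n) 1"
  shows "fps_prodinf u oo (fps_const c * fps_X) = fps_prodinf (\<lambda>n. u n oo (fps_const c * fps_X))"
proof (rule sym, rule fps_prodinf_eqI)
  have *: "fps_agree N (F oo (fps_const c * fps_X)) (G oo (fps_const c * fps_X))"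
    if "fps_agree N F G" for N and F G :: "'a fps"
    using that by (simp add: fps_agree_def)
  show "fps_agree n (u n oo (fps_const c * fps_X)) 1" for n
    using *[OF assms(1)[of n]] by simp
  show "\<exists>M\<ge>N. fps_agree N (fps_prodinf u oo (fps_const c * fps_X)) (\<Prod>n<M. u n oo (fps_const c * fps_X))" for N
    using fps_prodinf_agree[OF assms(1), of N N]
    by (intro exI[of _ N]) (auto simp: fps_compose_prod_distrib[symmetric] intro!: *)
qed

text \<open>Here \<open>l n\<close> is the logarithmic derivative of \<open>u n\<close> under q
  d/dq. Unlike \<open>fps_deriv\<close> alone, this operator loses no precision, so the finite
  product rule passes to the limit.\<close>

lemma fps_prodinf_deriv:
  fixes u :: "nat \<Rightarrow> 'a::comm_ring_1 fps"
  assumes "\<And>n. fps_agree n (u n) 1" "\<And>n. fps_agree n (l n) 0"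
    and "\<And>n. fps_X * fps_deriv (u n) = u n * l n"
  shows "fps_X * fps_deriv (fps_prodinf u) = fps_prodinf u * fps_suminf l"
proof (rule fps_agree_imp_eq)
  fix N
  have fin: "fps_X * fps_deriv (\<Prod>n<M. u n) = (\<Prod>n<M. u n) * (\<Sum>n<M. l n)" for M
  proof (induction M)
    case (Suc M)
    have "fps_X * fps_deriv (\<Prod>n<Suc M. u n) =
      fps_X * fps_deriv (\<Prod>n<M. u n) * u M + (\<Prod>n<M. u n) * (fps_X * fps_deriv (u M))"
      by (simp add: algebra_simps)
    also have "\<dots> = (\<Prod>n<Suc M. u n) * (\<Sum>n<Suc M. l n)"
      unfolding Suc assms(3) by (simp add: algebra_simps)
    finally show ?case .
  qed auto
  have "fps_agree N (fps_X * fps_deriv F) (fps_X * fps_deriv G)" if "fps_agree N F G" for F G :: "'a fps"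
    using that by (auto simp: fps_agree_def gr0_conv_Suc)
  then have "fps_agree N (fps_X * fps_deriv (fps_prodinf u)) (fps_X * fps_deriv (\<Prod>n<N. u n))"
    using fps_prodinf_agree[OF assms(1), of N N] by simp
  moreover have "fps_agree N (fps_prodinf u * fps_suminf l) ((\<Prod>n<N. u n) * (\<Sum>n<N. l n))"
    by (intro fps_agree_mult fps_prodinf_agree fps_suminf_agree assms order_refl)
  ultimately show "fps_agree N (fps_X * fps_deriv (fps_prodinf u)) (fps_prodinf u * fps_suminf l)"
    unfolding fin using fps_agree_sym fps_agree_trans by blast
qed

text \<open>
  The coefficients of a product depend on a parameter \<open>z\<close>; differentiating them one by one avoids
  any question of convergence.
\<close>

definition has_coeff_deriv :: "('a::real_normed_field \<Rightarrow> 'a fps) \<Rightarrow> 'a fps \<Rightarrow> 'a \<Rightarrow> bool" where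
  "has_coeff_deriv F F' z \<longleftrightarrow> (\<forall>m. ((\<lambda>w. F w $ m) has_field_derivative F' $ m) (at z))"

lemma has_coeff_deriv_mult:
  assumes "has_coeff_deriv F F' z" "has_coeff_deriv G G' z"
  shows "has_coeff_deriv (\<lambda>w. F w * G w) (F' * G z + F z * G') z"
  using assms unfolding has_coeff_deriv_def
  by (auto simp: fps_mult_nth sum.distrib[symmetric] intro!: derivative_eq_intros sum.cong)

lemma has_coeff_deriv_const [simp]: "has_coeff_deriv (\<lambda>w. F) 0 z"
  by (simp add: has_coeff_deriv_def)

lemma has_coeff_deriv_unique:
  "has_coeff_deriv F F' z \<Longrightarrow> has_coeff_deriv F G' z \<Longrightarrow> F' = G'"
  by (meson DERIV_unique fps_ext has_coeff_deriv_def)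

lemma has_coeff_deriv_suminf:
  assumes "\<And>n. has_coeff_deriv (l n) (l' n) z"
  shows "has_coeff_deriv (\<lambda>w. fps_suminf (\<lambda>n. l n w)) (fps_suminf l') z"
  using assms unfolding has_coeff_deriv_def fps_suminf_def
  by (auto simp: fps_sum_nth intro!: derivative_eq_intros sum.cong)

text \<open>Coefficient \<open>m\<close> involves only the first \<open>Suc m\<close> factors, for
  all parameter values at once, so the product rule for finite products suffices.\<close>

lemma has_coeff_deriv_prodinf:
  assumes "\<And>n w. fps_agree n (u n w) 1" "\<And>n. fps_agree n (l n) 0"
    and "\<And>n. has_coeff_deriv (u n) (u n z * l n) z"
  shows "has_coeff_deriv (\<lambda>w. fps_prodinf (\<lambda>n. u n w)) (fps_prodinf (\<lambda>n. u n z) * fps_suminf l) z"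
proof -
  have fin: "has_coeff_deriv (\<lambda>w. \<Prod>n<M. u n w) ((\<Prod>n<M. u n z) * (\<Sum>n<M. l n)) z" for M
  proof (induction M)
    case (Suc M)
    show ?case
      using has_coeff_deriv_mult[OF Suc assms(3)[of M]] by (simp add: algebra_simps)
  qed auto
  show ?thesis
    unfolding has_coeff_deriv_def
  proof
    fix m
    have "fps_agree (Suc m) (fps_prodinf (\<lambda>n. u n z) * fps_suminf l) ((\<Prod>n<Suc m. u n z) * (\<Sum>n<Suc m. l n))"
      by (intro fps_agree_mult fps_prodinf_agree fps_suminf_agree assms order_refl)
    then have "(fps_prodinf (\<lambda>n. u n z) * fps_suminf l) $ m = ((\<Prod>n<Suc m. u n z) * (\<Sum>n<Suc m. l n)) $ m"
      by (simp add: fps_agree_def)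
    then show "((\<lambda>w. fps_prodinf (\<lambda>n. u n w) $ m) has_field_derivative
        (fps_prodinf (\<lambda>n. u n z) * fps_suminf l) $ m) (at z)"
      using fin[of "Suc m"] by (simp add: has_coeff_deriv_def fps_prodinf_def)
  qed
qed

subsection \<open>The Jacobi triple product\<close>

text \<open>The q-Pascal rule makes sense in every commutative ring and avoids division by
  \<open>1 - q ^ i\<close>.\<close>

fun gauss_binomial :: "'a::comm_ring_1 \<Rightarrow> nat \<Rightarrow> nat \<Rightarrow> 'a" where
  "gauss_binomial q n 0 = 1"
| "gauss_binomial q 0 (Suc k) = 0"
| "gauss_binomial q (Suc n) (Suc k) = gauss_binomial q n (Suc k) + q ^ (n - k) * gauss_binomial q n k"

definition qpoch :: "'a::comm_ring_1 \<Rightarrow> nat \<Rightarrow> 'a" where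
  "qpoch q n = (\<Prod>i<n. 1 - q ^ Suc i)"

lemma qpoch_0 [simp]: "qpoch q 0 = 1"
  by (simp add: qpoch_def)

lemma qpoch_Suc: "qpoch q (Suc n) = qpoch q n * (1 - q ^ Suc n)"
  by (simp add: qpoch_def)

lemma gauss_binomial_eq_0: "n < k \<Longrightarrow> gauss_binomial q n k = 0"
  by (induction q n k rule: gauss_binomial.induct) auto

text \<open>The quotient formula with denominators cleared. The Pascal rule reduces it to 1 -
  q^(s+t) = (1 - q^s) + q^s (1 - q^t).\<close>

lemma gauss_binomial_qpoch:
  "k \<le> n \<Longrightarrow> gauss_binomial q n k * qpoch q k * qpoch q (n - k) = qpoch q n"
proof (induction n arbitrary: k)
  case (Suc n)
  show ?case
  proof (cases k)
    case (Suc l)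
    then have "l \<le> n" using Suc.prems by simp
    show ?thesis
    proof (cases "l = n")
      case True
      then show ?thesis
        using Suc.IH[of n] by (simp add: \<open>k = Suc l\<close> gauss_binomial_eq_0 qpoch_Suc mult.assoc[symmetric] del: power_Suc)
    next
      case False
      then obtain r where r: "n = Suc (l + r)" using \<open>l \<le> n\<close> less_iff_Suc_add[of l n] by auto
      then have diffs: "n - l = Suc r" "n - Suc l = r" "Suc n - Suc l = Suc r" by auto
      have 1: "gauss_binomial q n (Suc l) * qpoch q (Suc l) * qpoch q r = qpoch q n"
        using Suc.IH[of "Suc l"] r by simp
      have 2: "gauss_binomial q n l * qpoch q l * qpoch q (Suc r) = qpoch q n"
        using Suc.IH[of l] r diffs by simp
      have "gauss_binomial q (Suc n) k * qpoch q k * qpoch q (Suc n - k) =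
        (gauss_binomial q n (Suc l) * qpoch q (Suc l) * qpoch q r) * (1 - q ^ Suc r) +
        q ^ Suc r * (1 - q ^ Suc l) * (gauss_binomial q n l * qpoch q l * qpoch q (Suc r))"
        unfolding \<open>k = Suc l\<close> gauss_binomial.simps diffs qpoch_Suc by (simp add: algebra_simps del: power_Suc)
      also have "\<dots> = qpoch q n * (1 - q ^ (Suc r + Suc l))"
        unfolding 1 2 power_add by (simp add: algebra_simps del: power_Suc)
      also have "Suc r + Suc l = Suc n" using r by simp
      finally show ?thesis by (simp only: qpoch_Suc)
    qed
  qed auto
qed auto

text \<open>The two summands of the last factor \<open>y + x * q ^ n\<close> produce the two terms
  of the Pascal rule. The form homogeneous in \<open>x\<close> and \<open>y\<close> lets
  \<open>y\<close> be a power of the series variable later, so that no negative exponents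
  arise.\<close>

lemma gauss_binomial_theorem:
  fixes x y q :: "'a::comm_ring_1"
  shows "(\<Prod>i<n. y + x * q ^ i) =
    (\<Sum>k\<le>n. q ^ (k choose 2) * gauss_binomial q n k * x ^ k * y ^ (n - k))"
proof (induction n)
  case (Suc n)
  let ?t = "\<lambda>n k. q ^ (k choose 2) * gauss_binomial q n k * x ^ k * y ^ (n - k)"
  have "y * (\<Sum>k\<le>n. ?t n k) = (\<Sum>k\<le>n. q ^ (k choose 2) * gauss_binomial q n k * x ^ k * y ^ (Suc n - k))"
    by (simp add: sum_distrib_left Suc_diff_le mult_ac)
  also have "\<dots> = (\<Sum>k\<le>Suc n. q ^ (k choose 2) * gauss_binomial q n k * x ^ k * y ^ (Suc n - k))"
    by (simp add: gauss_binomial_eq_0)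
  also have "\<dots> = y ^ Suc n + (\<Sum>k\<le>n. q ^ (Suc k choose 2) * gauss_binomial q n (Suc k) * x ^ Suc k * y ^ (n - k))"
    by (subst sum.atMost_Suc_shift) (simp add: numeral_2_eq_2 del: power_Suc)
  finally have 1: "y * (\<Sum>k\<le>n. ?t n k) = y ^ Suc n + (\<Sum>k\<le>n. q ^ (Suc k choose 2) * gauss_binomial q n (Suc k) * x ^ Suc k * y ^ (n - k))" .
  have 2: "x * q ^ n * (\<Sum>k\<le>n. ?t n k) =
    (\<Sum>k\<le>n. q ^ (Suc k choose 2) * (q ^ (n - k) * gauss_binomial q n k) * x ^ Suc k * y ^ (n - k))"
    unfolding sum_distrib_left
  proof (intro sum.cong refl)
    fix k assume "k \<in> {..n}"
    then have "(Suc k choose 2) + (n - k) = n + (k choose 2)"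
      by (simp add: numeral_2_eq_2)
    then have e: "q ^ (Suc k choose 2) * q ^ (n - k) = q ^ n * q ^ (k choose 2)"
      by (simp only: power_add[symmetric])
    have "x * q ^ n * ?t n k = (q ^ (Suc k choose 2) * q ^ (n - k)) * (gauss_binomial q n k * x ^ Suc k * y ^ (n - k))"
      unfolding e by (simp add: mult_ac)
    then show "x * q ^ n * ?t n k =
      q ^ (Suc k choose 2) * (q ^ (n - k) * gauss_binomial q n k) * x ^ Suc k * y ^ (n - k)"
      by (simp only: mult.assoc)
  qed
  have "(\<Prod>i<Suc n. y + x * q ^ i) = y * (\<Sum>k\<le>n. ?t n k) + x * q ^ n * (\<Sum>k\<le>n. ?t n k)"
    using Suc by (simp add: algebra_simps)
  also have "\<dots> = y ^ Suc n + (\<Sum>k\<le>n. ?t (Suc n) (Suc k))"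
    unfolding 1 2 by (simp add: algebra_simps sum.distrib del: power_Suc)
  also have "\<dots> = (\<Sum>k\<le>Suc n. ?t (Suc n) k)"
    by (subst sum.atMost_Suc_shift) (simp add: numeral_2_eq_2 del: power_Suc)
  finally show ?case .
qed (simp add: numeral_2_eq_2)

section \<open>The triple product: exponents, finite form, limit\<close>

text \<open>The exponent that accompanies the \<open>j\<close>-th power of z in the triple product.
  For \<open>c < b\<close> it is nonnegative before \<open>nat\<close> is applied.\<close>

definition theta_exp :: "nat \<Rightarrow> nat \<Rightarrow> int \<Rightarrow> nat" where
  "theta_exp b c j = nat (int b * (j * (j - 1) div 2) + int c * j)"

text \<open>Serves to treat the exponents as polynomials in \<open>j\<close>, and to bound the
  \<open>j\<close> that contribute to a given coefficient.\<close>

lemma theta_exp: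
  assumes "c < b"
  shows "2 * int (theta_exp b c j) = int b * (j * (j - 1)) + 2 * int c * j"
    and "\<bar>j\<bar> - 1 \<le> int (theta_exp b c j)"
proof -
  define t where "t = j * (j - 1) div 2"
  have t: "2 * t = j * (j - 1)" by (simp add: t_def)
  \<comment> \<open>\<open>t\<close> and \<open>t + j\<close> are the triangular numbers j(j-1)/2
    and j(j+1)/2.\<close>
  have t0: "0 \<le> t \<and> 0 \<le> t + j \<and> \<bar>j\<bar> - 1 \<le> t"
  proof (cases "j \<ge> 1")
    case True
    then have "0 \<le> (j - 1) * (j - 2)"
      by (cases "j = 1") auto
    with True t show ?thesis by (simp add: algebra_simps)
  next
    case False
    then have "0 \<le> j * (j + 1)" "0 \<le> j * (j - 1)"
      by (cases "j = 0"; simp add: mult_nonpos_nonpos)+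
    with False t have "0 \<le> t + j" "0 \<le> t" by (simp_all add: algebra_simps)
    with False show ?thesis by linarith
  qed
  have "int c * (t + j) \<le> int b * t + int c * j"
    using t0 assms by (simp add: algebra_simps mult_left_mono)
  then have nonneg: "0 \<le> int b * t + int c * j"
    using t0 by (meson mult_nonneg_nonneg of_nat_0_le_iff order_trans)
  have e: "int (theta_exp b c j) = int b * t + int c * j"
    using nonneg by (simp add: theta_exp_def t_def)
  show "2 * int (theta_exp b c j) = int b * (j * (j - 1)) + 2 * int c * j"
    unfolding e t[symmetric] by (simp add: algebra_simps)
  show "\<bar>j\<bar> - 1 \<le> int (theta_exp b c j)"
  proof (cases "j \<ge> 0")
    case True
    have "1 * t \<le> int b * t" using t0 assms by (intro mult_right_mono) auto
    moreover have "0 \<le> int c * j" using True by simp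
    ultimately show ?thesis using e t0 by linarith
  next
    case False
    \<comment> \<open>For negative \<open>j\<close> the smallest exponent occurs at
      \<open>c = b - 1\<close>, where it equals \<open>(b - 1) * (t + j) + t\<close>.\<close>
    have "(int b - 1) * (t + j) + t = int b * t + (int b - 1) * j"
      by (simp add: algebra_simps)
    moreover have "0 \<le> (int b - 1) * (t + j)" using assms t0 by simp
    moreover have "(int b - 1) * j \<le> int c * j"
      using False assms by (intro mult_right_mono_neg) auto
    ultimately show ?thesis using e t0 by linarith
  qed
qed

text \<open>This is the q-binomial theorem for \<open>2 * N\<close> factors with base Q =
  \<open>fps_X ^ b\<close> and y = Q^N. The factors from index \<open>N\<close> on give the product
  in \<open>z\<close>; those before, taken in reverse order, give the product in
  \<open>inverse z\<close>. The monomial split off on the way is kept on both sides and cancelled at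
  the end.\<close>

lemma finite_triple_product:
  fixes z :: "'a::field"
  assumes z: "z \<noteq> 0" and cb: "c < b"
  shows "(\<Prod>n<N. (1 - fps_const z * fps_X ^ (b * n + c)) * (1 - fps_const (inverse z) * fps_X ^ (b * Suc n - c))) =
    (\<Sum>k\<le>2 * N. fps_const ((- z) powi (int k - int N)) * fps_X ^ theta_exp b c (int k - int N)
       * gauss_binomial (fps_X ^ b) (2 * N) k)"
    (is "?L = ?R")
proof -
  let ?Q = "fps_X ^ b :: 'a fps"
  let ?x = "- fps_const z * fps_X ^ c"
  \<comment> \<open>The power of \<open>fps_X\<close> split off from all \<open>2 * N\<close>
    factors together.\<close>
  define E where "E = b * (N choose 2) + b * (N * N) + c * N"
  have ch2: "2 * int (k choose 2) = int k * (int k - 1)" for k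
    by (induction k) (simp_all add: numeral_2_eq_2 algebra_simps)
  have A: "(\<Prod>n<N. ?Q ^ N + ?x * ?Q ^ n) =
    ?Q ^ (N choose 2) * (?x ^ N * (\<Prod>n<N. 1 - fps_const (inverse z) * fps_X ^ (b * Suc n - c)))"
  proof -
    have "(\<Prod>n<N. ?Q ^ N + ?x * ?Q ^ n) = (\<Prod>n<N. ?Q ^ N + ?x * ?Q ^ (N - Suc n))"
      by (rule prod.nat_diff_reindex[symmetric])
    also have "\<dots> = (\<Prod>n<N. ?Q ^ (N - Suc n) * (?x * (1 - fps_const (inverse z) * fps_X ^ (b * Suc n - c))))"
    proof (intro prod.cong refl)
      fix n assume "n \<in> {..<N}"
      then have 1: "?Q ^ N = ?Q ^ (N - Suc n) * ?Q ^ Suc n" by (simp flip: power_add del: power_Suc)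
      have "c \<le> b * Suc n" using cb by (simp add: trans_le_add1)
      then have 2: "?Q ^ Suc n = fps_X ^ c * fps_X ^ (b * Suc n - c)"
        by (simp only: power_mult[symmetric] power_add[symmetric]) simp
      have 3: "fps_const z * fps_const (inverse z) = 1" using z by simp
      have "- u * v * (1 - w * t) = - u * v + (u * w) * (v * t)" for u v w t :: "'a fps"
        by (simp add: algebra_simps)
      then have e: "?x * (1 - fps_const (inverse z) * fps_X ^ (b * Suc n - c)) = ?x + ?Q ^ Suc n"
        unfolding 2 3[symmetric] by (metis 3 mult_1)
      have "u * v + x * u = u * (x + v)" for u v x :: "'a fps"
        by (simp add: algebra_simps)
      then show "?Q ^ N + ?x * ?Q ^ (N - Suc n) =
        ?Q ^ (N - Suc n) * (?x * (1 - fps_const (inverse z) * fps_X ^ (b * Suc n - c)))"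
        unfolding e 1 .
    qed
    also have "\<dots> = (\<Prod>n<N. ?Q ^ (N - Suc n)) * (?x ^ N * (\<Prod>n<N. 1 - fps_const (inverse z) * fps_X ^ (b * Suc n - c)))"
      by (simp only: prod.distrib prod_constant card_lessThan power_mult_distrib)
    also have "(\<Prod>n<N. ?Q ^ (N - Suc n)) = (\<Prod>n<N. ?Q ^ n)"
      by (rule prod.nat_diff_reindex)
    also have "\<dots> = ?Q ^ (N choose 2)"
      by (induction N) (simp_all add: numeral_2_eq_2 power_add mult_ac)
    finally show ?thesis .
  qed
  have B: "(\<Prod>n<N. ?Q ^ N + ?x * ?Q ^ (N + n)) = ?Q ^ (N * N) * (\<Prod>n<N. 1 - fps_const z * fps_X ^ (b * n + c))"
  proof -
    have "(\<Prod>n<N. ?Q ^ N + ?x * ?Q ^ (N + n)) = (\<Prod>n<N. ?Q ^ N * (1 - fps_const z * fps_X ^ (b * n + c)))"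
      by (intro prod.cong) (simp_all add: algebra_simps flip: power_mult power_add)
    then show ?thesis by (simp add: prod.distrib power_mult)
  qed
  have xk: "?x ^ k = fps_const ((- z) ^ k) * fps_X ^ (c * k)" for k
    by (simp only: power_mult_distrib fps_const_neg fps_const_power power_mult)
  have "fps_const ((- z) ^ N) * fps_X ^ E * ?L = (\<Prod>n<N. ?Q ^ N + ?x * ?Q ^ n) * (\<Prod>n<N. ?Q ^ N + ?x * ?Q ^ (N + n))"
    unfolding A B prod.distrib unfolding E_def xk power_add power_mult[symmetric] by (simp only: mult_ac)
  also have "\<dots> = (\<Prod>n<2 * N. ?Q ^ N + ?x * ?Q ^ n)"
    using prod.atLeastLessThan_concat[of 0 N "2 * N" "\<lambda>n. ?Q ^ N + ?x * ?Q ^ n"]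
      prod.shift_bounds_nat_ivl[of "\<lambda>n. ?Q ^ N + ?x * ?Q ^ n" 0 N N]
    by (simp add: lessThan_atLeast0 mult_2 add.commute)
  also have "\<dots> = (\<Sum>k\<le>2 * N. ?Q ^ (k choose 2) * gauss_binomial ?Q (2 * N) k * ?x ^ k * (?Q ^ N) ^ (2 * N - k))"
    by (rule gauss_binomial_theorem)
  also have "\<dots> = fps_const ((- z) ^ N) * fps_X ^ E * ?R"
    unfolding sum_distrib_left
  proof (intro sum.cong refl)
    fix k assume k: "k \<in> {..2 * N}"
    let ?j = "int k - int N"
    \<comment> \<open>Doubling both exponents removes the halves hidden in the binomials and in
      \<open>theta_exp\<close>.\<close>
    have "2 * int (b * (k choose 2) + c * k + b * N * (2 * N - k)) = 2 * int (E + theta_exp b c ?j)"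
    proof -
      define r where "r = 2 * N - k"
      have r: "int r = 2 * int N - int k" using k by (auto simp: r_def)
      have "2 * int (b * (k choose 2) + c * k + b * N * r) =
        int b * (2 * int (k choose 2)) + 2 * int c * int k + 2 * int b * int N * int r"
        by (simp add: algebra_simps)
      moreover have "2 * int (E + theta_exp b c ?j) =
        int b * (2 * int (N choose 2)) + 2 * int b * (int N * int N) + 2 * int c * int N + 2 * int (theta_exp b c ?j)"
        by (simp add: E_def algebra_simps)
      ultimately show ?thesis
        unfolding r_def[symmetric] r ch2 theta_exp(1)[OF cb] by (simp add: algebra_simps)
    qed
    then have ex: "b * (k choose 2) + c * k + b * N * (2 * N - k) = E + theta_exp b c ?j" by (metis mult_cancel_left of_nat_eq_iff zero_neq_numeral)
    have "(- z) ^ k = (- z) ^ N * (- z) powi ?j"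
      using z by (subst power_int_diff) (auto simp: power_int_def)
    then have c: "fps_const ((- z) ^ k) = fps_const ((- z) ^ N) * fps_const ((- z) powi ?j)"
      by simp
    have "?Q ^ (k choose 2) * gauss_binomial ?Q (2 * N) k * ?x ^ k * (?Q ^ N) ^ (2 * N - k) =
      fps_const ((- z) ^ k) * fps_X ^ (b * (k choose 2) + c * k + b * N * (2 * N - k)) * gauss_binomial ?Q (2 * N) k"
      unfolding xk power_add power_mult[symmetric] by (simp only: mult_ac)
    then show "?Q ^ (k choose 2) * gauss_binomial ?Q (2 * N) k * ?x ^ k * (?Q ^ N) ^ (2 * N - k) =
      fps_const ((- z) ^ N) * fps_X ^ E * (fps_const ((- z) powi ?j) * fps_X ^ theta_exp b c ?j * gauss_binomial ?Q (2 * N) k)"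
      unfolding ex c power_add by (simp add: mult_ac)
  qed
  finally have "fps_const ((- z) ^ N) * fps_X ^ E * ?L = fps_const ((- z) ^ N) * fps_X ^ E * ?R" .
  moreover have "fps_const ((- z) ^ N) * fps_X ^ E \<noteq> 0"
    using z by (simp add: fps_const_eq_0_iff)
  ultimately show ?thesis using mult_left_cancel by blast
qed

text \<open>The truncated subtraction \<open>b * Suc n - c\<close> is a true one when
  \<open>c < b\<close>.\<close>

definition triple_factor :: "nat \<Rightarrow> nat \<Rightarrow> nat \<Rightarrow> 'a::field \<Rightarrow> 'a fps" where
  "triple_factor b c n z = (1 - fps_const z * fps_X ^ (b * n + c)) *
     (1 - fps_const (inverse z) * fps_X ^ (b * Suc n - c)) * (1 - fps_X ^ (b * Suc n))"

lemma triple_factor_agree: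
  assumes "c < b"
  shows "fps_agree n (triple_factor b c n z) 1"
proof -
  have "n \<le> b * n" using assms by (cases b) auto
  then have le: "n \<le> b * n + c" "n \<le> b * Suc n - c" "n \<le> b * Suc n"
    using assms unfolding mult_Suc_right by linarith+
  show ?thesis
    using fps_agree_mult[OF fps_agree_mult[OF fps_agree_one_minus[OF le(1)] fps_agree_one_minus[OF le(2)]]
        fps_agree_one_minus[OF le(3), of 1]]
    by (simp add: triple_factor_def)
qed

text \<open>After multiplication by \<open>qpoch ?Q N\<close>, each Gaussian binomial of the finite
  identity is 1 up to an order which, added to the exponent of its term, exceeds \<open>m\<close>.
  So coefficient \<open>m\<close> collects exactly the \<open>j\<close> with exponent
  \<open>m\<close>.\<close>

theorem jacobi_triple_product:
  fixes z :: "'a::field"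
  assumes z: "z \<noteq> 0" and cb: "c < b"
  shows "fps_prodinf (\<lambda>n. triple_factor b c n z) $ m = (\<Sum>j | theta_exp b c j = m. (- z) powi j)"
proof -
  \<comment> \<open>The 2 covers two losses of one: coefficient \<open>r\<close> requires agreement
    to order \<open>r + 1\<close>, and the exponent is only known to be at least |j| - 1.\<close>
  define N where "N = m + 2"
  let ?Q = "fps_X ^ b :: 'a fps"
  let ?e = "\<lambda>k. theta_exp b c (int k - int N)"
  have Q1: "fps_agree n (1 - ?Q ^ Suc n) 1" for n
  proof -
    have "n \<le> b * Suc n" using cb by (cases b) auto
    from fps_agree_one_minus[OF this, of 1] show ?thesis by (simp add: power_mult[symmetric] del: power_Suc)
  qed
  have qpoch_agree: "fps_agree r (qpoch ?Q n) (qpoch ?Q n')" if "r \<le> n" "r \<le> n'" for r n n'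
    unfolding qpoch_def
    using prod_agree_tail[OF Q1 that(1)] prod_agree_tail[OF Q1 that(2), THEN fps_agree_sym]
    by (rule fps_agree_trans)
  have gb: "fps_agree r (gauss_binomial ?Q (2 * N) k * qpoch ?Q N) 1"
    if "k \<le> 2 * N" "r \<le> k" "r \<le> 2 * N - k" "r \<le> N" for r k
  proof (rule fps_agree_cancel_left)
    let ?g = "gauss_binomial ?Q (2 * N) k"
    have "qpoch ?Q N * (?g * qpoch ?Q N) = ?g * qpoch ?Q N * qpoch ?Q N"
      by (simp add: mult_ac)
    also have "fps_agree r \<dots> (?g * qpoch ?Q k * qpoch ?Q (2 * N - k))"
      using that by (intro fps_agree_mult fps_agree_refl qpoch_agree)
    also have "?g * qpoch ?Q k * qpoch ?Q (2 * N - k) = qpoch ?Q (2 * N)"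
      using that by (intro gauss_binomial_qpoch)
    also have "fps_agree r \<dots> (qpoch ?Q N * 1)"
      using qpoch_agree[of r "2 * N" N] that by simp
    finally show "fps_agree r (qpoch ?Q N * (?g * qpoch ?Q N)) (qpoch ?Q N * 1)" .
    have "qpoch ?Q n $ 0 = 1" for n
      using cb by (induction n) (auto simp: qpoch_Suc)
    then show "qpoch ?Q N $ 0 \<noteq> 0" by simp
  qed
  have coeff: "(fps_const ((- z) powi (int k - int N)) * fps_X ^ ?e k * gauss_binomial ?Q (2 * N) k * qpoch ?Q N) $ m =
    (if ?e k = m then (- z) powi (int k - int N) else 0)" if k: "k \<le> 2 * N" for k
  proof -
    have eq: "(fps_const ((- z) powi (int k - int N)) * fps_X ^ ?e k * gauss_binomial ?Q (2 * N) k * qpoch ?Q N) $ m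
       = (- z) powi (int k - int N) * (if m < ?e k then 0 else (gauss_binomial ?Q (2 * N) k * qpoch ?Q N) $ (m - ?e k))"
      by (simp add: mult.assoc fps_X_power_mult_nth)
    have "(gauss_binomial ?Q (2 * N) k * qpoch ?Q N) $ (m - ?e k) = (1 :: 'a fps) $ (m - ?e k)" if "\<not> m < ?e k"
    proof -
      have "fps_agree (Suc (m - ?e k)) (gauss_binomial ?Q (2 * N) k * qpoch ?Q N) 1"
        using theta_exp(2)[OF cb, of "int k - int N"] that k by (intro gb) (auto simp: N_def)
      then show ?thesis by (simp add: fps_agree_def)
    qed
    with eq show ?thesis by auto
  qed
  have "fps_prodinf (\<lambda>n. triple_factor b c n z) $ m = (\<Prod>n<N. triple_factor b c n z) $ m"
    using fps_prodinf_agree[where u = "\<lambda>n. triple_factor b c n z", OF triple_factor_agree[OF cb], of "Suc m" N] by (simp add: fps_agree_def N_def)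
  also have "(\<Prod>n<N. triple_factor b c n z) =
    (\<Sum>k\<le>2 * N. fps_const ((- z) powi (int k - int N)) * fps_X ^ ?e k * gauss_binomial ?Q (2 * N) k * qpoch ?Q N)"
    unfolding triple_factor_def prod.distrib[of _ "\<lambda>n. 1 - fps_X ^ (b * Suc n)"] finite_triple_product[OF z cb]
      sum_distrib_right qpoch_def power_mult[symmetric] ..
  also have "\<dots> $ m = (\<Sum>k\<le>2 * N. if ?e k = m then (- z) powi (int k - int N) else 0)"
    unfolding fps_sum_nth by (intro sum.cong refl coeff) auto
  also have "\<dots> = (\<Sum>k | k \<le> 2 * N \<and> ?e k = m. (- z) powi (int k - int N))"
    by (subst sum.inter_filter[symmetric]) simp_all
  also have "\<dots> = (\<Sum>j | theta_exp b c j = m. (- z) powi j)"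
  proof (rule sum.reindex_bij_witness[of _ "\<lambda>j. nat (j + int N)" "\<lambda>k. int k - int N"])
    fix j assume "j \<in> {j. theta_exp b c j = m}"
    moreover from this have "\<bar>j\<bar> \<le> int N" using theta_exp(2)[OF cb, of j] by (auto simp: N_def)
    ultimately show "nat (j + int N) \<in> {k. k \<le> 2 * N \<and> ?e k = m}" "int (nat (j + int N)) - int N = j"
      by auto
  qed auto
  finally show ?thesis .
qed

subsection \<open>Logarithmic derivatives and Jacobi's identity\<close>

text \<open>The expansion of z q^a / (1 - z q^a) for positive \<open>a\<close>. The next series is
  its derivative in \<open>z\<close> at 1.\<close>

definition fps_geo :: "'a::comm_ring_1 \<Rightarrow> nat \<Rightarrow> 'a fps" where
  "fps_geo z a = Abs_fps (\<lambda>m. if a dvd m \<and> m > 0 then z ^ (m div a) else 0)"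

definition fps_geo_deriv :: "nat \<Rightarrow> 'a::comm_ring_1 fps" where
  "fps_geo_deriv a = Abs_fps (\<lambda>m. if a dvd m then of_nat (m div a) else 0)"

lemma fps_geo_mult:
  assumes "a > 0"
  shows "(1 - fps_const z * fps_X ^ a) * fps_geo z a = fps_const z * fps_X ^ a"
proof (rule fps_ext)
  fix m
  have "((1 - fps_const z * fps_X ^ a) * fps_geo z a) $ m =
    fps_geo z a $ m - z * (if m < a then 0 else fps_geo z a $ (m - a))"
    by (simp add: left_diff_distrib mult.assoc fps_X_power_mult_nth)
  also have "\<dots> = (fps_const z * fps_X ^ a) $ m"
  proof (cases "m > a \<and> a dvd m")
    case True
    then obtain k where "m = a * k" by blast
    with True obtain l where "m = a * Suc (Suc l)"
      using assms by (cases k; cases "k - 1") auto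
    moreover have "(a * Suc (Suc l) - a) div a = Suc l"
      using assms nonzero_mult_div_cancel_left[of a "Suc l"] by simp
    ultimately show ?thesis using assms by (simp add: fps_geo_def)
  next
    case False
    moreover have "m = 0" if "m < a" "a dvd m"
      using that nat_dvd_not_less[of m a] by auto
    ultimately show ?thesis using assms
      by (cases m a rule: linorder_cases) (auto simp: fps_geo_def dvd_minus_self)
  qed
  finally show "((1 - fps_const z * fps_X ^ a) * fps_geo z a) $ m = (fps_const z * fps_X ^ a) $ m" .
qed

lemma fps_geo_agree:
  assumes "n \<le> a"
  shows "fps_agree n (fps_geo z a) 0" and "fps_agree n (fps_geo_deriv a) 0"
  using assms by (auto simp: fps_agree_def fps_geo_def fps_geo_deriv_def dest: dvd_imp_le)

lemma has_coeff_deriv_geo: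
  "has_coeff_deriv (\<lambda>w. fps_geo w a) (fps_geo_deriv a) (1 :: complex)"
  unfolding has_coeff_deriv_def
proof
  fix m
  show "((\<lambda>w. fps_geo w a $ m) has_field_derivative fps_geo_deriv a $ m) (at (1 :: complex))"
    by (cases "a dvd m \<and> m > 0") (auto simp: fps_geo_def fps_geo_deriv_def intro!: derivative_eq_intros)
qed

lemma has_coeff_deriv_geo_inverse:
  "has_coeff_deriv (\<lambda>w. fps_geo (inverse w) a) (- fps_geo_deriv a) (1 :: complex)"
  unfolding has_coeff_deriv_def
proof
  fix m
  show "((\<lambda>w. fps_geo (inverse w) a $ m) has_field_derivative (- fps_geo_deriv a) $ m) (at (1 :: complex))"
    by (cases "a dvd m \<and> m > 0") (auto simp: fps_geo_def fps_geo_deriv_def intro!: derivative_eq_intros)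
qed

lemma has_coeff_deriv_diff:
  "has_coeff_deriv F F' z \<Longrightarrow> has_coeff_deriv G G' z \<Longrightarrow> has_coeff_deriv (\<lambda>w. F w - G w) (F' - G') z"
  unfolding has_coeff_deriv_def by (auto intro: derivative_intros)

lemma has_coeff_deriv_const_mult:
  fixes z :: "'a::real_normed_field"
  assumes "(f has_field_derivative f') (at z)"
  shows "has_coeff_deriv (\<lambda>w. fps_const (f w) * F) (fps_const f' * F) z"
  unfolding has_coeff_deriv_def using assms by (auto intro!: derivative_eq_intros)

lemma has_coeff_deriv_transform:
  assumes "has_coeff_deriv F F' z" "open A" "z \<in> A" "\<And>w. w \<in> A \<Longrightarrow> F w = G w"
  shows "has_coeff_deriv G F' z"
  unfolding has_coeff_deriv_def
proof
  fix m
  show "((\<lambda>w. G w $ m) has_field_derivative F' $ m) (at z)"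
    by (rule has_field_derivative_transform_within_open[where f = "\<lambda>w. F w $ m" and S = A])
      (use assms in \<open>auto simp: has_coeff_deriv_def\<close>)
qed

text \<open>The logarithmic derivative in \<open>z\<close> of (1 - z q^a)(1 - q^b / z).\<close>

definition theta_log_deriv :: "nat \<Rightarrow> nat \<Rightarrow> complex \<Rightarrow> complex fps" where
  "theta_log_deriv a b z = fps_const (inverse z) * (fps_geo (inverse z) b - fps_geo z a)"

lemma has_coeff_deriv_factor:
  fixes C :: "complex fps"
  assumes "z \<noteq> 0" "a > 0" "b > 0"
  shows "has_coeff_deriv (\<lambda>w. (1 - fps_const w * fps_X ^ a) * (1 - fps_const (inverse w) * fps_X ^ b) * C)
     ((1 - fps_const z * fps_X ^ a) * (1 - fps_const (inverse z) * fps_X ^ b) * C * theta_log_deriv a b z) z"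
proof -
  let ?A = "1 - fps_const z * fps_X ^ a" and ?B = "1 - fps_const (inverse z) * fps_X ^ b"
  have 1: "has_coeff_deriv (\<lambda>w. 1 - fps_const w * fps_X ^ a) (?A * (fps_const (inverse z) * - fps_geo z a)) z"
  proof -
    have "fps_const (inverse z) * (?A * fps_geo z a) = (fps_const (inverse z) * fps_const z) * fps_X ^ a"
      unfolding fps_geo_mult[OF assms(2)] by (simp only: mult.assoc)
    then have "?A * (fps_const (inverse z) * - fps_geo z a) = 0 - fps_const 1 * fps_X ^ a"
      using assms(1) by (simp add: mult_ac)
    then show ?thesis
      by (simp only:) (intro has_coeff_deriv_diff has_coeff_deriv_const has_coeff_deriv_const_mult DERIV_ident)
  qed
  have 2: "has_coeff_deriv (\<lambda>w. 1 - fps_const (inverse w) * fps_X ^ b) (?B * (fps_const (inverse z) * fps_geo (inverse z) b)) z"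
  proof -
    have "fps_const (inverse z) * (?B * fps_geo (inverse z) b) = (fps_const (inverse z) * fps_const (inverse z)) * fps_X ^ b"
      unfolding fps_geo_mult[OF assms(3)] by (simp only: mult.assoc)
    then have "?B * (fps_const (inverse z) * fps_geo (inverse z) b) = 0 - fps_const (- (inverse z * inverse z)) * fps_X ^ b"
      by (simp add: mult_ac flip: fps_const_neg)
    moreover have "(inverse has_field_derivative - (inverse z * inverse z)) (at z)"
      using DERIV_inverse[OF assms(1)] by (simp add: power2_eq_square numeral_2_eq_2)
    ultimately show ?thesis
      by (simp only:) (intro has_coeff_deriv_diff has_coeff_deriv_const has_coeff_deriv_const_mult)
  qed
  have e: "(?A * (fps_const (inverse z) * - fps_geo z a) * ?B + ?A * (?B * (fps_const (inverse z) * fps_geo (inverse z) b))) * C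
      + ?A * ?B * 0 = ?A * ?B * C * theta_log_deriv a b z"
    unfolding theta_log_deriv_def by (simp add: algebra_simps)
  show ?thesis
    unfolding e[symmetric] by (rule has_coeff_deriv_mult[OF has_coeff_deriv_mult[OF 1 2] has_coeff_deriv_const])
qed

lemma theta_log_deriv_agree:
  assumes "n \<le> a" "n \<le> b"
  shows "fps_agree n (theta_log_deriv a b z) 0"
  using fps_geo_agree(1)[OF assms(1), of z] fps_geo_agree(1)[OF assms(2), of "inverse z"]
  by (auto simp: theta_log_deriv_def fps_agree_def)

section \<open>Euler's product, pentagonal numbers and their moments\<close>

text \<open>The coefficient ring is left open: the congruences live over the integers, while
  derivatives in z and cube roots of unity call for the complex numbers.\<close>

definition euler_fps :: "'a::comm_ring_1 fps" where
  "euler_fps = fps_prodinf (\<lambda>n. 1 - fps_X ^ Suc n)"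

lemma euler_factor_agree:
  assumes "0 < k"
  shows "fps_agree n (1 - fps_X ^ (k * Suc n) :: 'a::comm_ring_1 fps) 1"
proof -
  have "n \<le> k * Suc n" using assms by (cases k) auto
  from fps_agree_one_minus[OF this, of 1] show ?thesis by simp
qed

lemma euler_factor_agree': "fps_agree n (1 - fps_X ^ Suc n :: 'a::comm_ring_1 fps) 1"
  using euler_factor_agree[of 1 n] by simp

text \<open>The exponents 3n+1, 3n+2, 3n+3 of the three factors run once through all positive
  integers.\<close>

lemma fps_prodinf_triple_factor_3_1:
  "fps_prodinf (\<lambda>n. triple_factor 3 1 n (1 :: 'a::field)) = euler_fps"
proof -
  have "triple_factor 3 1 n (1 :: 'a) = (1 - fps_X ^ Suc (3 * n)) * (1 - fps_X ^ Suc (3 * n + 1)) * (1 - fps_X ^ Suc (3 * n + 2))" for n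
    by (simp add: triple_factor_def numeral_3_eq_3 del: power_Suc)
  then show ?thesis
    unfolding euler_fps_def
    using fps_prodinf_triple[of "\<lambda>n. 1 - fps_X ^ Suc n :: 'a fps", OF euler_factor_agree'] by simp
qed

text \<open>Euler's pentagonal number theorem; \<open>theta_exp 3 1 j\<close> is j(3j-1)/2.\<close>

lemma euler_fps_nth:
  "(euler_fps :: 'a::field fps) $ m = (\<Sum>j | theta_exp 3 1 j = m. (- 1) powi j)"
  using jacobi_triple_product[of "1 :: 'a" 1 3 m] unfolding fps_prodinf_triple_factor_3_1 by simp

text \<open>The Lambert series of n q^n / (1 - q^n), which generates the divisor sums; up to sign it
  is the logarithmic derivative of Euler's product.\<close>

definition euler_lambert :: "'a::comm_ring_1 fps" where
  "euler_lambert = fps_suminf (\<lambda>n. of_nat (Suc n) * fps_geo 1 (Suc n))"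

lemma fps_X_mult_deriv_X_power: "fps_X * fps_deriv (fps_X ^ n) = of_nat n * (fps_X ^ n :: 'a::comm_ring_1 fps)"
  by (induction n) (simp_all add: algebra_simps)

lemma euler_fps_log_deriv: "fps_X * fps_deriv euler_fps = - (euler_fps * (euler_lambert :: 'a::comm_ring_1 fps))"
proof -
  have "fps_X * fps_deriv euler_fps = (euler_fps :: 'a fps) * fps_suminf (\<lambda>n. - (of_nat (Suc n) * fps_geo 1 (Suc n)))"
    unfolding euler_fps_def
  proof (rule fps_prodinf_deriv[OF euler_factor_agree'])
    fix n
    show "fps_agree n (- (of_nat (Suc n) * fps_geo 1 (Suc n)) :: 'a fps) 0"
      using fps_geo_agree(1)[of n "Suc n" "1::'a"] by (auto simp: fps_agree_def simp flip: fps_of_nat)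
    have "(1 - fps_X ^ Suc n) * fps_geo (1::'a) (Suc n) = fps_X ^ Suc n"
      using fps_geo_mult[of "Suc n" "1::'a"] by simp
    then have "(1 - fps_X ^ Suc n) * - (of_nat (Suc n) * fps_geo (1::'a) (Suc n)) = - (of_nat (Suc n) * fps_X ^ Suc n)"
      by (metis mult.left_commute mult_minus_right)
    then show "fps_X * fps_deriv (1 - fps_X ^ Suc n) = (1 - fps_X ^ Suc n) * - (of_nat (Suc n) * fps_geo (1::'a) (Suc n))"
      using fps_X_mult_deriv_X_power[of "Suc n", where ?'a = 'a] by (simp only: fps_deriv_sub fps_deriv_1 right_diff_distrib) simp
  qed
  moreover have "fps_suminf (\<lambda>n. - (of_nat (Suc n) * fps_geo 1 (Suc n))) = - (euler_lambert :: 'a fps)"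
    unfolding euler_lambert_def by (rule fps_ext) (simp add: fps_suminf_def fps_sum_nth sum_negf del: sum.lessThan_Suc)
  ultimately show ?thesis by simp
qed

text \<open>The result of applying z d/dz \<open>k\<close> times to the triple product with
  \<open>b = 3\<close>, \<open>c = 1\<close> and setting z = 1.\<close>

definition pent_moment :: "nat \<Rightarrow> complex fps" where
  "pent_moment k = Abs_fps (\<lambda>m. \<Sum>j | theta_exp 3 1 j = m. (- 1) powi j * of_int j ^ k)"

definition lambert_not3 :: "complex fps" where
  "lambert_not3 = fps_suminf (\<lambda>n. fps_geo_deriv (3 * n + 1) + fps_geo_deriv (3 * n + 2))"

text \<open>If J is the triple product and L its logarithmic derivative in z, then J' = J L and J''
  = J (L^2 + L'), and at z = 1 one has L' = - L - \<open>lambert_not3\<close>. Passing from d/dz to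
  z d/dz absorbs the term - L. The value of L stays open; completing a square eliminates it
  later.\<close>

lemma pent_moments:
  obtains L where "pent_moment 0 = euler_fps" "pent_moment 1 = euler_fps * L"
    "pent_moment 2 = euler_fps * (L\<^sup>2 - lambert_not3)"
proof -
  define l where "l n w = theta_log_deriv (3 * n + 1) (3 * n + 2) w" for n w
  define L where "L w = fps_suminf (\<lambda>n. l n w)" for w
  define J where "J w = fps_prodinf (\<lambda>n. triple_factor 3 1 n w)" for w :: complex
  have J1: "J 1 = euler_fps" unfolding J_def by (rule fps_prodinf_triple_factor_3_1)
  have J': "has_coeff_deriv J (J w * L w) w" if "w \<noteq> 0" for w
    unfolding J_def L_def
  proof (rule has_coeff_deriv_prodinf)
    show "fps_agree n (triple_factor 3 1 n w) 1" for n and w :: complex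
      by (rule triple_factor_agree) simp
    show "fps_agree n (l n w) 0" for n
      unfolding l_def by (rule theta_log_deriv_agree) auto
    show "has_coeff_deriv (triple_factor 3 1 n) (triple_factor 3 1 n w * l n w) w" for n
    proof -
      have "3 * Suc n - 1 = 3 * n + 2" by simp
      then show ?thesis
        using has_coeff_deriv_factor[OF that, of "3 * n + 1" "3 * n + 2" "1 - fps_X ^ (3 * Suc n)"]
        unfolding triple_factor_def l_def by (simp only:)
    qed
  qed
  define D where "D w = Abs_fps (\<lambda>m. \<Sum>j | theta_exp 3 1 j = m. (- 1) powi j * (of_int j * w powi (j - 1)))" for w :: complex
  have Jm: "J w $ m = (\<Sum>j | theta_exp 3 1 j = m. (- 1) powi j * w powi j)" if "w \<noteq> 0" for w m
  proof -
    have "(- w) powi j = (- 1) powi j * w powi j" for j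
      using power_int_mult_distrib[of "-1" w j] by simp
    moreover have "J w $ m = (\<Sum>j | theta_exp 3 1 j = m. (- w) powi j)"
      unfolding J_def by (rule jacobi_triple_product[OF that]) simp
    ultimately show ?thesis by (simp only:)
  qed
  \<comment> \<open>Proved for all nonzero \<open>w\<close> and not only at 1, because the identity
    is differentiated once more.\<close>
  have D: "D w = J w * L w" if "w \<noteq> 0" for w
  proof (rule has_coeff_deriv_unique)
    show "has_coeff_deriv J (J w * L w) w" by (rule J'[OF that])
    have "has_coeff_deriv (\<lambda>w. Abs_fps (\<lambda>m. \<Sum>j | theta_exp 3 1 j = m. (- 1) powi j * w powi j)) (D w) w"
      unfolding has_coeff_deriv_def D_def using that
      by (auto intro!: derivative_eq_intros sum.cong)
    then show "has_coeff_deriv J (D w) w"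
      by (rule has_coeff_deriv_transform[where A = "- {0}"]) (use that in \<open>auto simp: Jm fps_eq_iff\<close>)
  qed
  define D2 where "D2 = Abs_fps (\<lambda>m. \<Sum>j | theta_exp 3 1 j = m. (- 1) powi j * (of_int j * (of_int j - 1 :: complex)))"
  have l': "has_coeff_deriv (l n) (- l n 1 - (fps_geo_deriv (3 * n + 1) + fps_geo_deriv (3 * n + 2))) 1" for n
  proof -
    have "(inverse has_field_derivative - (1 :: complex)) (at 1)"
      using DERIV_inverse[of "1 :: complex"] by simp
    then have a: "has_coeff_deriv (\<lambda>w. fps_const (inverse w) * 1) (fps_const (- 1) * 1) (1 :: complex)"
      by (rule has_coeff_deriv_const_mult)
    show ?thesis
      using has_coeff_deriv_mult[OF a has_coeff_deriv_diff[OF has_coeff_deriv_geo_inverse[of "3 * n + 2"] has_coeff_deriv_geo[of "3 * n + 1"]]]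
      unfolding l_def[abs_def] theta_log_deriv_def by (simp add: algebra_simps flip: fps_const_neg)
  qed
  have L': "has_coeff_deriv L (- L 1 - lambert_not3) 1"
  proof -
    have "fps_suminf (\<lambda>n. - l n 1 - (fps_geo_deriv (3 * n + 1) + fps_geo_deriv (3 * n + 2))) = - L 1 - lambert_not3"
      unfolding L_def lambert_not3_def
      by (rule fps_ext) (simp add: fps_suminf_def fps_sum_nth sum_subtractf sum_negf sum.distrib)
    then show ?thesis
      using has_coeff_deriv_suminf[of l, OF l'] unfolding L_def[abs_def] by simp
  qed
  have D2: "D2 = J 1 * L 1 * L 1 + J 1 * (- L 1 - lambert_not3)"
  proof (rule has_coeff_deriv_unique)
    show "has_coeff_deriv (\<lambda>w. J w * L w) (J 1 * L 1 * L 1 + J 1 * (- L 1 - lambert_not3)) 1"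
      by (rule has_coeff_deriv_mult[OF J' L']) simp
    have "has_coeff_deriv D D2 1"
      unfolding has_coeff_deriv_def D2_def D_def
      by (auto intro!: derivative_eq_intros sum.cong)
    then show "has_coeff_deriv (\<lambda>w. J w * L w) D2 1"
      by (rule has_coeff_deriv_transform[where A = "- {0}"]) (auto simp: D)
  qed
  show ?thesis
  proof
    show "pent_moment 0 = euler_fps"
      by (rule fps_ext) (simp add: pent_moment_def euler_fps_nth)
    have "pent_moment 1 = D 1" by (simp add: pent_moment_def D_def)
    then show m1: "pent_moment 1 = euler_fps * L 1" using D[of 1] J1 by simp
    have "pent_moment 2 = D2 + pent_moment 1"
      by (rule fps_ext) (simp add: pent_moment_def D2_def sum.distrib[symmetric] algebra_simps power2_eq_square)
    then show "pent_moment 2 = euler_fps * ((L 1)\<^sup>2 - lambert_not3)"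
      unfolding m1 D2 J1 by (simp add: algebra_simps power2_eq_square)
  qed
qed

text \<open>Coefficient m of the left side is the sum of m/d over the divisors d of m that are prime
  to 3. The divisors d = 3e make up the divisor sum of m/3.\<close>

lemma lambert_not3:
  "(lambert_not3 :: complex fps) = euler_lambert - (euler_lambert oo fps_X ^ 3)"
proof (rule fps_ext)
  fix m
  have el: "(euler_lambert :: complex fps) $ n = (\<Sum>d | d dvd n. of_nat (n div d))" if "n > 0" for n
  proof -
    have "(euler_lambert :: complex fps) $ n = (\<Sum>i<Suc n. if Suc i dvd n then of_nat (Suc i) else 0)"
      using that unfolding euler_lambert_def fps_suminf_def fps_sum_nth fps_nth_Abs_fps
      by (intro sum.cong refl) (auto simp: fps_geo_def simp flip: fps_of_nat)
    also have "\<dots> = (\<Sum>d\<in>{1..Suc n}. if d dvd n then of_nat d else 0)"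
      by (rule sum.reindex_bij_witness[of _ "\<lambda>d. d - 1" Suc]) auto
    also have "\<dots> = (\<Sum>d | d dvd n. of_nat d)"
      unfolding sum.inter_filter[symmetric, OF finite_atLeastAtMost]
      using that by (intro sum.cong) (auto dest: dvd_imp_le simp: Suc_le_eq dvd_pos_nat le_SucI)
    also have "\<dots> = (\<Sum>d | d dvd n. of_nat (n div d))"
      using that by (intro sum.reindex_bij_witness[of _ "\<lambda>d. n div d" "\<lambda>d. n div d"]) (auto elim!: dvdE)
    finally show ?thesis .
  qed
  have el0: "(euler_lambert :: complex fps) $ 0 = 0"
    by (simp add: euler_lambert_def fps_suminf_def fps_geo_def)
  show "lambert_not3 $ m = (euler_lambert - (euler_lambert oo fps_X ^ 3) :: complex fps) $ m"
  proof (cases "m = 0")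
    case True
    then show ?thesis
      unfolding fps_sub_nth fps_nth_compose_X_power
      by (simp add: el0) (simp add: lambert_not3_def fps_suminf_def fps_geo_deriv_def)
  next
    case False
    then have m: "m > 0" by simp
    have fin: "finite {d. d dvd m}" using m by simp
    define h :: "nat \<Rightarrow> complex" where "h d = (if d dvd m then of_nat (m div d) else 0)" for d
    have "lambert_not3 $ m = (\<Sum>n<Suc m. h (3 * n + 1) + h (3 * n + 2))"
      by (simp add: lambert_not3_def fps_suminf_def fps_sum_nth fps_geo_deriv_def h_def)
    also have "\<dots> = (\<Sum>d<3 * Suc m. if \<not> 3 dvd d then h d else 0)"
    proof -
      have "(\<Sum>d<3 * N. if \<not> 3 dvd d then h d else 0) = (\<Sum>n<N. h (3 * n + 1) + h (3 * n + 2))" for N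
      proof (induction N)
        case (Suc N)
        have 3: "3 * Suc N = Suc (Suc (Suc (3 * N)))" by simp
        have "\<not> 3 dvd Suc (3 * N)" "\<not> 3 dvd Suc (Suc (3 * N))" by presburger+
        then show ?case unfolding 3 using Suc by simp
      qed simp
      from this[of "Suc m"] show ?thesis by (simp only:)
    qed
    also have "\<dots> = (\<Sum>d | d dvd m \<and> \<not> 3 dvd d. of_nat (m div d))"
    proof -
      have "(\<Sum>d<3 * Suc m. if \<not> 3 dvd d then h d else 0) = (\<Sum>d<3 * Suc m. if d dvd m \<and> \<not> 3 dvd d then of_nat (m div d) else 0)"
        by (intro sum.cong) (auto simp: h_def)
      also have "\<dots> = (\<Sum>d | d \<in> {..<3 * Suc m} \<and> d dvd m \<and> \<not> 3 dvd d. of_nat (m div d))"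
        by (rule sum.inter_filter[symmetric]) simp
      also have "{d. d \<in> {..<3 * Suc m} \<and> d dvd m \<and> \<not> 3 dvd d} = {d. d dvd m \<and> \<not> 3 dvd d}"
        using m by (fastforce dest: dvd_imp_le)
      finally show ?thesis .
    qed
    also have "\<dots> = (\<Sum>d | d dvd m. of_nat (m div d)) - (\<Sum>d | d dvd m \<and> 3 dvd d. of_nat (m div d))"
    proof -
      have "{d. d dvd m} = {d. d dvd m \<and> \<not> 3 dvd d} \<union> {d. d dvd m \<and> 3 dvd d}" by auto
      moreover have "finite {d. d dvd m \<and> \<not> 3 dvd d}" "finite {d. d dvd m \<and> 3 dvd d}"
        by (rule finite_subset[OF _ fin]; blast)+
      moreover have "{d. d dvd m \<and> \<not> 3 dvd d} \<inter> {d. d dvd m \<and> 3 dvd d} = {}" by blast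
      ultimately have "(\<Sum>d | d dvd m. of_nat (m div d) :: complex) =
        (\<Sum>d | d dvd m \<and> \<not> 3 dvd d. of_nat (m div d)) + (\<Sum>d | d dvd m \<and> 3 dvd d. of_nat (m div d))"
        by (simp only: sum.union_disjoint)
      then show ?thesis by simp
    qed
    also have "(\<Sum>d | d dvd m \<and> 3 dvd d. of_nat (m div d)) = ((euler_lambert :: complex fps) oo fps_X ^ 3) $ m"
    proof (cases "3 dvd m")
      case True
      then obtain k where k: "m = 3 * k" by blast
      then have "k > 0" using m by simp
      have "(\<Sum>d | d dvd m \<and> 3 dvd d. of_nat (m div d) :: complex) = (\<Sum>d | d dvd k. of_nat (k div d))"
        unfolding k by (rule sum.reindex_bij_witness[of _ "\<lambda>d. 3 * d" "\<lambda>d. d div 3"]) auto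
      then show ?thesis
        unfolding fps_nth_compose_X_power k using el[OF \<open>k > 0\<close>] by simp
    next
      case False
      then have none: "{d. d dvd m \<and> 3 dvd d} = {}" by (auto intro: dvd_trans)
      show ?thesis unfolding fps_nth_compose_X_power none using False by simp
    qed
    finally show ?thesis using el[OF m] by simp
  qed
qed

section \<open>Jacobi's formula for the cube of Euler's product\<close>

lemma fps_prodinf_Suc:
  assumes "\<And>n. fps_agree n (u n) 1" "\<And>n. fps_agree n (u (Suc n)) 1"
  shows "fps_prodinf u = u 0 * fps_prodinf (\<lambda>n. u (Suc n))"
proof (rule fps_prodinf_eqI[OF assms(1)])
  show "\<exists>M\<ge>N. fps_agree N (u 0 * fps_prodinf (\<lambda>n. u (Suc n))) (\<Prod>n<M. u n)" for N
    by (intro exI[of _ "Suc N"])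
      (auto simp: prod.lessThan_Suc_shift simp del: prod.lessThan_Suc intro!: fps_agree_mult fps_prodinf_agree assms(2))
qed

text \<open>Differentiate the triple product with \<open>b = 1\<close>, \<open>c = 0\<close> at z =
  1. It has the form (1 - z) V(z), so only - V(1) survives, and V(1) is the cube of Euler's
  product.\<close>

theorem jacobi_identity:
  "((euler_fps :: complex fps) ^ 3) $ m = - (\<Sum>j | theta_exp 1 0 j = m. (- 1) powi j * of_int j)"
proof -
  define v where "v n w = (1 - fps_const w * fps_X ^ Suc n) * (1 - fps_const (inverse w) * fps_X ^ Suc n) * (1 - fps_X ^ Suc n)"
    for n and w :: complex
  define V where "V w = fps_prodinf (\<lambda>n. v n w)" for w
  have a1: "fps_agree n (1 - F * fps_X ^ Suc n) 1" and a2: "fps_agree n (1 - F * fps_X ^ n) 1" for n and F :: "complex fps"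
    by (rule fps_agree_one_minus; simp)+
  have av: "fps_agree n (v n w) 1" for n w
    using fps_agree_mult[OF fps_agree_mult[OF a1 a1] euler_factor_agree'] by (simp add: v_def del: power_Suc)
  have V1: "V 1 = euler_fps ^ 3"
  proof -
    have "V 1 = fps_prodinf (\<lambda>n. (1 - fps_X ^ Suc n) ^ 3)"
      unfolding V_def v_def by (simp add: power3_eq_cube del: power_Suc)
    then show ?thesis
      unfolding euler_fps_def by (simp only: fps_prodinf_power[OF euler_factor_agree'])
  qed
  have J: "fps_prodinf (\<lambda>n. triple_factor 1 0 n w) = (1 - fps_const w) * V w" for w
  proof -
    let ?B = "\<lambda>n. (1 - fps_const (inverse w) * fps_X ^ Suc n) * (1 - fps_X ^ Suc n)"
    have aB: "fps_agree n (?B n) 1" for n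
      using fps_agree_mult[OF a1 euler_factor_agree'] by (simp del: power_Suc)
    have "fps_prodinf (\<lambda>n. triple_factor 1 0 n w) = fps_prodinf (\<lambda>n. (1 - fps_const w * fps_X ^ n) * ?B n)"
      by (simp add: triple_factor_def mult.assoc del: power_Suc)
    also have "\<dots> = fps_prodinf (\<lambda>n. 1 - fps_const w * fps_X ^ n) * fps_prodinf ?B"
      by (rule fps_prodinf_mult[OF a2 aB])
    also have "fps_prodinf (\<lambda>n. 1 - fps_const w * fps_X ^ n) = (1 - fps_const w) * fps_prodinf (\<lambda>n. 1 - fps_const w * fps_X ^ Suc n)"
      using fps_prodinf_Suc[of "\<lambda>n. 1 - fps_const w * fps_X ^ n", OF a2 a1] by simp
    also have "\<dots> * fps_prodinf ?B = (1 - fps_const w) * (fps_prodinf (\<lambda>n. 1 - fps_const w * fps_X ^ Suc n) * fps_prodinf ?B)"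
      by (simp only: mult.assoc)
    also have "fps_prodinf (\<lambda>n. 1 - fps_const w * fps_X ^ Suc n) * fps_prodinf ?B = V w"
      unfolding V_def v_def mult.assoc by (rule fps_prodinf_mult[OF a1 aB, symmetric])
    finally show ?thesis .
  qed
  define l where "l n = theta_log_deriv (Suc n) (Suc n) 1" for n
  have V': "has_coeff_deriv V (V 1 * fps_suminf l) 1"
    unfolding V_def
  proof (rule has_coeff_deriv_prodinf[OF av])
    show "fps_agree n (l n) 0" for n
      unfolding l_def by (rule theta_log_deriv_agree) auto
    show "has_coeff_deriv (v n) (v n 1 * l n) 1" for n
      unfolding v_def l_def by (rule has_coeff_deriv_factor) auto
  qed
  have "has_coeff_deriv (\<lambda>w. 1 - fps_const w * 1) (0 - fps_const 1 * 1) (1 :: complex)"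
    by (intro has_coeff_deriv_diff has_coeff_deriv_const has_coeff_deriv_const_mult DERIV_ident)
  from has_coeff_deriv_mult[OF this V']
  have d1: "has_coeff_deriv (\<lambda>w. (1 - fps_const w) * V w) (- V 1) 1" by simp
  define D where "D = Abs_fps (\<lambda>m. \<Sum>j | theta_exp 1 0 j = m. (- 1) powi j * (of_int j :: complex))"
  have "has_coeff_deriv (\<lambda>w. Abs_fps (\<lambda>m. \<Sum>j | theta_exp 1 0 j = m. (- 1) powi j * w powi j)) D (1 :: complex)"
    unfolding has_coeff_deriv_def D_def by (auto intro!: derivative_eq_intros sum.cong)
  then have "has_coeff_deriv (\<lambda>w. (1 - fps_const w) * V w) D 1"
  proof (rule has_coeff_deriv_transform[where A = "- {0}"])
    fix w :: complex assume "w \<in> - {0}"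
    then have "w \<noteq> 0" by simp
    have "(- w) powi j = (- 1) powi j * w powi j" for j
      using power_int_mult_distrib[of "-1" w j] by simp
    then show "Abs_fps (\<lambda>m. \<Sum>j | theta_exp 1 0 j = m. (- 1) powi j * w powi j) = (1 - fps_const w) * V w"
      unfolding J[symmetric] using jacobi_triple_product[OF \<open>w \<noteq> 0\<close>, of 0 1] by (simp add: fps_eq_iff)
  qed auto
  then have "D = - V 1" using d1 has_coeff_deriv_unique by blast
  then have "euler_fps ^ 3 = - D" using V1 by simp
  then show ?thesis by (simp add: D_def)
qed

subsection \<open>The tenth power of Euler's product\<close>

definition chi4 :: "int \<Rightarrow> int" where
  "chi4 x = (if x mod 4 = 1 then 1 else if x mod 4 = 3 then - 1 else 0)"

definition chi3 :: "int \<Rightarrow> int" where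
  "chi3 x = (if x mod 3 = 1 then 1 else if x mod 3 = 2 then - 1 else 0)"

text \<open>The even quadratic character modulo 12: it is 1 on 1 and 11, and -1 on 5 and 7.\<close>

definition psi :: "int \<Rightarrow> int" where
  "psi x = chi4 x * chi3 x"

lemma chi4_add_mult [simp]: "chi4 (x + 4 * k) = chi4 x"
  by (simp add: chi4_def)

lemma chi3_add_mult [simp]: "chi3 (x + 3 * k) = chi3 x"
  by (simp add: chi3_def)

lemma chi4_minus [simp]: "chi4 (- x) = - chi4 x"
  unfolding chi4_def by presburger

lemma chi3_minus [simp]: "chi3 (- x) = - chi3 x"
  unfolding chi3_def by presburger

lemma chi4_2_minus_1: "chi4 (2 * j - 1) = (if even j then - 1 else 1)"
proof (cases "even j")
  case True
  then obtain k where "j = 2 * k" by blast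
  then show ?thesis using chi4_add_mult[of "- 1" k] by (simp add: chi4_def)
next
  case False
  then obtain k where "j = 2 * k + 1" by (rule oddE)
  then show ?thesis using chi4_add_mult[of 1 k] by (simp add: chi4_def)
qed

lemma chi4_6_minus_1: "chi4 (6 * j - 1) = (if even j then - 1 else 1)"
proof -
  have "6 * j - 1 = 2 * j - 1 + 4 * j" by simp
  then show ?thesis by (simp only: chi4_add_mult chi4_2_minus_1)
qed

lemma chi3_6_minus_1: "chi3 (6 * j - 1) = - 1"
proof -
  have "6 * j - 1 = - 1 + 3 * (2 * j)" by simp
  then have "chi3 (6 * j - 1) = chi3 (- 1)" by (simp only: chi3_add_mult)
  then show ?thesis by (simp add: chi3_def)
qed

lemma psi_minus [simp]: "psi (- x) = psi x"
  by (simp add: psi_def)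

lemma powi_minus_one_cases: "(- 1 :: 'a::field) powi j = (if even j then 1 else - 1)"
  by simp

lemma abs_le_square: "\<bar>x\<bar> \<le> (x :: int)\<^sup>2"
proof (cases "x = 0")
  case False
  then have "\<bar>x\<bar> * 1 \<le> \<bar>x\<bar> * \<bar>x\<bar>" by (intro mult_left_mono) auto
  then show ?thesis by (simp add: power2_eq_square)
qed simp

lemma finite_int_squares: "finite {x::int. x\<^sup>2 = k}"
proof (rule finite_subset)
  show "{x::int. x\<^sup>2 = k} \<subseteq> {- k..k}"
  proof
    fix x :: int assume "x \<in> {x. x\<^sup>2 = k}"
    then show "x \<in> {- k..k}" using abs_le_square[of x] by auto
  qed
qed simp

text \<open>Completing the square. With exponents encoded as squares, products of theta series
  become sums over lattice points on circles.\<close>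

lemma theta_exp_3_1_iff: "theta_exp 3 1 j = m \<longleftrightarrow> (6 * j - 1)\<^sup>2 = 24 * int m + 1"
proof -
  have "2 * int (theta_exp 3 1 j) = 3 * (j * (j - 1)) + 2 * j"
    using theta_exp(1)[of 1 3 j] by simp
  then have "(6 * j - 1)\<^sup>2 = 24 * int (theta_exp 3 1 j) + 1"
    by (simp add: power2_eq_square algebra_simps)
  then show ?thesis by auto
qed

lemma theta_exp_1_0_iff: "theta_exp 1 0 j = m \<longleftrightarrow> (2 * j - 1)\<^sup>2 = 8 * int m + 1"
proof -
  have "2 * int (theta_exp 1 0 j) = j * (j - 1)"
    using theta_exp(1)[of 0 1 j] by simp
  then have "(2 * j - 1)\<^sup>2 = 8 * int (theta_exp 1 0 j) + 1"
    by (simp add: power2_eq_square algebra_simps)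
  then show ?thesis by auto
qed

lemmas theta_exp_iffs = theta_exp_3_1_iff theta_exp_1_0_iff theta_exp_3_1_iff[unfolded One_nat_def] theta_exp_1_0_iff[unfolded One_nat_def]

lemma fps_numeral_mult_nth: "(numeral k * F) $ m = numeral k * (F :: 'a::comm_ring_1 fps) $ m"
  by (simp add: numeral_fps_const)

lemma square_24_1_mod:
  fixes x :: int
  assumes "x\<^sup>2 = 24 * k + 1"
  shows "x mod 6 = 1 \<or> x mod 6 = 5"
proof -
  have 1: "(x * x) mod 6 = 1" using assms unfolding power2_eq_square by presburger
  have "x mod 6 \<in> {0, 1, 2, 3, 4, 5}" by simp presburger
  then show ?thesis using 1 mod_mult_eq[of x 6 x, symmetric] by auto
qed

text \<open>The square roots of 24m + 1 are 1 or 5 modulo 6. Negation exchanges the two classes, and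
  the second one consists of the numbers 6j - 1.\<close>

lemma sum_squares_24_1:
  fixes h :: "int \<Rightarrow> int"
  assumes "\<And>x. h (- x) = h x"
  shows "(\<Sum>x | x\<^sup>2 = 24 * int m + 1. h x) = 2 * (\<Sum>j | theta_exp 3 1 j = m. h (6 * j - 1))"
proof -
  let ?A = "{x::int. x\<^sup>2 = 24 * int m + 1 \<and> x mod 6 = 5}"
  let ?B = "{x::int. x\<^sup>2 = 24 * int m + 1 \<and> x mod 6 = 1}"
  have fin: "finite {x::int. x\<^sup>2 = 24 * int m + 1}" by (rule finite_int_squares)
  have finA: "finite ?A" and finB: "finite ?B" by (rule finite_subset[OF _ fin]; blast)+
  have "{x::int. x\<^sup>2 = 24 * int m + 1} = ?A \<union> ?B" using square_24_1_mod by blast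
  moreover have "?A \<inter> ?B = {}" by auto
  ultimately have "(\<Sum>x | x\<^sup>2 = 24 * int m + 1. h x) = sum h ?A + sum h ?B"
    using finA finB by (simp only: sum.union_disjoint)
  moreover have "sum h ?B = sum h ?A"
    by (rule sum.reindex_bij_witness[of _ uminus uminus]) (auto simp: assms, presburger+)
  moreover have "sum h ?A = (\<Sum>j | theta_exp 3 1 j = m. h (6 * j - 1))"
  proof (rule sum.reindex_bij_witness[of _ "\<lambda>j. 6 * j - 1" "\<lambda>x. (x + 1) div 6"])
    fix x assume x: "x \<in> ?A"
    then have *: "6 * ((x + 1) div 6) - 1 = x" by simp presburger
    then show "6 * ((x + 1) div 6) - 1 = x" "h (6 * ((x + 1) div 6) - 1) = h x" by simp_all
    show "(x + 1) div 6 \<in> {j. theta_exp 3 1 j = m}" using x * by (simp add: theta_exp_iffs)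
  next
    fix j assume "j \<in> {j. theta_exp 3 1 j = m}"
    then show "6 * j - 1 \<in> ?A" by (simp add: theta_exp_iffs) presburger
  qed auto
  ultimately show ?thesis by simp
qed

section \<open>Theta series of weight 3/2 and the 3-dissection of the cube\<close>

text \<open>The theta series with weights \<open>chi4 x * x\<close>, up to a factor 2. It is written
  through moments because its square is obtained from their relation to L.\<close>

definition theta_T :: "complex fps" where
  "theta_T = pent_moment 0 - 6 * pent_moment 1"

lemma two_times_euler_nth:
  "2 * (euler_fps :: complex fps) $ m = of_int (\<Sum>x | x\<^sup>2 = 24 * int m + 1. psi x)"
proof -
  have "psi (6 * j - 1) = (if even j then 1 else - 1)" for j
    by (simp add: psi_def chi4_6_minus_1 chi3_6_minus_1)
  then show ?thesis
    by (simp only: sum_squares_24_1[of psi m, OF psi_minus] euler_fps_nth of_int_mult of_int_sum powi_minus_one_cases)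
      (simp add: if_distrib cong: if_cong)
qed

lemma two_times_theta_T_nth:
  "2 * theta_T $ m = of_int (\<Sum>x | x\<^sup>2 = 24 * int m + 1. chi4 x * x)"
proof -
  have "(\<Sum>x | x\<^sup>2 = 24 * int m + 1. chi4 x * x) = 2 * (\<Sum>j | theta_exp 3 1 j = m. (if even j then - 1 else 1) * (6 * j - 1))"
    using sum_squares_24_1[of "\<lambda>x. chi4 x * x" m] by (simp add: chi4_6_minus_1)
  moreover have "theta_T $ m = (\<Sum>j | theta_exp 3 1 j = m. (- 1) powi j * (1 - 6 * of_int j))"
    by (simp add: theta_T_def pent_moment_def fps_numeral_mult_nth sum_subtractf right_diff_distrib sum_distrib_left mult_ac)
  then have "theta_T $ m = of_int (\<Sum>j | theta_exp 3 1 j = m. (if even j then - 1 else 1) * (6 * j - 1))"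
    unfolding of_int_sum by (simp only:) (intro sum.cong refl, simp)
  ultimately show ?thesis by simp
qed

text \<open>The substitution of 1 - j for j keeps the exponent and changes the parity. Hence the
  signs sum to 0, and 2j may be replaced by 2j - 1 in Jacobi's formula.\<close>

lemma two_times_euler_cube_nth:
  "2 * ((euler_fps :: complex fps) ^ 3) $ m = of_int (\<Sum>x | x\<^sup>2 = 8 * int m + 1. chi4 x * x)"
proof -
  let ?J = "{j. theta_exp 1 0 j = m}"
  have "(\<Sum>x | x\<^sup>2 = 8 * int m + 1. chi4 x * x) = (\<Sum>j\<in>?J. chi4 (2 * j - 1) * (2 * j - 1))"
  proof (rule sum.reindex_bij_witness[of _ "\<lambda>j. 2 * j - 1" "\<lambda>x. (x + 1) div 2"])
    fix x :: int assume x: "x \<in> {x. x\<^sup>2 = 8 * int m + 1}"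
    then have "odd (x\<^sup>2)" by simp
    then have "odd x" by simp
    then have *: "2 * ((x + 1) div 2) - 1 = x" by presburger
    then show "2 * ((x + 1) div 2) - 1 = x"
      "chi4 (2 * ((x + 1) div 2) - 1) * (2 * ((x + 1) div 2) - 1) = chi4 x * x" by simp_all
    show "(x + 1) div 2 \<in> ?J" using x * by (simp add: theta_exp_iffs)
  qed (auto simp: theta_exp_iffs)
  moreover have z: "(\<Sum>j\<in>?J. if even j then - 1 else (1::int)) = 0"
  proof -
    have "(\<Sum>j\<in>?J. if even j then - 1 else (1::int)) = (\<Sum>j\<in>?J. - (if even j then - 1 else (1::int)))"
      by (rule sum.reindex_bij_witness[of _ "\<lambda>j. 1 - j" "\<lambda>j. 1 - j"])
        (auto simp: theta_exp_iffs power2_eq_square algebra_simps)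
    then show ?thesis by (simp add: sum_negf)
  qed
  moreover have "(\<Sum>j\<in>?J. chi4 (2 * j - 1) * (2 * j - 1)) =
    2 * (\<Sum>j\<in>?J. (if even j then - 1 else 1) * j) - (\<Sum>j\<in>?J. if even j then - 1 else 1)"
    unfolding chi4_2_minus_1 by (simp add: sum_distrib_left sum_subtractf[symmetric] algebra_simps)
  moreover have "((euler_fps :: complex fps) ^ 3) $ m = of_int (\<Sum>j\<in>?J. (if even j then - 1 else 1) * j)"
    unfolding jacobi_identity of_int_sum sum_negf[symmetric] by (intro sum.cong refl) simp
  ultimately show ?thesis by simp
qed

definition theta_U :: "complex fps" where
  "theta_U = (euler_fps oo fps_X ^ 3) ^ 3"

lemma theta_U_altdef: "theta_U = euler_fps ^ 3 oo fps_X ^ 3"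
  unfolding theta_U_def by (rule fps_compose_power) simp

text \<open>A root x of 24m + 9 is a multiple of 3, say x = 3y with y^2 = 8k + 1 and m = 3k. The
  sign is the value of \<open>chi4\<close> at 3.\<close>

lemma six_times_theta_U_nth:
  "6 * theta_U $ m = - of_int (\<Sum>x | x\<^sup>2 = 24 * int m + 9. chi4 x * x)"
proof (cases "3 dvd m")
  case True
  then obtain k where k: "m = 3 * k" by blast
  have chi: "chi4 (3 * x) = - chi4 x" for x
    using chi4_add_mult[of "- x" x] by simp
  have "(\<Sum>x | x\<^sup>2 = 24 * int m + 9. chi4 x * x) = (\<Sum>x | x\<^sup>2 = 8 * int k + 1. chi4 (3 * x) * (3 * x))"
  proof (rule sum.reindex_bij_witness[of _ "\<lambda>x. 3 * x" "\<lambda>x. x div 3"])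
    fix x assume x: "x \<in> {x. x\<^sup>2 = 24 * int m + 9}"
    then have "x\<^sup>2 = 3 * (24 * int k + 3)" by (simp add: k)
    then have "3 dvd x\<^sup>2" by (metis dvd_triv_left)
    then have "3 dvd x" using prime_dvd_power[of 3 x 2] by simp
    then obtain y where y: "x = 3 * y" by blast
    then show "3 * (x div 3) = x" "chi4 (3 * (x div 3)) * (3 * (x div 3)) = chi4 x * x" by simp_all
    show "x div 3 \<in> {x. x\<^sup>2 = 8 * int k + 1}" using x by (simp add: y k power2_eq_square)
  qed (auto simp: k power2_eq_square)
  also have "\<dots> = - 3 * (\<Sum>x | x\<^sup>2 = 8 * int k + 1. chi4 x * x)"
    unfolding chi sum_distrib_left by (simp add: mult_ac)
  also have "of_int \<dots> = - 3 * (2 * ((euler_fps :: complex fps) ^ 3) $ k)"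
    unfolding two_times_euler_cube_nth by simp
  finally show ?thesis
    unfolding theta_U_altdef fps_nth_compose_X_power k by simp
next
  case False
  have "{x. x\<^sup>2 = 24 * int m + 9} = {}"
  proof (rule ccontr)
    assume "{x. x\<^sup>2 = 24 * int m + 9} \<noteq> {}"
    then obtain x where x: "x\<^sup>2 = 24 * int m + 9" by blast
    then have "x\<^sup>2 = 3 * (8 * int m + 3)" by simp
    then have "3 dvd x\<^sup>2" by (metis dvd_triv_left)
    then have "3 dvd x" using prime_dvd_power[of 3 x 2] by simp
    then obtain y where "x = 3 * y" by blast
    with x have "3 * y\<^sup>2 = 8 * int m + 3" by (simp add: power2_eq_square)
    then have "3 dvd int m" by presburger
    with False show False by presburger
  qed
  then show ?thesis
    unfolding theta_U_altdef fps_nth_compose_X_power using False by simp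
qed

text \<open>Jacobi's sum runs over x^2 = 8m + 1. For m = 3k this is 24k + 1, which gives
  \<open>theta_T\<close>; for m = 3k + 1 it is 24k + 9, which gives \<open>theta_U\<close>; for m =
  3k + 2 it is 2 modulo 3 and no square.\<close>

lemma euler_cube_dissection:
  "(euler_fps :: complex fps) ^ 3 = (theta_T oo fps_X ^ 3) - 3 * (fps_X * (theta_U oo fps_X ^ 3))"
proof (rule fps_ext)
  fix m
  let ?R = "(theta_T oo fps_X ^ 3) - 3 * (fps_X * (theta_U oo fps_X ^ 3))"
  have R: "?R $ m = (if 3 dvd m then theta_T $ (m div 3) else 0)
      - 3 * (if m = 0 then 0 else if 3 dvd (m - 1) then theta_U $ ((m - 1) div 3) else 0)"
    by (simp add: fps_numeral_mult_nth fps_nth_compose_X_power)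
  have "m mod 3 = 0 \<or> m mod 3 = 1 \<or> m mod 3 = 2" by linarith
  then consider k where "m = 3 * k" | k where "m = 3 * k + 1" | k where "m = 3 * k + 2"
    by (metis add.right_neutral mult_div_mod_eq)
  then have "2 * ((euler_fps :: complex fps) ^ 3) $ m = 2 * ?R $ m"
  proof cases
    case 1
    have "8 * int m + 1 = 24 * int k + 1" using 1 by simp
    moreover have "?R $ m = theta_T $ k"
      unfolding R using 1 by (cases k) (auto, presburger)
    ultimately show ?thesis
      unfolding two_times_euler_cube_nth by (simp add: two_times_theta_T_nth)
  next
    case 2
    have e: "8 * int m + 1 = 24 * int k + 9" using 2 by simp
    have r: "?R $ m = - 3 * theta_U $ k"
      unfolding R using 2 by (auto, presburger)
    have "of_int (\<Sum>x | x\<^sup>2 = 24 * int k + 9. chi4 x * x) = - (6 * theta_U $ k)"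
      using six_times_theta_U_nth[of k] by (metis minus_minus)
    then show ?thesis
      unfolding two_times_euler_cube_nth e r by simp
  next
    case 3
    have "{x::int. x\<^sup>2 = 8 * int m + 1} = {}"
    proof (rule ccontr)
      assume "{x::int. x\<^sup>2 = 8 * int m + 1} \<noteq> {}"
      then obtain x :: int where "x * x = 8 * int m + 1" by (auto simp: power2_eq_square)
      then have 1: "(x * x) mod 3 = 2" using 3 by presburger
      have "x mod 3 \<in> {0, 1, 2}" by simp presburger
      then show False using 1 mod_mult_eq[of x 3 x, symmetric] by auto
    qed
    moreover have "?R $ m = 0" unfolding R using 3 by (auto; presburger)
    ultimately show ?thesis unfolding two_times_euler_cube_nth by simp
  qed
  then show "((euler_fps :: complex fps) ^ 3) $ m = ?R $ m"
    by (metis mult_left_cancel zero_neq_numeral)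
qed

lemma fps_X_deriv_compose_X_power:
  fixes F :: "'a::comm_ring_1 fps"
  assumes "k > 0"
  shows "fps_X * fps_deriv (F oo fps_X ^ k) = of_nat k * ((fps_X * fps_deriv F) oo fps_X ^ k)"
proof (rule fps_ext)
  fix m
  have th: "(fps_X * fps_deriv G) $ i = of_nat i * G $ i" for G :: "'a fps" and i
    by (cases i) auto
  show "(fps_X * fps_deriv (F oo fps_X ^ k)) $ m = (of_nat k * ((fps_X * fps_deriv F) oo fps_X ^ k)) $ m"
    unfolding th fps_nth_compose_X_power
    using assms by (auto simp: fps_nth_compose_X_power th mult_ac simp flip: fps_of_nat elim!: dvdE)
qed

text \<open>A heat equation: since (6j - 1)^2 = 24m + 1, a combination of moments equals 24 q d/dq +
  1 applied to Euler's product f. Division by f leaves a quadratic equation for L, whose completed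
  square is (1 - 6L)^2, and \<open>theta_T\<close> is f (1 - 6L).\<close>

lemma theta_T_square:
  "theta_T ^ 2 = euler_fps ^ 2 * (1 + 12 * euler_lambert - 36 * (euler_lambert oo fps_X ^ 3))"
proof -
  obtain L where L: "pent_moment 0 = euler_fps" "pent_moment 1 = euler_fps * L"
    "pent_moment 2 = euler_fps * (L\<^sup>2 - lambert_not3)" by (rule pent_moments)
  have "36 * pent_moment 2 - 12 * pent_moment 1 + pent_moment 0 = 24 * (fps_X * fps_deriv euler_fps) + euler_fps"
  proof (rule fps_ext)
    fix m
    have "(36 * pent_moment 2 - 12 * pent_moment 1 + pent_moment 0) $ m =
      (\<Sum>j | theta_exp 3 1 j = m. (- 1) powi j * (36 * of_int j ^ 2 - 12 * of_int j + 1))"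
      by (simp add: pent_moment_def fps_numeral_mult_nth sum.distrib sum_subtractf sum_distrib_left algebra_simps)
    also have "\<dots> = (\<Sum>j | theta_exp 3 1 j = m. (- 1) powi j * (24 * of_nat m + 1))"
    proof (intro sum.cong refl)
      fix j assume "j \<in> {j. theta_exp 3 1 j = m}"
      then have "36 * j\<^sup>2 - 12 * j + 1 = 24 * int m + 1"
        by (simp add: theta_exp_iffs power2_eq_square algebra_simps)
      then have "(of_int (36 * j\<^sup>2 - 12 * j + 1) :: complex) = of_int (24 * int m + 1)" by (simp only:)
      then show "(- 1) powi j * (36 * of_int j ^ 2 - 12 * of_int j + 1) = (- 1) powi j * (24 * of_nat m + 1 :: complex)"
        by simp
    qed
    also have "\<dots> = (24 * of_nat m + 1) * euler_fps $ m"
      by (simp add: euler_fps_nth sum_distrib_left sum_distrib_right mult_ac)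
    also have "\<dots> = (24 * (fps_X * fps_deriv euler_fps) + euler_fps) $ m"
      by (cases m) (simp_all add: fps_numeral_mult_nth, simp_all add: algebra_simps)
    finally show "(36 * pent_moment 2 - 12 * pent_moment 1 + pent_moment 0) $ m = (24 * (fps_X * fps_deriv euler_fps) + euler_fps) $ m" .
  qed
  then have "euler_fps * (36 * (L\<^sup>2 - lambert_not3) - 12 * L + 1) = euler_fps * (1 - 24 * euler_lambert)"
    unfolding L euler_fps_log_deriv by (simp add: algebra_simps)
  moreover have "(euler_fps :: complex fps) $ 0 = 1"
    by (simp add: euler_fps_def fps_prodinf_def)
  then have "(euler_fps :: complex fps) \<noteq> 0" by auto
  ultimately have "36 * (L\<^sup>2 - lambert_not3) - 12 * L + 1 = 1 - 24 * euler_lambert" by simp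
  then have e: "(1 - 6 * L)\<^sup>2 = 1 + 12 * euler_lambert - 36 * (euler_lambert oo fps_X ^ 3)"
    unfolding lambert_not3 by (simp add: power2_eq_square algebra_simps)
  have t: "theta_T = euler_fps * (1 - 6 * L)"
    unfolding theta_T_def L by (simp add: algebra_simps)
  show ?thesis unfolding t power_mult_distrib e ..
qed

section \<open>The product over the cube roots of unity\<close>

text \<open>Multiplied over the three rotations, a factor with exponent n prime to 3 becomes 1 -
  q^(3n), and one with exponent 3n becomes (1 - q^(3n))^3. The series in q^9 completes the first
  kind to a full product and so avoids a quotient.\<close>

lemma euler_fps_rotations:
  fixes w :: complex
  assumes w: "w\<^sup>2 + w + 1 = 0"
  shows "euler_fps * (euler_fps oo (fps_const w * fps_X)) * (euler_fps oo (fps_const (w\<^sup>2) * fps_X)) *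
      ((euler_fps oo fps_X ^ 3) oo fps_X ^ 3) = (euler_fps oo fps_X ^ 3) ^ 4"
proof -
  have w3: "w ^ 3 = 1"
  proof -
    have "w ^ 3 - 1 = (w - 1) * (w\<^sup>2 + w + 1)" by (simp add: power3_eq_cube power2_eq_square algebra_simps)
    with w show ?thesis by simp
  qed
  define e where "e c n = 1 - fps_const (c ^ Suc n) * fps_X ^ Suc n" for c :: complex and n
  have e_agree: "fps_agree n (e c n) 1" for c n
    unfolding e_def by (rule fps_agree_one_minus) simp
  have rot: "euler_fps oo (fps_const c * fps_X) = fps_prodinf (e c)" for c
  proof -
    have "(1 - fps_X ^ Suc n) oo (fps_const c * fps_X) = e c n" for n
      by (rule fps_ext) (simp add: e_def fps_X_power_nth del: power_Suc)
    then show ?thesis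
      unfolding euler_fps_def using fps_prodinf_compose_linear[of "\<lambda>n. 1 - fps_X ^ Suc n" c, OF euler_factor_agree']
      by (simp del: power_Suc)
  qed
  have e1: "euler_fps = fps_prodinf (e 1)"
    using rot[of 1] by simp
  define h :: "nat \<Rightarrow> complex fps" where "h n = 1 - fps_X ^ (3 * Suc n)" for n
  have h_agree: "fps_agree n (h n) 1" for n
    unfolding h_def by (rule euler_factor_agree) simp
  have comp: "(1 - fps_X ^ a) oo fps_X ^ 3 = (1 - fps_X ^ (3 * a) :: complex fps)" for a :: nat
  proof -
    have "fps_X ^ a oo fps_X ^ 3 = ((fps_X ^ 3) ^ a :: complex fps)"
      by (simp add: fps_X_power_compose)
    then show ?thesis by (simp add: fps_compose_sub_distrib power_mult)
  qed
  have Q: "euler_fps oo fps_X ^ 3 = fps_prodinf h"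
    unfolding euler_fps_def fps_prodinf_compose_X_power[OF euler_factor_agree' zero_less_numeral] comp
    by (simp add: h_def[abs_def])
  have Q9: "(euler_fps oo fps_X ^ 3) oo fps_X ^ 3 = fps_prodinf (\<lambda>n. h (3 * n + 2))"
  proof -
    have "h n oo fps_X ^ 3 = h (3 * n + 2)" for n
      unfolding h_def comp by simp
    then show ?thesis
      unfolding Q fps_prodinf_compose_X_power[OF h_agree zero_less_numeral] by simp
  qed
  define g where "g n = e 1 n * e w n * e (w\<^sup>2) n" for n
  have g_agree: "fps_agree n (g n) 1" for n
    using fps_agree_mult[OF fps_agree_mult[OF e_agree e_agree] e_agree] by (simp add: g_def)
  have h9_agree: "fps_agree n (h (3 * n + 2)) (1 :: complex fps)" for n
    by (rule fps_agree_mono[OF h_agree]) simp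
  have g3_agree: "fps_agree n (g (3 * n) * g (3 * n + 1) * g (3 * n + 2)) 1" for n
    using fps_agree_mult[OF fps_agree_mult[OF fps_agree_mono[OF g_agree[of "3*n"]]
        fps_agree_mono[OF g_agree[of "3*n+1"]]] fps_agree_mono[OF g_agree[of "3*n+2"]], of n] by simp
  have h3_agree: "fps_agree n (h (3 * n) * h (3 * n + 1) * h (3 * n + 2)) (1 :: complex fps)" for n
    using fps_agree_mult[OF fps_agree_mult[OF fps_agree_mono[OF h_agree[of "3*n"]]
        fps_agree_mono[OF h_agree[of "3*n+1"]]] fps_agree_mono[OF h_agree[of "3*n+2"]], of n] by simp
  have hc_agree: "fps_agree n (h n ^ 3) (1 :: complex fps)" for n
    using fps_agree_power[OF h_agree[of n], of 3] by simp
  \<comment> \<open>Indices are shifted by one, so the exponent divisible by 3 is the last one of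
    each block of three.\<close>
  have factor: "g (3 * n) * g (3 * n + 1) * g (3 * n + 2) * h (3 * n + 2) =
      (h (3 * n) * h (3 * n + 1) * h (3 * n + 2)) * h n ^ 3" for n
  proof -
    have W: "(fps_const w)\<^sup>2 + fps_const w + 1 = (0 :: complex fps)"
      using w by (metis fps_const_0_eq_0 fps_const_1_eq_1 fps_const_add fps_const_power)
    have cub: "(1 - Y) * (1 - fps_const w * Y) * (1 - fps_const (w\<^sup>2) * Y) = 1 - Y ^ 3" for Y :: "complex fps"
    proof -
      have W2: "fps_const (w\<^sup>2) = - 1 - fps_const w" using W by (simp add: eq_neg_iff_add_eq_0 algebra_simps)
      have W3: "fps_const w * fps_const w = - 1 - fps_const w"
        using W by (simp add: power2_eq_square eq_neg_iff_add_eq_0 algebra_simps del: fps_const_mult)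
      \<comment> \<open>The right side displays the multiples of w^2 + w + 1, which vanish by
        \<open>W3\<close>.\<close>
      have "(1 - Y) * (1 - fps_const w * Y) * (1 - (- 1 - fps_const w) * Y) =
         1 + (fps_const w * fps_const w + fps_const w + 1) * (Y * Y - Y\<^sup>2 * Y) + (0 - 1) * Y ^ 3 + (fps_const w * fps_const w + fps_const w + 1) * (Y ^ 3 - Y * Y) + (- 1 - fps_const w - fps_const w * fps_const w) * (Y * Y - Y ^ 3)"
        by (simp add: power3_eq_cube power2_eq_square algebra_simps del: fps_const_mult)
      then show ?thesis unfolding W2 W3 by simp
    qed
    have cub2: "(1 - Y) * (1 - fps_const (w\<^sup>2) * Y) * (1 - fps_const w * Y) = 1 - Y ^ 3" for Y
      using cub[of Y] by (simp only: mult.assoc mult.commute[of "1 - fps_const (w\<^sup>2) * Y"])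
    have p0: "w ^ (3 * n) = 1" using w3 by (simp add: power_mult)
    have p1: "w ^ Suc (3 * n) = w" and p2: "w ^ Suc (3 * n + 1) = w\<^sup>2" and p3: "w ^ Suc (3 * n + 2) = 1"
      using w3 p0 by (simp_all add: power2_eq_square power3_eq_cube mult.assoc)
    have p4: "w\<^sup>2 * w\<^sup>2 = w"
    proof -
      have "w\<^sup>2 * w\<^sup>2 = w ^ 3 * w" by (simp add: eval_nat_numeral)
      then show ?thesis using w3 by simp
    qed
    have q1: "(w\<^sup>2) ^ Suc (3 * n) = w\<^sup>2" and q2: "(w\<^sup>2) ^ Suc (3 * n + 1) = w" and q3: "(w\<^sup>2) ^ Suc (3 * n + 2) = 1"
      unfolding power_commutes[symmetric] power_mult[symmetric] mult.commute[of 2]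
      unfolding power_mult p1 p2 p3 using p4 by (simp_all add: power2_eq_square)
    have "g (3 * n) = h (3 * n)"
      using cub[of "fps_X ^ Suc (3 * n)"] unfolding g_def e_def h_def p1 q1 power_one
      by (simp only: power_mult[symmetric] mult.commute[of _ 3] fps_const_1_eq_1 mult_1)
    moreover have "g (3 * n + 1) = h (3 * n + 1)"
      using cub2[of "fps_X ^ Suc (3 * n + 1)"] unfolding g_def e_def h_def p2 q2 power_one
      by (simp only: power_mult[symmetric] mult.commute[of _ 3] fps_const_1_eq_1 mult_1)
    moreover have "g (3 * n + 2) = h n ^ 3"
    proof -
      have "Suc (3 * n + 2) = 3 * Suc n" by simp
      then show ?thesis
        unfolding g_def e_def h_def p3 q3 power_one by (simp only: fps_const_1_eq_1 mult_1 power3_eq_cube)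
    qed
    ultimately show ?thesis by (simp only: mult_ac)
  qed
  have "euler_fps * (euler_fps oo (fps_const w * fps_X)) * (euler_fps oo (fps_const (w\<^sup>2) * fps_X)) = fps_prodinf g"
  proof -
    have ee: "fps_agree n (e 1 n * e w n) 1" for n
      using fps_agree_mult[OF e_agree e_agree] by simp
    show ?thesis
      unfolding rot unfolding g_def e1 fps_prodinf_mult[OF ee e_agree] fps_prodinf_mult[OF e_agree e_agree] ..
  qed
  also have "\<dots> = fps_prodinf (\<lambda>n. g (3 * n) * g (3 * n + 1) * g (3 * n + 2))"
    by (rule fps_prodinf_triple[OF g_agree, symmetric])
  also have "\<dots> * ((euler_fps oo fps_X ^ 3) oo fps_X ^ 3) =
      fps_prodinf (\<lambda>n. (h (3 * n) * h (3 * n + 1) * h (3 * n + 2)) * h n ^ 3)"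
    unfolding Q9 fps_prodinf_mult[OF g3_agree h9_agree, symmetric] factor ..
  also have "\<dots> = fps_prodinf h * fps_prodinf h ^ 3"
    unfolding fps_prodinf_mult[OF h3_agree hc_agree] fps_prodinf_triple[OF h_agree] fps_prodinf_power[OF h_agree] ..
  finally show ?thesis unfolding Q by (simp add: power_Suc[symmetric] del: power_Suc)
qed

lemma fps_compose_X_power_inject:
  fixes F G :: "'a::comm_ring_1 fps"
  assumes "F oo fps_X ^ k = G oo fps_X ^ k" "k > 0"
  shows "F = G"
proof (rule fps_ext)
  fix n
  have "(F oo fps_X ^ k) $ (k * n) = (G oo fps_X ^ k) $ (k * n)" using assms(1) by simp
  then show "F $ n = G $ n" using assms(2) by (simp add: fps_nth_compose_X_power)
qed

text \<open>The factors a - 3b, a - 3wb and a - 3w^2 b of the dissection multiply to a^3 - 27 b^3;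
  \<open>euler_fps_rotations\<close>, cubed, evaluates the same product. After clearing denominators
  both sides are series in q^3, and q^3 is replaced by q.\<close>

lemma theta_T_cube: "theta_T ^ 3 * theta_U = euler_fps ^ 12 + 27 * fps_X * theta_U ^ 4"
proof -
  define w where "w = Complex (- 1 / 2) (sqrt 3 / 2)"
  have w: "w\<^sup>2 + w + 1 = 0"
    by (simp add: w_def power2_eq_square complex_eq_iff)
  have w3: "w ^ 3 = 1"
  proof -
    have "w ^ 3 - 1 = (w - 1) * (w\<^sup>2 + w + 1)" by (simp add: power3_eq_cube power2_eq_square algebra_simps)
    with w show ?thesis by simp
  qed
  define a where "a = theta_T oo fps_X ^ 3"
  define b where "b = fps_X * (theta_U oo fps_X ^ 3)"
  define P where "P = (euler_fps :: complex fps)"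
  have P: "P ^ 3 = a - 3 * b" unfolding P_def a_def b_def by (rule euler_cube_dissection)
  have rot: "(P oo (fps_const c * fps_X)) ^ 3 = a - 3 * (fps_const c * b)" if "c ^ 3 = 1" for c
  proof -
    have ck: "c ^ (3 * k) = 1" for k using that by (simp add: power_mult)
    have "(a - 3 * b) oo (fps_const c * fps_X) = a - 3 * (fps_const c * b)"
    proof (rule fps_ext)
      fix m
      have A: "c ^ m * a $ m = a $ m"
        unfolding a_def fps_nth_compose_X_power using ck by auto
      have B: "c ^ m * b $ m = c * b $ m"
      proof (cases m)
        case (Suc i)
        then show ?thesis
          unfolding b_def using ck by (auto simp: fps_nth_compose_X_power)
      qed (simp add: b_def)
      show "((a - 3 * b) oo (fps_const c * fps_X)) $ m = (a - 3 * (fps_const c * b)) $ m"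
        unfolding fps_nth_compose_linear fps_sub_nth fps_numeral_mult_nth fps_mult_left_const_nth
          right_diff_distrib mult.left_commute[of "c ^ m" 3] A B ..
    qed
    then show ?thesis
      using fps_compose_power[of "fps_const c * fps_X" P 3] by (simp add: P)
  qed
  have "w\<^sup>2 - (- 1 - w) = 0" using w by (simp add: algebra_simps)
  then have "w\<^sup>2 = - 1 - w" by simp
  then have W: "fps_const (w\<^sup>2) = - 1 - fps_const w"
    by (simp only: fps_const_sub[symmetric] fps_const_neg[symmetric] fps_const_1_eq_1)
  have W2: "fps_const w * fps_const w = - 1 - fps_const w"
    using W by (simp add: power2_eq_square)
  have w6: "(w\<^sup>2) ^ 3 = 1" using w3 by (metis mult.commute power_mult power_one)
  have "(P * (P oo (fps_const w * fps_X)) * (P oo (fps_const (w\<^sup>2) * fps_X))) ^ 3 =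
      (a - 3 * b) * (a - 3 * (fps_const w * b)) * (a - 3 * ((- 1 - fps_const w) * b))"
    unfolding power_mult_distrib rot[OF w6] rot[OF w3] P unfolding W ..
  also have "\<dots> = a ^ 3 - 27 * b ^ 3 + (fps_const w * fps_const w - (- 1 - fps_const w)) * (27 * b ^ 3 - 9 * a * b\<^sup>2)"
    by (simp add: power3_eq_cube power2_eq_square algebra_simps del: fps_const_mult)
  also have "\<dots> = a ^ 3 - 27 * b ^ 3" unfolding W2 by simp
  finally have prod: "(P * (P oo (fps_const w * fps_X)) * (P oo (fps_const (w\<^sup>2) * fps_X))) ^ 3 = a ^ 3 - 27 * b ^ 3" .
  have c0: "(fps_X ^ 3 :: complex fps) $ 0 = 0" by simp
  have "(a ^ 3 - 27 * b ^ 3) * ((P oo fps_X ^ 3) oo fps_X ^ 3) ^ 3 = ((P oo fps_X ^ 3) ^ 4) ^ 3"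
    unfolding prod[symmetric] power_mult_distrib[symmetric] unfolding P_def by (simp only: euler_fps_rotations[OF w])
  also have "((P oo fps_X ^ 3) oo fps_X ^ 3) ^ 3 = theta_U oo fps_X ^ 3"
    unfolding theta_U_def P_def by (simp only: fps_compose_power[OF c0])
  also have "((P oo fps_X ^ 3) ^ 4) ^ 3 = P ^ 12 oo fps_X ^ 3"
    by (simp add: fps_compose_power[OF c0] flip: power_mult)
  also have "a ^ 3 - 27 * b ^ 3 = (theta_T ^ 3 - 27 * (fps_X * theta_U ^ 3)) oo fps_X ^ 3"
  proof -
    have "(27 :: complex fps) oo fps_X ^ 3 = 27" by (metis fps_const_compose numeral_fps_const)
    moreover have "fps_X oo fps_X ^ 3 = (fps_X ^ 3 :: complex fps)" by simp
    ultimately show ?thesis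
      unfolding a_def b_def fps_compose_sub_distrib fps_compose_mult_distrib[OF c0] power_mult_distrib
      by (simp only: fps_compose_power[OF c0])
  qed
  finally have "(theta_T ^ 3 - 27 * (fps_X * theta_U ^ 3)) * theta_U oo fps_X ^ 3 = P ^ 12 oo fps_X ^ 3"
    unfolding fps_compose_mult_distrib[OF c0, symmetric] .
  then have "(theta_T ^ 3 - 27 * (fps_X * theta_U ^ 3)) * theta_U = P ^ 12"
    by (rule fps_compose_X_power_inject) simp
  moreover have "theta_U ^ 4 = theta_U ^ 3 * theta_U" by (simp add: eval_nat_numeral)
  ultimately show ?thesis by (simp add: P_def algebra_simps)
qed

text \<open>Multiply by T^2: the derivative of \<open>theta_T_cube\<close> then eliminates T^2 times
  the derivative of T, and the right side collapses to f^12 (1 + 12 S - 36 R), which is f^10 T^2 by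
  \<open>theta_T_square\<close>.\<close>

theorem euler_pow_10:
  "euler_fps ^ 10 = 3 * (theta_T * (fps_X * fps_deriv theta_U) - theta_U * (fps_X * fps_deriv theta_T)) + theta_T * theta_U"
proof -
  define P where "P = (euler_fps :: complex fps)"
  define S where "S = (euler_lambert :: complex fps)"
  define R where "R = (euler_lambert oo fps_X ^ 3 :: complex fps)"
  define T where "T = theta_T"
  define U where "U = theta_U"
  define th where "th F = fps_X * fps_deriv F" for F :: "complex fps"
  have th_mult: "th (F * G) = th F * G + F * th G" for F G by (simp add: th_def algebra_simps)
  have th_pow: "th (F ^ Suc n) = of_nat (Suc n) * F ^ n * th F" for F n
    by (induction n) (simp_all add: th_mult algebra_simps)
  have thP: "th P = - (P * S)" unfolding th_def P_def S_def by (rule euler_fps_log_deriv)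
  have c0: "(fps_X ^ 3 :: complex fps) $ 0 = 0" by simp
  \<comment> \<open>One factor 3 comes from the substitution of q^3 for q, the other from the
    cube.\<close>
  have thU: "th U = - 9 * R * U"
  proof -
    have "th (P oo fps_X ^ 3) = 3 * (- (P * S) oo fps_X ^ 3)"
      unfolding th_def fps_X_deriv_compose_X_power[OF zero_less_numeral] using thP by (simp add: th_def)
    also have "\<dots> = - 3 * ((P oo fps_X ^ 3) * R)"
      by (simp add: fps_compose_uminus fps_compose_mult_distrib[OF c0] R_def S_def)
    finally have "th (P oo fps_X ^ 3) = - 3 * ((P oo fps_X ^ 3) * R)" .
    then show ?thesis
      using th_pow[of "P oo fps_X ^ 3" 2] unfolding U_def theta_U_def P_def[symmetric]
      by (simp add: numeral_3_eq_3[symmetric] power3_eq_cube power2_eq_square algebra_simps)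
  qed
  have sq: "T\<^sup>2 = P\<^sup>2 * (1 + 12 * S - 36 * R)"
    unfolding T_def P_def S_def R_def by (rule theta_T_square)
  have cube: "T ^ 3 * U = P ^ 12 + 27 * fps_X * U ^ 4"
    unfolding T_def P_def U_def by (rule theta_T_cube)
  define Y where "Y = 27 * fps_X * U ^ 4"
  have thY: "th Y = Y - 36 * R * Y"
  proof -
    have "th Y = 27 * th (fps_X * U ^ 4)"
      by (simp add: Y_def th_def algebra_simps)
    also have "th (fps_X * U ^ 4) = fps_X * U ^ 4 + fps_X * (4 * U ^ 3 * th U)"
      using th_pow[of U 3] by (simp add: th_mult) (simp add: th_def)
    also have "fps_X * (4 * U ^ 3 * th U) = - 36 * R * (fps_X * U ^ 4)"
      unfolding thU by (simp add: eval_nat_numeral algebra_simps)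
    finally show ?thesis by (simp add: Y_def algebra_simps)
  qed
  have "3 * T\<^sup>2 * th T * U + T ^ 3 * th U = th (T ^ 3 * U)"
    using th_pow[of T 2] by (simp add: th_mult)
  also have "\<dots> = th (P ^ 12) + th Y"
    unfolding cube Y_def by (simp add: th_def algebra_simps)
  also have "th (P ^ 12) = - 12 * P ^ 12 * S"
    using th_pow[of P 11] unfolding thP by (simp add: eval_nat_numeral algebra_simps)
  finally have d: "3 * T\<^sup>2 * th T * U = - 12 * P ^ 12 * S + Y - 36 * R * Y + 9 * R * (T ^ 3 * U)"
    unfolding thY thU by (simp add: algebra_simps)
  have "T\<^sup>2 * (3 * (T * th U - U * th T) + T * U) = 3 * T ^ 3 * th U - 3 * T\<^sup>2 * th T * U + T ^ 3 * U"
    by (simp add: power3_eq_cube power2_eq_square algebra_simps)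
  also have "\<dots> = (T ^ 3 * U - Y) * (1 - 36 * R) + 12 * P ^ 12 * S"
    unfolding d thU by (simp add: algebra_simps)
  also have "\<dots> = P ^ 10 * (P\<^sup>2 * (1 + 12 * S - 36 * R))"
    unfolding cube Y_def by (simp add: eval_nat_numeral algebra_simps)
  also have "\<dots> = T\<^sup>2 * P ^ 10" unfolding sq by (simp only: mult_ac)
  finally have "T\<^sup>2 * (3 * (T * th U - U * th T) + T * U) = T\<^sup>2 * P ^ 10" .
  \<comment> \<open>The right side of \<open>cube\<close> has constant term 1.\<close>
  moreover have "T \<noteq> 0"
  proof
    assume "T = 0"
    then have "P ^ 12 + 27 * fps_X * U ^ 4 = 0" using cube by simp
    then have "(P ^ 12 + 27 * fps_X * U ^ 4) $ 0 = 0" by simp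
    moreover have "P $ 0 = 1" by (simp add: P_def euler_fps_def fps_prodinf_def)
    ultimately show False by (simp add: fps_nth_power_0 mult.assoc)
  qed
  ultimately have "P ^ 10 = 3 * (T * th U - U * th T) + T * U" by simp
  then show ?thesis by (simp add: P_def T_def U_def th_def)
qed

subsection \<open>Sums over Gaussian integers of given norm\<close>

definition circle_points :: "int \<Rightarrow> (int \<times> int) set" where
  "circle_points K = {(x, y). x\<^sup>2 + y\<^sup>2 = K}"

lemma finite_circle_points [simp]: "finite (circle_points K)"
proof (rule finite_subset)
  show "circle_points K \<subseteq> {- K..K} \<times> {- K..K}"
  proof
    fix p assume "p \<in> circle_points K"
    then obtain x y where p: "p = (x, y)" "x\<^sup>2 + y\<^sup>2 = K" by (auto simp: circle_points_def)
    then show "p \<in> {- K..K} \<times> {- K..K}"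
      using abs_le_square[of x] abs_le_square[of y] zero_le_power2[of x] zero_le_power2[of y] by auto
  qed
qed simp

text \<open>A convolution index \<open>i\<close> is recovered from the point as
  \<open>x\<^sup>2 div 24\<close>; the residues \<open>r\<close> and \<open>s\<close> lie below 24
  so that this is exact.\<close>

lemma sum_square_pairs:
  fixes g :: "int \<Rightarrow> int \<Rightarrow> int"
  assumes "r < 24" "s < 24"
  shows "(\<Sum>i\<le>n. \<Sum>x | x\<^sup>2 = 24 * int i + int r. \<Sum>y | y\<^sup>2 = 24 * int (n - i) + int s. g x y) =
    (\<Sum>(x, y) | (x, y) \<in> circle_points (int (24 * n + r + s)) \<and> x\<^sup>2 mod 24 = int r \<and> y\<^sup>2 mod 24 = int s. g x y)"
proof -
  have "(\<Sum>i\<le>n. \<Sum>x | x\<^sup>2 = 24 * int i + int r. \<Sum>y | y\<^sup>2 = 24 * int (n - i) + int s. g x y) =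
    (\<Sum>(i, x, y)\<in>(SIGMA i:{..n}. SIGMA x:{x. x\<^sup>2 = 24 * int i + int r}. {y. y\<^sup>2 = 24 * int (n - i) + int s}). g x y)"
    by (simp add: sum.Sigma finite_int_squares split_def del: of_nat_diff)
  also have "\<dots> = (\<Sum>(x, y) | (x, y) \<in> circle_points (int (24 * n + r + s)) \<and> x\<^sup>2 mod 24 = int r \<and> y\<^sup>2 mod 24 = int s. g x y)"
  proof (rule sum.reindex_bij_witness[of _ "\<lambda>(x, y). (nat (x\<^sup>2 div 24), x, y)" snd])
    fix p assume "p \<in> {(x, y). (x, y) \<in> circle_points (int (24 * n + r + s)) \<and> x\<^sup>2 mod 24 = int r \<and> y\<^sup>2 mod 24 = int s}"
    then obtain x y where p: "p = (x, y)" "x\<^sup>2 + y\<^sup>2 = int (24 * n + r + s)" "x\<^sup>2 mod 24 = int r" "y\<^sup>2 mod 24 = int s"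
      by (auto simp: circle_points_def)
    define a where "a = x\<^sup>2 div 24"
    define b where "b = y\<^sup>2 div 24"
    have a: "x\<^sup>2 = 24 * a + int r" "a \<ge> 0" and b: "y\<^sup>2 = 24 * b + int s" "b \<ge> 0"
      using mult_div_mod_eq[of 24 "x\<^sup>2"] mult_div_mod_eq[of 24 "y\<^sup>2"] p by (simp_all add: a_def b_def pos_imp_zdiv_nonneg_iff)
    have ab: "a + b = int n" using p a b by simp
    have na: "nat a \<le> n" "int (nat a) = a" "int (n - nat a) = b" using ab a(2) b(2) by linarith+
    show "(case p of (x, y) \<Rightarrow> (nat (x\<^sup>2 div 24), x, y)) \<in>
      (SIGMA i:{..n}. SIGMA x:{x. x\<^sup>2 = 24 * int i + int r}. {y. y\<^sup>2 = 24 * int (n - i) + int s})"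
      unfolding p(1) prod.case a_def[symmetric] mem_Sigma_iff mem_Collect_eq atMost_iff na(2,3)
      using a b na(1) by blast
  next
    fix q assume "q \<in> (SIGMA i:{..n}. SIGMA x:{x. x\<^sup>2 = 24 * int i + int r}. {y. y\<^sup>2 = 24 * int (n - i) + int s})"
    then obtain i x y where q: "q = (i, x, y)" "i \<le> n" "x\<^sup>2 = 24 * int i + int r" "y\<^sup>2 = 24 * int (n - i) + int s"
      by auto
    have "x\<^sup>2 div 24 = int i" "x\<^sup>2 mod 24 = int r" "y\<^sup>2 mod 24 = int s"
      unfolding q(3,4) using assms by simp_all
    moreover have "x\<^sup>2 + y\<^sup>2 = int (24 * n + r + s)" unfolding q(3,4) using q(2) by simp
    ultimately show "(case snd q of (x, y) \<Rightarrow> (nat (x\<^sup>2 div 24), x, y)) = q"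
      "snd q \<in> {(x, y). (x, y) \<in> circle_points (int (24 * n + r + s)) \<and> x\<^sup>2 mod 24 = int r \<and> y\<^sup>2 mod 24 = int s}"
      "(case snd q of (x, y) \<Rightarrow> g x y) = (case q of (i, x, y) \<Rightarrow> g x y)"
      by (simp_all add: q(1) circle_points_def)
  qed auto
  finally show ?thesis .
qed

definition psi_sum :: "int \<Rightarrow> int" where
  "psi_sum K = (\<Sum>(x, y)\<in>circle_points K. psi x * psi y)"

text \<open>The extra weight is the real part of (x + iy)^4.\<close>

definition psi_sum4 :: "int \<Rightarrow> int" where
  "psi_sum4 K = (\<Sum>(x, y)\<in>circle_points K. psi x * psi y * (x ^ 4 - 6 * x\<^sup>2 * y\<^sup>2 + y ^ 4))"

text \<open>The units modulo 12 have squares that are 1 modulo 24, and every other integer is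
  divisible by 2 or 3.\<close>

lemma psi_eq_0: "x\<^sup>2 mod 24 \<noteq> 1 \<Longrightarrow> psi x = 0"
proof -
  assume a: "x\<^sup>2 mod 24 \<noteq> 1"
  have "\<not> (x mod 12 \<in> {1, 5, 7, 11})"
  proof
    assume "x mod 12 \<in> {1, 5, 7, 11}"
    then obtain k where "x = 12 * k + 1 \<or> x = 12 * k + 5 \<or> x = 12 * k + 7 \<or> x = 12 * k + 11"
      using mult_div_mod_eq[of 12 x] by (metis insertE singletonD)
    then have "\<exists>t. x\<^sup>2 = 24 * t + 1"
    proof (elim disjE)
      assume "x = 12 * k + 1"
      then have "x\<^sup>2 = 24 * (6 * k * k + k) + 1" by (simp add: power2_eq_square algebra_simps)
      then show ?thesis ..
    next
      assume "x = 12 * k + 5"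
      then have "x\<^sup>2 = 24 * (6 * k * k + 5 * k + 1) + 1" by (simp add: power2_eq_square algebra_simps)
      then show ?thesis ..
    next
      assume "x = 12 * k + 7"
      then have "x\<^sup>2 = 24 * (6 * k * k + 7 * k + 2) + 1" by (simp add: power2_eq_square algebra_simps)
      then show ?thesis ..
    next
      assume "x = 12 * k + 11"
      then have "x\<^sup>2 = 24 * (6 * k * k + 11 * k + 5) + 1" by (simp add: power2_eq_square algebra_simps)
      then show ?thesis ..
    qed
    then show False using a by auto
  qed
  then have "even x \<or> x mod 3 = 0" by simp presburger
  moreover have "chi4 x = 0" if "even x" using that unfolding chi4_def by presburger
  ultimately show "psi x = 0" by (auto simp: psi_def chi3_def)
qed

lemma four_times_euler_square_nth:
  "4 * ((euler_fps :: complex fps)\<^sup>2) $ m = of_int (psi_sum (24 * int m + 2))"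
proof -
  let ?P = "euler_fps :: complex fps"
  have "4 * (?P\<^sup>2) $ m = (\<Sum>i\<le>m. (2 * ?P $ i) * (2 * ?P $ (m - i)))"
    by (simp add: power2_eq_square fps_mult_nth sum_distrib_left atMost_atLeast0 mult_ac)
  also have "\<dots> = of_int (\<Sum>i\<le>m. \<Sum>x | x\<^sup>2 = 24 * int i + int 1. \<Sum>y | y\<^sup>2 = 24 * int (m - i) + int 1. psi x * psi y)"
    unfolding two_times_euler_nth of_int_mult[symmetric] sum_product of_int_sum[symmetric] by simp
  also have "(\<Sum>i\<le>m. \<Sum>x | x\<^sup>2 = 24 * int i + int 1. \<Sum>y | y\<^sup>2 = 24 * int (m - i) + int 1. psi x * psi y) =
    (\<Sum>(x, y) | (x, y) \<in> circle_points (int (24 * m + 1 + 1)) \<and> x\<^sup>2 mod 24 = int 1 \<and> y\<^sup>2 mod 24 = int 1. psi x * psi y)"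
    by (rule sum_square_pairs) simp_all
  also have "\<dots> = psi_sum (24 * int m + 2)"
    unfolding psi_sum_def
  proof (rule sum.mono_neutral_left)
    have e: "int (24 * m + 1 + 1) = 24 * int m + 2" by simp
    show "{(x, y). (x, y) \<in> circle_points (int (24 * m + 1 + 1)) \<and> x\<^sup>2 mod 24 = int 1 \<and> y\<^sup>2 mod 24 = int 1}
        \<subseteq> circle_points (24 * int m + 2)"
      unfolding e by blast
    show "\<forall>p\<in>circle_points (24 * int m + 2) - {(x, y). (x, y) \<in> circle_points (int (24 * m + 1 + 1)) \<and> x\<^sup>2 mod 24 = int 1 \<and> y\<^sup>2 mod 24 = int 1}.
        (case p of (x, y) \<Rightarrow> psi x * psi y) = 0"
    proof
      fix p assume p: "p \<in> circle_points (24 * int m + 2) - {(x, y). (x, y) \<in> circle_points (int (24 * m + 1 + 1)) \<and> x\<^sup>2 mod 24 = int 1 \<and> y\<^sup>2 mod 24 = int 1}"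
      obtain x y where xy: "p = (x, y)" by (cases p)
      have "\<not> (x\<^sup>2 mod 24 = 1 \<and> y\<^sup>2 mod 24 = 1)" using p by (auto simp: xy circle_points_def)
      then show "(case p of (x, y) \<Rightarrow> psi x * psi y) = 0" using psi_eq_0 by (auto simp: xy)
    qed
  qed (rule finite_circle_points)
  finally show ?thesis .
qed

section \<open>The tenth power as a circle sum\<close>

text \<open>The weight is a quarter of the imaginary part of (x + iy)^4. The coordinate
  \<open>y\<close> stems from \<open>theta_U\<close>, whose squares are those of multiples of
  3.\<close>

definition chi_sum :: "int \<Rightarrow> int" where
  "chi_sum K = (\<Sum>(x, y) | (x, y) \<in> circle_points K \<and> 3 dvd y. chi4 x * chi4 y * (x * y * (x\<^sup>2 - y\<^sup>2)))"

lemma odd_square_mod_24: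
  fixes y :: int
  assumes "odd y" "3 dvd y"
  shows "y\<^sup>2 mod 24 = 9"
proof -
  obtain z where z: "y = 3 * z" using assms by blast
  with assms obtain k where "z = 2 * k + 1" by (auto elim: oddE)
  moreover have "even (k * k + k)" by simp
  then obtain l where "k * k + k = 2 * l" by blast
  ultimately have "y\<^sup>2 = 9 + 24 * (3 * l)" using z by (simp add: power2_eq_square algebra_simps)
  then show ?thesis by (simp only: mod_mult_self2) simp
qed

text \<open>In the Wronskian, a pair x^2 = 24i + 1, y^2 = 24(n - i) + 9 carries the factor 3((n - i)
  - i) + 1 = (y^2 - x^2)/8. Hence 96 = 2 * 6 * 8, and the sign of \<open>theta_U\<close> turns y^2 -
  x^2 around.\<close>

lemma euler_pow_10_nth:
  "96 * ((euler_fps :: complex fps) ^ 10) $ n = of_int (chi_sum (24 * int n + 10))"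
proof -
  let ?P = "euler_fps :: complex fps"
  have th: "(fps_X * fps_deriv F) $ i = of_nat i * F $ i" for F :: "complex fps" and i
    by (cases i) auto
  have "96 * (?P ^ 10) $ n = (\<Sum>i\<le>n. 96 * ((3 * (of_nat (n - i) - of_nat i) + 1) * (theta_T $ i * theta_U $ (n - i))))"
  proof -
    have "(theta_U * (fps_X * fps_deriv theta_T)) $ n = ((fps_X * fps_deriv theta_T) * theta_U) $ n"
      by (simp only: mult.commute)
    then have "(?P ^ 10) $ n = 3 * ((\<Sum>i\<le>n. theta_T $ i * (of_nat (n - i) * theta_U $ (n - i))) -
      (\<Sum>i\<le>n. of_nat i * theta_T $ i * theta_U $ (n - i))) + (\<Sum>i\<le>n. theta_T $ i * theta_U $ (n - i))"
      unfolding euler_pow_10 fps_add_nth fps_numeral_mult_nth fps_sub_nth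
      unfolding fps_mult_nth[of theta_T] fps_mult_nth[of _ theta_U] th atMost_atLeast0 by (simp only:)
    also have "\<dots> = (\<Sum>i\<le>n. (3 * (of_nat (n - i) - of_nat i) + 1) * (theta_T $ i * theta_U $ (n - i)))"
      by (simp add: sum_distrib_left sum_subtractf[symmetric] sum.distrib[symmetric] algebra_simps del: of_nat_diff)
    finally show ?thesis by (simp only: sum_distrib_left)
  qed
  also have "\<dots> = of_int (\<Sum>i\<le>n. \<Sum>x | x\<^sup>2 = 24 * int i + int 1. \<Sum>y | y\<^sup>2 = 24 * int (n - i) + int 9.
      chi4 x * chi4 y * (x * y * (x\<^sup>2 - y\<^sup>2)))"
    unfolding of_int_sum[of _ "{..n}"]
  proof (intro sum.cong refl)
    fix i assume i: "i \<in> {..n}"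
    define q :: int where "q = 3 * (int (n - i) - int i) + 1"
    have "96 * ((3 * (of_nat (n - i) - of_nat i) + 1) * (theta_T $ i * theta_U $ (n - i))) =
      8 * of_int q * ((2 * theta_T $ i) * (6 * theta_U $ (n - i)))"
      by (simp add: q_def del: of_nat_diff)
    also have "\<dots> = of_int (- 8 * q * ((\<Sum>x | x\<^sup>2 = 24 * int i + int 1. chi4 x * x) *
        (\<Sum>y | y\<^sup>2 = 24 * int (n - i) + int 9. chi4 y * y)))" (is "_ = of_int (- 8 * q * (?A * ?B))")
    proof -
      have "2 * theta_T $ i = of_int ?A" "6 * theta_U $ (n - i) = - of_int ?B"
        unfolding two_times_theta_T_nth six_times_theta_U_nth by (simp_all del: of_int_sum of_nat_diff)
      then show ?thesis by (simp del: of_int_sum of_nat_diff)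
    qed
    also have "- 8 * q * (?A * ?B) = (\<Sum>x | x\<^sup>2 = 24 * int i + int 1. \<Sum>y | y\<^sup>2 = 24 * int (n - i) + int 9.
        - 8 * q * ((chi4 x * x) * (chi4 y * y)))"
      by (simp only: sum_product) (simp only: sum_distrib_left)
    also have "(\<Sum>x | x\<^sup>2 = 24 * int i + int 1. \<Sum>y | y\<^sup>2 = 24 * int (n - i) + int 9. - 8 * q * ((chi4 x * x) * (chi4 y * y))) =
      (\<Sum>x | x\<^sup>2 = 24 * int i + int 1. \<Sum>y | y\<^sup>2 = 24 * int (n - i) + int 9. chi4 x * chi4 y * (x * y * (x\<^sup>2 - y\<^sup>2)))"
    proof (intro sum.cong refl)
      fix x y assume "x \<in> {x. x\<^sup>2 = 24 * int i + int 1}" "y \<in> {y. y\<^sup>2 = 24 * int (n - i) + int 9}"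
      then have "x\<^sup>2 - y\<^sup>2 = - 8 * q" by (simp add: q_def)
      then show "- 8 * q * ((chi4 x * x) * (chi4 y * y)) = chi4 x * chi4 y * (x * y * (x\<^sup>2 - y\<^sup>2))"
        by (simp add: mult_ac)
    qed
    finally show "96 * ((3 * (of_nat (n - i) - of_nat i) + 1) * (theta_T $ i * theta_U $ (n - i))) =
      of_int (\<Sum>x | x\<^sup>2 = 24 * int i + int 1. \<Sum>y | y\<^sup>2 = 24 * int (n - i) + int 9.
      chi4 x * chi4 y * (x * y * (x\<^sup>2 - y\<^sup>2)))" .
  qed
  also have "(\<Sum>i\<le>n. \<Sum>x | x\<^sup>2 = 24 * int i + int 1. \<Sum>y | y\<^sup>2 = 24 * int (n - i) + int 9.
      chi4 x * chi4 y * (x * y * (x\<^sup>2 - y\<^sup>2))) =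
    (\<Sum>(x, y) | (x, y) \<in> circle_points (int (24 * n + 1 + 9)) \<and> x\<^sup>2 mod 24 = int 1 \<and> y\<^sup>2 mod 24 = int 9.
      chi4 x * chi4 y * (x * y * (x\<^sup>2 - y\<^sup>2)))"
    by (rule sum_square_pairs) simp_all
  also have "\<dots> = chi_sum (24 * int n + 10)"
    unfolding chi_sum_def
  proof (rule sum.mono_neutral_left)
    show "finite {(x, y). (x, y) \<in> circle_points (24 * int n + 10) \<and> 3 dvd y}"
      by (rule finite_subset[OF _ finite_circle_points]) auto
    show "{(x, y). (x, y) \<in> circle_points (int (24 * n + 1 + 9)) \<and> x\<^sup>2 mod 24 = int 1 \<and> y\<^sup>2 mod 24 = int 9}
      \<subseteq> {(x, y). (x, y) \<in> circle_points (24 * int n + 10) \<and> 3 dvd y}"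
    proof clarsimp
      fix x y :: int assume "(x, y) \<in> circle_points (10 + 24 * int n)" "y\<^sup>2 mod 24 = 9"
      then have "y\<^sup>2 = 3 * (8 * (y\<^sup>2 div 24) + 3)" using mult_div_mod_eq[of 24 "y\<^sup>2"] by simp
      then have "3 dvd y\<^sup>2" by (rule dvdI)
      then have "3 dvd y" using prime_dvd_power[of 3 y 2] by simp
      then show "(x, y) \<in> circle_points (24 * int n + 10) \<and> 3 dvd y"
        using \<open>(x, y) \<in> _\<close> by (simp add: add.commute)
    qed
    show "\<forall>p\<in>{(x, y). (x, y) \<in> circle_points (24 * int n + 10) \<and> 3 dvd y} -
        {(x, y). (x, y) \<in> circle_points (int (24 * n + 1 + 9)) \<and> x\<^sup>2 mod 24 = int 1 \<and> y\<^sup>2 mod 24 = int 9}.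
        (case p of (x, y) \<Rightarrow> chi4 x * chi4 y * (x * y * (x\<^sup>2 - y\<^sup>2))) = 0"
    proof
      fix p assume p: "p \<in> {(x, y). (x, y) \<in> circle_points (24 * int n + 10) \<and> 3 dvd y} -
        {(x, y). (x, y) \<in> circle_points (int (24 * n + 1 + 9)) \<and> x\<^sup>2 mod 24 = int 1 \<and> y\<^sup>2 mod 24 = int 9}"
      obtain x y where xy: "p = (x, y)" by (cases p)
      have K: "x\<^sup>2 + y\<^sup>2 = 24 * int n + 10" "3 dvd y" and nm: "\<not> (x\<^sup>2 mod 24 = 1 \<and> y\<^sup>2 mod 24 = 9)"
        using p by (auto simp: xy circle_points_def)
      \<comment> \<open>For odd \<open>y\<close> divisible by 3, both residues are forced by the
        norm; on the remaining points \<open>chi4 y\<close> vanishes.\<close>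
      have "even y"
      proof (rule ccontr)
        assume "odd y"
        then have "y\<^sup>2 mod 24 = 9" using K(2) by (rule odd_square_mod_24)
        moreover have "x\<^sup>2 mod 24 = 1"
        proof -
          obtain b where "y\<^sup>2 = 24 * b + 9" using calculation mult_div_mod_eq[of 24 "y\<^sup>2"] by metis
          then have "x\<^sup>2 = 1 + 24 * (int n - b)" using K(1) by simp
          then show ?thesis by (simp only: mod_mult_self2) simp
        qed
        ultimately show False using nm by simp
      qed
      then have "chi4 y = 0" unfolding chi4_def by presburger
      then show "(case p of (x, y) \<Rightarrow> chi4 x * chi4 y * (x * y * (x\<^sup>2 - y\<^sup>2))) = 0" by (simp add: xy)
    qed
  qed
  finally show ?thesis .
qed

section \<open>Circle sums at the Gaussian primes above 5\<close>

text \<open>Since 5 divides x^2 - 4y^2, each point is a multiple of 2 + i, where x is 2y modulo 5,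
  or of 2 - i. Conjugation exchanges the two kinds, and their overlap consists of the multiples of
  5.\<close>

lemma sum_split_mod_5:
  fixes s :: "int \<times> int \<Rightarrow> int"
  assumes S: "S \<subseteq> circle_points K" and K: "5 dvd K"
    and sym: "\<And>x y. (x, y) \<in> S \<Longrightarrow> (x, - y) \<in> S" "\<And>x y. s (x, - y) = s (x, y)"
  shows "sum s S = 2 * (\<Sum>p | p \<in> S \<and> 5 dvd fst p - 2 * snd p. s p) - (\<Sum>p | p \<in> S \<and> 5 dvd fst p \<and> 5 dvd snd p. s p)"
proof -
  let ?A = "{p. p \<in> S \<and> 5 dvd fst p - 2 * snd p}"
  let ?B = "{p. p \<in> S \<and> 5 dvd fst p + 2 * snd p}"
  have fin: "finite S" using S finite_circle_points by (rule finite_subset)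
  have "p \<in> ?A \<union> ?B" if "p \<in> S" for p
  proof -
    obtain x y where p: "p = (x, y)" by (cases p)
    then have "x\<^sup>2 + y\<^sup>2 = K" using that S by (auto simp: circle_points_def)
    then have "(x - 2 * y) * (x + 2 * y) = K - 5 * y\<^sup>2"
      by (simp add: power2_eq_square algebra_simps)
    then have "5 dvd (x - 2 * y) * (x + 2 * y)" using K by simp
    then show ?thesis using that by (simp add: p prime_dvd_mult_iff)
  qed
  then have un: "S = ?A \<union> ?B" by blast
  have int: "?A \<inter> ?B = {p. p \<in> S \<and> 5 dvd fst p \<and> 5 dvd snd p}"
    by (auto; presburger)
  have "sum s (?A \<union> ?B) + sum s (?A \<inter> ?B) = sum s ?A + sum s ?B"
    by (rule sum.union_inter) (use fin in auto)
  moreover have "sum s ?B = sum s ?A"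
    by (rule sum.reindex_bij_witness[of _ "\<lambda>(x, y). (x, - y)" "\<lambda>(x, y). (x, - y)"]) (auto simp: sym)
  ultimately show ?thesis unfolding un[symmetric] int by simp
qed

text \<open>
  \<open>(x, y) \<mapsto> (X, Y)\<close> is \<open>\<gamma> \<mapsto> (2 + i) \<delta>'\<close>, where \<open>\<gamma> = (2 + i) \<delta>\<close> and \<open>\<delta>'\<close> is the conjugate of \<open>\<delta>\<close>. Since
  it changes the sign of the character, the multiples of \<open>2 + i\<close> contribute nothing to \<open>psi_sum\<close>.
\<close>

lemma psi_reflect:
  assumes "5 * X = 3 * x + 4 * y" "5 * Y = 4 * x - 3 * y"
  shows "psi X * psi Y = - (psi x * psi y)"
proof -
  \<comment> \<open>The hypotheses solved modulo 4 and modulo 3, where 5 is 1 and -1.\<close>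
  have "X = - x + 4 * (x + y - X)" "Y = y + 4 * (x - y - Y)"
    "X = - y + 3 * (2 * X - x - y)" "Y = - x + 3 * (2 * Y - x + y)" using assms by auto
  then have "chi4 X = - chi4 x" "chi4 Y = chi4 y" "chi3 X = - chi3 y" "chi3 Y = - chi3 x"
    by (metis chi4_add_mult chi4_minus, metis chi4_add_mult, metis chi3_add_mult chi3_minus, metis chi3_add_mult chi3_minus)
  then show ?thesis by (simp add: psi_def)
qed

lemma psi_sum_reflect: "(\<Sum>p | p \<in> circle_points K \<and> 5 dvd fst p - 2 * snd p. psi (fst p) * psi (snd p)) = 0" (is "sum ?s ?S = 0")
proof -
  define \<phi> where "\<phi> = (\<lambda>(x :: int, y :: int). ((3 * x + 4 * y) div 5, (4 * x - 3 * y) div 5))"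
  have \<phi>: "\<phi> p \<in> ?S \<and> \<phi> (\<phi> p) = p \<and> ?s (\<phi> p) = - ?s p" if "p \<in> ?S" for p
  proof -
    obtain x y where p: "p = (x, y)" by (cases p)
    then have K: "x\<^sup>2 + y\<^sup>2 = K" and "5 dvd x - 2 * y" using that by (auto simp: circle_points_def)
    then obtain t where "x - 2 * y = 5 * t" by blast
    \<comment> \<open>With this parametrisation the reflection sends (x, y) to (2y + 3t, y + 4t),
      free of divisions.\<close>
    then have x: "x = 2 * y + 5 * t" by simp
    have \<phi>p: "\<phi> p = (2 * y + 3 * t, y + 4 * t)"
      by (simp add: \<phi>_def p x)
    have "(2 * y + 3 * t)\<^sup>2 + (y + 4 * t)\<^sup>2 = K"
      unfolding K[symmetric] x by (simp add: power2_eq_square algebra_simps)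
    moreover have "(2 * y + 3 * t) - 2 * (y + 4 * t) = 5 * (- t)" by simp
    then have "5 dvd (2 * y + 3 * t) - 2 * (y + 4 * t)" by (rule dvdI)
    moreover have "\<phi> (\<phi> p) = p"
      unfolding \<phi>p by (simp add: \<phi>_def p x)
    moreover have "psi (2 * y + 3 * t) * psi (y + 4 * t) = - (psi x * psi y)"
      by (rule psi_reflect) (simp_all add: x)
    ultimately show ?thesis unfolding \<phi>p by (simp add: p circle_points_def)
  qed
  have "sum ?s ?S = (\<Sum>p\<in>?S. - ?s p)"
    by (rule sum.reindex_bij_witness[of _ \<phi> \<phi>]) (use \<phi> in auto)
  then show ?thesis by (simp add: sum_negf)
qed

lemma chi4_mult_5 [simp]: "chi4 (5 * x) = chi4 x"
  using chi4_add_mult[of x x] by simp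

lemma chi3_mult_5 [simp]: "chi3 (5 * x) = - chi3 x"
  using chi3_add_mult[of "- x" "2 * x"] by simp

text \<open>By \<open>psi_sum_reflect\<close> only the overlap in \<open>sum_split_mod_5\<close>
  remains, with a minus sign. Its points are 5 times the points of norm K/25, and the two signs of
  \<open>psi\<close> at 5 cancel.\<close>

lemma psi_sum_5:
  assumes "5 dvd K"
  shows "psi_sum K = (if 25 dvd K then - psi_sum (K div 25) else 0)"
proof -
  let ?s = "\<lambda>p. psi (fst p) * psi (snd p)"
  have 1: "psi_sum K = - (\<Sum>p | p \<in> circle_points K \<and> 5 dvd fst p \<and> 5 dvd snd p. ?s p)"
  proof -
    have "sum ?s (circle_points K) = 2 * (\<Sum>p | p \<in> circle_points K \<and> 5 dvd fst p - 2 * snd p. ?s p) -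
        (\<Sum>p | p \<in> circle_points K \<and> 5 dvd fst p \<and> 5 dvd snd p. ?s p)"
      by (rule sum_split_mod_5[of _ K]) (use assms in \<open>auto simp: circle_points_def\<close>)
    then show ?thesis by (simp only: psi_sum_reflect psi_sum_def split_def)
  qed
  show ?thesis
  proof (cases "25 dvd K")
    case True
    then obtain k where k: "K = 25 * k" by blast
    have "(\<Sum>p | p \<in> circle_points K \<and> 5 dvd fst p \<and> 5 dvd snd p. ?s p) = (\<Sum>p\<in>circle_points k. ?s p)"
      by (rule sum.reindex_bij_witness[of _ "\<lambda>(x, y). (5 * x, 5 * y)" "\<lambda>(x, y). (x div 5, y div 5)"])
        (auto simp: circle_points_def k power2_eq_square psi_def elim!: dvdE)
    then show ?thesis using 1 by (simp add: k psi_sum_def split_def)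
  next
    case False
    have none: "{p. p \<in> circle_points K \<and> 5 dvd fst p \<and> 5 dvd snd p} = {}"
    proof (rule ccontr)
      assume "{p. p \<in> circle_points K \<and> 5 dvd fst p \<and> 5 dvd snd p} \<noteq> {}"
      then obtain x y where "x\<^sup>2 + y\<^sup>2 = K" "5 dvd x" "5 dvd y" by (auto simp: circle_points_def)
      then have "25 dvd K" by (auto simp: power2_eq_square elim!: dvdE)
      with False show False by simp
    qed
    show ?thesis using 1 False by (simp only: none) simp
  qed
qed

text \<open>
  \<open>quartic\<close> is the real part of \<open>(x + i y)\<^sup>4\<close>, and \<open>quartic'\<close> a quarter of its imaginary part.
\<close>

definition quartic :: "int \<times> int \<Rightarrow> int" where
  "quartic p = fst p ^ 4 - 6 * (fst p)\<^sup>2 * (snd p)\<^sup>2 + snd p ^ 4"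

definition quartic' :: "int \<times> int \<Rightarrow> int" where
  "quartic' p = fst p * snd p * ((fst p)\<^sup>2 - (snd p)\<^sup>2)"

lemma quartic_dvd_25:
  assumes "5 dvd fst p" "5 dvd snd p"
  shows "25 dvd quartic p" "25 dvd quartic' p"
proof -
  obtain a b where "fst p = 5 * a" "snd p = 5 * b" using assms by (auto elim!: dvdE)
  then have "quartic p = 25 * (25 * quartic (a, b))" "quartic' p = 25 * (25 * quartic' (a, b))"
    by (simp_all add: quartic_def quartic'_def eval_nat_numeral algebra_simps)
  then show "25 dvd quartic p" "25 dvd quartic' p" by (metis dvd_triv_left)+
qed

lemma dvd_25_mult_iff:
  fixes u w :: int
  assumes "\<not> 5 dvd u"
  shows "25 dvd u * w \<longleftrightarrow> 25 dvd w"
proof -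
  have "coprime 5 u" using assms by (simp add: prime_imp_coprime)
  then have "coprime (5 * 5) u" by (simp only: coprime_mult_left_iff)
  then show ?thesis using coprime_dvd_mult_right_iff[of 25 u w] by simp
qed

lemma dvd_diff_imp_iff: "d dvd a - b \<Longrightarrow> d dvd a \<longleftrightarrow> d dvd (b :: 'a::comm_ring_1)"
  by (metis diff_add_cancel dvd_add_right_iff)

lemma psi_sum4_altdef: "psi_sum4 K = (\<Sum>p\<in>circle_points K. psi (fst p) * psi (snd p) * quartic p)"
  by (simp add: psi_sum4_def quartic_def split_def)

text \<open>Exchanging the coordinates changes the sign of \<open>quartic'\<close> and keeps the
  product of the characters.\<close>

lemma sum_quartic'_eq_0:
  assumes "\<And>x y. (x, y) \<in> S \<Longrightarrow> (y, x) \<in> S"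
  shows "(\<Sum>p\<in>S. psi (fst p) * psi (snd p) * quartic' p) = 0" (is "sum ?s S = 0")
proof -
  have "sum ?s S = (\<Sum>p\<in>S. - ?s p)"
    by (rule sum.reindex_bij_witness[of _ prod.swap prod.swap])
      (use assms in \<open>auto simp: quartic'_def algebra_simps\<close>)
  then show ?thesis by (simp add: sum_negf)
qed

text \<open>
  Modulo 25 only the multiples of \<open>(2 + i)\<^sup>2 = 3 + 4 i\<close> and of its conjugate matter, and
  \<open>(3 + 4 i)\<^sup>4 = - 527 - 336 i\<close>.
\<close>

lemma psi_sum4_25: "25 dvd psi_sum4 (25 * K) - 4 * psi_sum4 K"
proof -
  let ?s = "\<lambda>p. psi (fst p) * psi (snd p) * quartic p"
  let ?S = "{p. p \<in> circle_points (25 * K) \<and> 5 dvd fst p - 2 * snd p}"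
  \<comment> \<open>\<open>?S\<close> holds the multiples of 2 + i and \<open>?T\<close> those of
    its square 3 + 4i, recognised by multiplying with 3 - 4i and dividing by 25.\<close>
  let ?T = "{p. p \<in> circle_points (25 * K) \<and> 25 dvd 3 * fst p + 4 * snd p \<and> 25 dvd 3 * snd p - 4 * fst p}"
  have fin: "finite ?S" by (rule finite_subset[OF _ finite_circle_points]) auto
  have G: "psi_sum4 (25 * K) = 2 * sum ?s ?S - (\<Sum>p | p \<in> circle_points (25 * K) \<and> 5 dvd fst p \<and> 5 dvd snd p. ?s p)"
    unfolding psi_sum4_altdef
    by (rule sum_split_mod_5[of _ "25 * K"]) (auto simp: circle_points_def quartic_def)
  have E: "25 dvd (\<Sum>p | p \<in> circle_points (25 * K) \<and> 5 dvd fst p \<and> 5 dvd snd p. ?s p)"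
  proof (rule dvd_sum)
    fix p assume "p \<in> {p. p \<in> circle_points (25 * K) \<and> 5 dvd fst p \<and> 5 dvd snd p}"
    then have "25 dvd quartic p" using quartic_dvd_25 by blast
    then show "25 dvd ?s p" by simp
  qed
  have S: "sum ?s ?S = sum ?s ?T + sum ?s (?S - ?T)"
  proof -
    have "?T \<subseteq> ?S"
    proof
      fix p assume "p \<in> ?T"
      then obtain a b where "p \<in> circle_points (25 * K)" "3 * fst p + 4 * snd p = 25 * a" "3 * snd p - 4 * fst p = 25 * b"
        by (auto elim!: dvdE)
      moreover from this have "fst p - 2 * snd p = 5 * (- a - 2 * b)" by simp
      then have "5 dvd fst p - 2 * snd p" by (rule dvdI)
      ultimately show "p \<in> ?S" by simp
    qed
    then show ?thesis using fin by (subst sum.subset_diff[of ?T ?S]) (auto simp: add.commute)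
  qed
  \<comment> \<open>A point of norm 25K that is divisible by 2 + i but not by its square is
    divisible by 2 - i as well, hence by 5.\<close>
  have D: "25 dvd sum ?s (?S - ?T)"
  proof (rule dvd_sum)
    fix p assume p: "p \<in> ?S - ?T"
    obtain x y where xy: "p = (x, y)" by (cases p)
    have K: "x\<^sup>2 + y\<^sup>2 = 25 * K" and "5 dvd x - 2 * y" and nT: "\<not> (25 dvd 3 * x + 4 * y \<and> 25 dvd 3 * y - 4 * x)"
      using p by (auto simp: xy circle_points_def)
    then obtain t where "x - 2 * y = 5 * t" by blast
    then have x: "x = 2 * y + 5 * t" by simp
    have "y * (y + 4 * t) = 5 * (K - t * t)" using K unfolding x by (simp add: power2_eq_square algebra_simps)
    then have "5 dvd y * (y + 4 * t)" by (metis dvd_triv_left)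
    then have "5 dvd y \<or> 5 dvd y + 4 * t" by (simp add: prime_dvd_mult_iff)
    moreover have "\<not> 5 dvd y + 4 * t"
    proof
      assume "5 dvd y + 4 * t"
      then obtain w where "y + 4 * t = 5 * w" by blast
      then have "3 * x + 4 * y = 25 * (2 * w - t)" "3 * y - 4 * x = 25 * (- w)" using x by simp_all
      with nT show False by (metis dvd_triv_left)
    qed
    ultimately have "5 dvd y" by blast
    then have "5 dvd x" unfolding x by presburger
    then have "25 dvd quartic p" using \<open>5 dvd y\<close> quartic_dvd_25 by (simp add: xy)
    then show "25 dvd ?s p" by simp
  qed
  have T: "sum ?s ?T = 527 * psi_sum4 K"
  proof -
    have "sum ?s ?T = (\<Sum>p\<in>circle_points K. ?s (3 * fst p - 4 * snd p, 4 * fst p + 3 * snd p))"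
    proof (rule sum.reindex_bij_witness[of _ "\<lambda>p. (3 * fst p - 4 * snd p, 4 * fst p + 3 * snd p)"
          "\<lambda>p. ((3 * fst p + 4 * snd p) div 25, (3 * snd p - 4 * fst p) div 25)"])
      fix p assume "p \<in> ?T"
      then obtain x y a b where xy: "p = (x, y)" "x\<^sup>2 + y\<^sup>2 = 25 * K" "3 * x + 4 * y = 25 * a" "3 * y - 4 * x = 25 * b"
        by (cases p) (auto simp: circle_points_def elim!: dvdE)
      have xab: "x = 3 * a - 4 * b" "y = 4 * a + 3 * b" using xy by simp_all
      have "a\<^sup>2 + b\<^sup>2 = K" using xy(2) unfolding xab by (simp add: power2_eq_square algebra_simps)
      then show "((3 * fst p + 4 * snd p) div 25, (3 * snd p - 4 * fst p) div 25) \<in> circle_points K"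
        using xy(3,4) by (simp add: xy(1) circle_points_def)
      show e: "(3 * fst ((3 * fst p + 4 * snd p) div 25, (3 * snd p - 4 * fst p) div 25) -
             4 * snd ((3 * fst p + 4 * snd p) div 25, (3 * snd p - 4 * fst p) div 25),
             4 * fst ((3 * fst p + 4 * snd p) div 25, (3 * snd p - 4 * fst p) div 25) +
             3 * snd ((3 * fst p + 4 * snd p) div 25, (3 * snd p - 4 * fst p) div 25)) = p"
        using xy(3,4) xab by (simp add: xy(1))
      then show "?s (3 * fst ((3 * fst p + 4 * snd p) div 25, (3 * snd p - 4 * fst p) div 25) -
             4 * snd ((3 * fst p + 4 * snd p) div 25, (3 * snd p - 4 * fst p) div 25),
             4 * fst ((3 * fst p + 4 * snd p) div 25, (3 * snd p - 4 * fst p) div 25) +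
             3 * snd ((3 * fst p + 4 * snd p) div 25, (3 * snd p - 4 * fst p) div 25)) = ?s p" by (simp only:)
    next
      fix p assume "p \<in> circle_points K"
      then obtain x y where xy: "p = (x, y)" "x\<^sup>2 + y\<^sup>2 = K" by (cases p) (auto simp: circle_points_def)
      have e: "3 * (3 * x - 4 * y) + 4 * (4 * x + 3 * y) = 25 * x" "3 * (4 * x + 3 * y) - 4 * (3 * x - 4 * y) = 25 * y"
        by simp_all
      show "((3 * fst (3 * fst p - 4 * snd p, 4 * fst p + 3 * snd p) + 4 * snd (3 * fst p - 4 * snd p, 4 * fst p + 3 * snd p)) div 25,
          (3 * snd (3 * fst p - 4 * snd p, 4 * fst p + 3 * snd p) - 4 * fst (3 * fst p - 4 * snd p, 4 * fst p + 3 * snd p)) div 25) = p"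
        unfolding xy(1) fst_conv snd_conv e by simp
      have "(3 * x - 4 * y)\<^sup>2 + (4 * x + 3 * y)\<^sup>2 = 25 * K"
        unfolding xy(2)[symmetric] by (simp add: power2_eq_square algebra_simps)
      then show "(3 * fst p - 4 * snd p, 4 * fst p + 3 * snd p) \<in> ?T"
        unfolding xy(1) mem_Collect_eq fst_conv snd_conv e by (simp add: circle_points_def)
    qed
    also have "\<dots> = (\<Sum>p\<in>circle_points K. 527 * ?s p - 1344 * (psi (fst p) * psi (snd p) * quartic' p))"
    proof (intro sum.cong refl)
      fix p :: "int \<times> int"
      obtain x y where xy: "p = (x, y)" by (cases p)
      have "3 * x - 4 * y = - x + 4 * (x - y)" "4 * x + 3 * y = - y + 4 * (x + y)"
        "3 * x - 4 * y = - y + 3 * (x - y)" "4 * x + 3 * y = x + 3 * (x + y)" by simp_all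
      then have "chi4 (3 * x - 4 * y) = - chi4 x" "chi4 (4 * x + 3 * y) = - chi4 y"
        "chi3 (3 * x - 4 * y) = - chi3 y" "chi3 (4 * x + 3 * y) = chi3 x"
        by (metis chi4_add_mult chi4_minus, metis chi4_add_mult chi4_minus, metis chi3_add_mult chi3_minus, metis chi3_add_mult)
      then have ps: "psi (3 * x - 4 * y) * psi (4 * x + 3 * y) = - (psi x * psi y)" by (simp add: psi_def)
      \<comment> \<open>The fourth power of 3 + 4i again; 1344 is 4 * 336 because
        \<open>quartic'\<close> is a quarter of the imaginary part.\<close>
      have q: "quartic (3 * x - 4 * y, 4 * x + 3 * y) = - 527 * quartic (x, y) + 1344 * quartic' (x, y)"
        by (simp add: quartic_def quartic'_def eval_nat_numeral algebra_simps)
      show "?s (3 * fst p - 4 * snd p, 4 * fst p + 3 * snd p) =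
          527 * ?s p - 1344 * (psi (fst p) * psi (snd p) * quartic' p)"
        unfolding xy fst_conv snd_conv ps q by (simp add: algebra_simps)
    qed
    also have "\<dots> = 527 * psi_sum4 K - 1344 * (\<Sum>p\<in>circle_points K. psi (fst p) * psi (snd p) * quartic' p)"
      by (simp add: psi_sum4_altdef sum_subtractf sum_distrib_left)
    also have "(\<Sum>p\<in>circle_points K. psi (fst p) * psi (snd p) * quartic' p) = 0"
      by (rule sum_quartic'_eq_0) (auto simp: circle_points_def add.commute)
    finally show ?thesis by simp
  qed
  \<comment> \<open>Uses 2 * 527 = 4 + 25 * 42.\<close>
  have "psi_sum4 (25 * K) - 4 * psi_sum4 K = 25 * (42 * psi_sum4 K) + 2 * sum ?s (?S - ?T) -
      (\<Sum>p | p \<in> circle_points (25 * K) \<and> 5 dvd fst p \<and> 5 dvd snd p. ?s p)"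
    unfolding G S T by simp
  also have "25 dvd \<dots>"
    by (rule dvd_diff[OF dvd_add[OF dvd_triv_left dvd_mult[OF D]] E])
  finally show ?thesis .
qed

text \<open>The fourth power of a Gaussian integer of norm prime to 5 has the form u + iv with u = 1
  + 5a and v = 5b. Comparing u^2 + v^2 = K^4 modulo 25 determines 10a, and with it 2u.\<close>

lemma quartic_mod_25:
  assumes "x\<^sup>2 + y\<^sup>2 = K" "\<not> 5 dvd K"
  shows "25 dvd 2 * quartic (x, y) - (1 + K ^ 4)"
proof -
  define u where "u = quartic (x, y)"
  define v where "v = 4 * quartic' (x, y)"
  have norm: "u\<^sup>2 + v\<^sup>2 = K ^ 4"
    unfolding u_def v_def quartic_def quartic'_def assms(1)[symmetric]
    by (simp add: eval_nat_numeral algebra_simps)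
  define r where "r = x mod 5"
  define s where "s = y mod 5"
  have r: "[x = r] (mod 5)" "r \<in> {0, 1, 2, 3, 4}" and s: "[y = s] (mod 5)" "s \<in> {0, 1, 2, 3, 4}"
    unfolding r_def s_def by (auto simp: cong_def)
  have "[x\<^sup>2 + y\<^sup>2 = r\<^sup>2 + s\<^sup>2] (mod 5)"
    by (intro cong_add cong_pow r s)
  then have nz: "\<not> 5 dvd r\<^sup>2 + s\<^sup>2"
    using assms by (simp add: cong_dvd_iff)
  have "[u - 1 = quartic (r, s) - 1] (mod 5)" "[v = 4 * quartic' (r, s)] (mod 5)"
    unfolding u_def v_def quartic_def quartic'_def fst_conv snd_conv
    by (intro cong_add cong_diff cong_mult cong_pow cong_refl r s)+
  moreover have "5 dvd quartic (r, s) - 1 \<and> 5 dvd 4 * quartic' (r, s)"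
    using r(2) s(2) nz by (auto simp: quartic_def quartic'_def)
  ultimately have "5 dvd u - 1 \<and> 5 dvd v" by (simp add: cong_dvd_iff)
  then obtain a b where "u - 1 = 5 * a" "v = 5 * b" by (auto elim!: dvdE)
  then have u: "u = 5 * a + 1" and v: "v = 5 * b" by simp_all
  then have "2 * u - (1 + K ^ 4) = 25 * (- (a * a + b * b))"
    unfolding norm[symmetric] u v by (simp add: power2_eq_square algebra_simps)
  then show ?thesis unfolding u_def by (rule dvdI)
qed

lemma psi_sum4_mod_25: "\<not> 5 dvd K \<Longrightarrow> 25 dvd 2 * psi_sum4 K - (1 + K ^ 4) * psi_sum K"
proof -
  assume K: "\<not> 5 dvd K"
  have "2 * psi_sum4 K - (1 + K ^ 4) * psi_sum K =
    (\<Sum>(x, y)\<in>circle_points K. psi x * psi y * (2 * quartic (x, y) - (1 + K ^ 4)))"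
    by (simp add: psi_sum4_altdef psi_sum_def sum_distrib_left sum_subtractf[symmetric] split_def algebra_simps)
  also have "25 dvd \<dots>"
    by (rule dvd_sum) (use quartic_mod_25[OF _ K] in \<open>auto simp: circle_points_def\<close>)
  finally show ?thesis .
qed

text \<open>Factors 25 are removed from \<open>K\<close> by induction. If 5 divides \<open>K\<close>
  exactly once, \<open>psi_sum K\<close> is 0; if not at all, \<open>psi_sum4_mod_25\<close>
  applies. The factor 4 and the sign are chosen so that \<open>v\<close> becomes the ratio of the
  coefficients of the tenth power and the square.\<close>

lemma psi_sum4_psi_sum:
  assumes "K > 0"
  shows "psi_sum K = 0 \<or> (\<exists>v. 5 dvd v - 1 \<and> 25 dvd psi_sum4 K + 4 * v * psi_sum K)"
  using assms
proof (induction "nat K" arbitrary: K rule: less_induct)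
  case less
  show ?case
  proof (cases "5 dvd K")
    case False
    have "5 dvd K ^ 4 - 1"
    proof -
      define r where "r = K mod 5"
      have "r \<noteq> 0" using False unfolding r_def by (simp add: dvd_eq_mod_eq_0)
      then have r: "[K = r] (mod 5)" "r \<in> {1, 2, 3, 4}"
        unfolding r_def by (auto simp: cong_def)
      have "[K ^ 4 - 1 = r ^ 4 - 1] (mod 5)"
        by (intro cong_diff cong_pow cong_refl r)
      moreover have "5 dvd r ^ 4 - 1" using r(2) by auto
      ultimately show ?thesis by (simp add: cong_dvd_iff)
    qed
    then obtain w where "K ^ 4 - 1 = 5 * w" by blast
    \<comment> \<open>The choice of \<open>v\<close> is 3(1 + K^4): it is 6 modulo 5, and 2 * 4 * 3
      is -1 modulo 25.\<close>
    then have "3 * (1 + K ^ 4) - 1 = 5 * (3 * w + 1)" by simp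
    then have "5 dvd 3 * (1 + K ^ 4) - 1" by (rule dvdI)
    moreover have "25 dvd psi_sum4 K + 4 * (3 * (1 + K ^ 4)) * psi_sum K"
    proof -
      have "2 * (psi_sum4 K + 4 * (3 * (1 + K ^ 4)) * psi_sum K) =
        (2 * psi_sum4 K - (1 + K ^ 4) * psi_sum K) + 25 * ((1 + K ^ 4) * psi_sum K)"
        by (simp add: algebra_simps)
      also have "25 dvd \<dots>" by (rule dvd_add[OF psi_sum4_mod_25[OF False] dvd_triv_left])
      finally show ?thesis by (subst (asm) dvd_25_mult_iff) simp_all
    qed
    ultimately show ?thesis by blast
  next
    case True
    show ?thesis
    proof (cases "25 dvd K")
      case False
      then show ?thesis using psi_sum_5[OF True] by simp
    next
      case 25: True
      then obtain k where k: "K = 25 * k" by blast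
      have A: "psi_sum K = - psi_sum k" using psi_sum_5[OF True] by (simp add: k)
      have "psi_sum k = 0 \<or> (\<exists>v. 5 dvd v - 1 \<and> 25 dvd psi_sum4 k + 4 * v * psi_sum k)"
        using less by (intro less.hyps) (auto simp: k)
      then show ?thesis
      proof
        assume "\<exists>v. 5 dvd v - 1 \<and> 25 dvd psi_sum4 k + 4 * v * psi_sum k"
        then obtain v where v: "5 dvd v - 1" "25 dvd psi_sum4 k + 4 * v * psi_sum k" by blast
        \<comment> \<open>Passing from \<open>k\<close> to \<open>25 * k\<close> multiplies
          \<open>psi_sum4\<close> by 4 modulo 25 and \<open>psi_sum\<close> by -1, so
          \<open>v\<close> turns into -4v, which equals \<open>v\<close> modulo 5.\<close>
        have "5 dvd - 4 * v - 1" using v(1) by presburger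
        moreover have "25 dvd psi_sum4 K + 4 * (- 4 * v) * psi_sum K"
        proof -
          have "psi_sum4 K + 4 * (- 4 * v) * psi_sum K =
            (psi_sum4 (25 * k) - 4 * psi_sum4 k) + 4 * (psi_sum4 k + 4 * v * psi_sum k)"
            unfolding A by (simp add: k)
          also have "25 dvd \<dots>" by (rule dvd_add[OF psi_sum4_25 dvd_mult[OF v(2)]])
          finally show ?thesis .
        qed
        ultimately show ?thesis by blast
      qed (simp add: A)
    qed
  qed
qed

text \<open>The points of norm \<open>5 K\<close> are the multiples of \<open>2 + i\<close> and of \<open>2 - i\<close> by points of norm \<open>K\<close>.\<close>

lemma chi_sum_mod_25: "25 dvd chi_sum (5 * (24 * int m + 2)) + 6 * psi_sum4 (24 * int m + 2)"
proof -
  define K where "K = 24 * int m + 2"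
  let ?s = "\<lambda>p. chi4 (fst p) * chi4 (snd p) * quartic' p"
  let ?t = "\<lambda>p. psi (fst p) * psi (snd p) * quartic p"
  let ?S = "{p. p \<in> circle_points (5 * K) \<and> 3 dvd snd p}"
  \<comment> \<open>The product of 2 + i and x + iy has second coordinate x + 2y, which 3 divides
    exactly when it divides x - y.\<close>
  let ?L = "{p. p \<in> circle_points K \<and> 3 dvd fst p - snd p}"
  let ?R = "{p. p \<in> circle_points K \<and> 3 dvd fst p + snd p}"
  have "chi_sum (5 * K) = sum ?s ?S"
    by (simp add: chi_sum_def quartic'_def split_def)
  also have "\<dots> = 2 * (\<Sum>p | p \<in> ?S \<and> 5 dvd fst p - 2 * snd p. ?s p) - (\<Sum>p | p \<in> ?S \<and> 5 dvd fst p \<and> 5 dvd snd p. ?s p)"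
    by (rule sum_split_mod_5[of _ "5 * K"]) (auto simp: circle_points_def quartic'_def)
  also have "(\<Sum>p | p \<in> ?S \<and> 5 dvd fst p - 2 * snd p. ?s p) = (\<Sum>p\<in>?L. ?s (2 * fst p - snd p, fst p + 2 * snd p))"
  proof (rule sum.reindex_bij_witness[of _ "\<lambda>p. (2 * fst p - snd p, fst p + 2 * snd p)"
        "\<lambda>p. ((2 * fst p + snd p) div 5, (2 * snd p - fst p) div 5)"])
    fix p assume p: "p \<in> {p. p \<in> ?S \<and> 5 dvd fst p - 2 * snd p}"
    obtain x y where xy: "p = (x, y)" by (cases p)
    have K: "x\<^sup>2 + y\<^sup>2 = 5 * K" and "3 dvd y" and "5 dvd x - 2 * y" using p by (auto simp: xy circle_points_def)
    then obtain t where "x - 2 * y = 5 * t" by blast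
    then have x: "x = 2 * y + 5 * t" by simp
    have d: "(2 * x + y) div 5 = y + 2 * t" "(2 * y - x) div 5 = - t" unfolding x by presburger+
    have "5 * ((y + 2 * t)\<^sup>2 + (- t)\<^sup>2) = 5 * K" unfolding K[symmetric] x by (simp add: power2_eq_square algebra_simps)
    moreover have "3 dvd (y + 2 * t) - (- t)" using \<open>3 dvd y\<close> by presburger
    ultimately show "((2 * fst p + snd p) div 5, (2 * snd p - fst p) div 5) \<in> ?L"
      by (simp add: xy d circle_points_def)
    show e: "(2 * fst ((2 * fst p + snd p) div 5, (2 * snd p - fst p) div 5) - snd ((2 * fst p + snd p) div 5, (2 * snd p - fst p) div 5),
        fst ((2 * fst p + snd p) div 5, (2 * snd p - fst p) div 5) + 2 * snd ((2 * fst p + snd p) div 5, (2 * snd p - fst p) div 5)) = p"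
      unfolding xy fst_conv snd_conv d by (simp add: x)
    then show "?s (2 * fst ((2 * fst p + snd p) div 5, (2 * snd p - fst p) div 5) - snd ((2 * fst p + snd p) div 5, (2 * snd p - fst p) div 5),
        fst ((2 * fst p + snd p) div 5, (2 * snd p - fst p) div 5) + 2 * snd ((2 * fst p + snd p) div 5, (2 * snd p - fst p) div 5)) = ?s p"
      by (simp only:)
  next
    fix p assume p: "p \<in> ?L"
    obtain x y where xy: "p = (x, y)" by (cases p)
    have K: "x\<^sup>2 + y\<^sup>2 = K" and 3: "3 dvd x - y" using p by (auto simp: xy circle_points_def)
    have "2 * (2 * x - y) + (x + 2 * y) = 5 * x" "2 * (x + 2 * y) - (2 * x - y) = 5 * y" by simp_all
    then show "((2 * fst (2 * fst p - snd p, fst p + 2 * snd p) + snd (2 * fst p - snd p, fst p + 2 * snd p)) div 5,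
        (2 * snd (2 * fst p - snd p, fst p + 2 * snd p) - fst (2 * fst p - snd p, fst p + 2 * snd p)) div 5) = p"
      unfolding xy fst_conv snd_conv by (metis nonzero_mult_div_cancel_left zero_neq_numeral)
    have "(2 * x - y)\<^sup>2 + (x + 2 * y)\<^sup>2 = 5 * K" unfolding K[symmetric] by (simp add: power2_eq_square algebra_simps)
    moreover have "3 dvd x + 2 * y" using 3 by presburger
    moreover have "2 * x - y - 2 * (x + 2 * y) = 5 * (- y)" by simp
    then have "5 dvd 2 * x - y - 2 * (x + 2 * y)" by (rule dvdI)
    ultimately show "(2 * fst p - snd p, fst p + 2 * snd p) \<in> {p. p \<in> ?S \<and> 5 dvd fst p - 2 * snd p}"
      by (simp add: xy circle_points_def)
  qed
  also have "\<dots> = (\<Sum>p\<in>?L. - 6 * ?t p + 7 * (psi (fst p) * psi (snd p) * quartic' p))"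
  proof (intro sum.cong refl)
    fix p assume p: "p \<in> ?L"
    obtain x y where xy: "p = (x, y)" by (cases p)
    have K: "x\<^sup>2 + y\<^sup>2 = 24 * int m + 2" and 3: "3 dvd x - y" using p by (auto simp: xy circle_points_def K_def)
    have odd: "odd x \<and> odd y"
    proof (rule ccontr)
      assume "\<not> (odd x \<and> odd y)"
      moreover have "even (x\<^sup>2 + y\<^sup>2)" unfolding K by simp
      ultimately have "even x" "even y" by auto
      then have "4 dvd x\<^sup>2 + y\<^sup>2" by (auto simp: power2_eq_square elim!: evenE)
      then show False unfolding K by presburger
    qed
    then obtain k where k: "x - y = 2 * k" by (metis even_diff dvdE odd_even_add even_add)
    have "2 * x - y = y + 4 * k" "x + 2 * y = - x + 4 * (x - k)" using k by auto
    then have c: "chi4 (2 * x - y) = chi4 y" "chi4 (x + 2 * y) = - chi4 x"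
      by (metis chi4_add_mult, metis chi4_add_mult chi4_minus)
    obtain l where l: "x - y = 3 * l" using 3 by blast
    have "x = y + 3 * l" using l by simp
    then have "chi3 x = chi3 y" by (metis chi3_add_mult)
    moreover have "chi3 y * chi3 y = 1"
    proof -
      have "\<not> 3 dvd y"
      proof
        assume "3 dvd y"
        then have "3 dvd x" using 3 by presburger
        with \<open>3 dvd y\<close> have "3 dvd x\<^sup>2 + y\<^sup>2" by (simp add: power2_eq_square)
        then show False unfolding K by presburger
      qed
      then show ?thesis unfolding chi3_def by (auto; presburger)
    qed
    ultimately have ps: "psi x * psi y = chi4 x * chi4 y" by (simp add: psi_def mult_ac)
    \<comment> \<open>Read off from (2 + i)^4 = -7 + 24i, with the imaginary part divided by
      4.\<close>
    have q: "quartic' (2 * x - y, x + 2 * y) = 6 * quartic (x, y) - 7 * quartic' (x, y)"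
      by (simp add: quartic_def quartic'_def eval_nat_numeral algebra_simps)
    show "?s (2 * fst p - snd p, fst p + 2 * snd p) = - 6 * ?t p + 7 * (psi (fst p) * psi (snd p) * quartic' p)"
      unfolding xy fst_conv snd_conv c ps q by (simp add: algebra_simps)
  qed
  also have "\<dots> = - 6 * sum ?t ?L + 7 * (\<Sum>p\<in>?L. psi (fst p) * psi (snd p) * quartic' p)"
    by (simp only: sum.distrib sum_distrib_left)
  also have "(\<Sum>p\<in>?L. psi (fst p) * psi (snd p) * quartic' p) = 0"
    by (rule sum_quartic'_eq_0) (auto simp: circle_points_def add.commute dvd_diff_commute)
  finally have c: "chi_sum (5 * K) = 2 * (- 6 * sum ?t ?L + 7 * 0) - (\<Sum>p | p \<in> ?S \<and> 5 dvd fst p \<and> 5 dvd snd p. ?s p)" .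
  have "25 dvd (\<Sum>p | p \<in> ?S \<and> 5 dvd fst p \<and> 5 dvd snd p. ?s p)"
  proof (rule dvd_sum)
    fix p assume "p \<in> {p. p \<in> ?S \<and> 5 dvd fst p \<and> 5 dvd snd p}"
    then have "25 dvd quartic' p" using quartic_dvd_25 by blast
    then show "25 dvd ?s p" by simp
  qed
  \<comment> \<open>The norm is 2 modulo 3, so neither coordinate is divisible by 3 and exactly one
    of x - y and x + y is. Conjugation exchanges the two halves.\<close>
  moreover have "psi_sum4 K = 2 * sum ?t ?L"
  proof -
    have un: "circle_points K = ?L \<union> ?R"
    proof -
      have "p \<in> ?L \<union> ?R" if "p \<in> circle_points K" for p
      proof -
        obtain x y where xy: "p = (x, y)" by (cases p)
        have K: "x\<^sup>2 + y\<^sup>2 = 24 * int m + 2" using that by (auto simp: xy circle_points_def K_def)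
        define r where "r = x mod 3"
        define s where "s = y mod 3"
        have r: "[x = r] (mod 3)" "r \<in> {0, 1, 2}" and s: "[y = s] (mod 3)" "s \<in> {0, 1, 2}"
          unfolding r_def s_def by (auto simp: cong_def)
        have "[x\<^sup>2 + y\<^sup>2 - 2 = r\<^sup>2 + s\<^sup>2 - 2] (mod 3)"
          by (intro cong_add cong_diff cong_pow cong_refl r s)
        moreover have "x\<^sup>2 + y\<^sup>2 - 2 = 3 * (8 * int m)" using K by simp
        then have "3 dvd x\<^sup>2 + y\<^sup>2 - 2" by (rule dvdI)
        ultimately have "3 dvd r\<^sup>2 + s\<^sup>2 - 2" by (simp add: cong_dvd_iff)
        then have "3 dvd r - s \<or> 3 dvd r + s" using r(2) s(2) by auto
        moreover have "[x - y = r - s] (mod 3)" "[x + y = r + s] (mod 3)"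
          by (intro cong_add cong_diff r s)+
        ultimately have "3 dvd x - y \<or> 3 dvd x + y" by (simp add: cong_dvd_iff)
        then show ?thesis using that by (simp add: xy)
      qed
      then show ?thesis by blast
    qed
    have dis: "?L \<inter> ?R = {}"
    proof (rule ccontr)
      assume "?L \<inter> ?R \<noteq> {}"
      then obtain x y where K: "x\<^sup>2 + y\<^sup>2 = 24 * int m + 2" and "3 dvd x - y" "3 dvd x + y"
        by (auto simp: circle_points_def K_def)
      then have "3 dvd x" "3 dvd y" by presburger+
      then have "3 dvd x\<^sup>2 + y\<^sup>2" by (simp add: power2_eq_square)
      then show False unfolding K by presburger
    qed
    have fin: "finite ?L" "finite ?R" by (rule finite_subset[OF _ finite_circle_points[of K]]; blast)+
    have "psi_sum4 K = sum ?t (?L \<union> ?R)"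
      unfolding psi_sum4_altdef by (rule sum.cong[OF un refl])
    also have "\<dots> = sum ?t ?L + sum ?t ?R" by (rule sum.union_disjoint[OF fin dis])
    finally have "psi_sum4 K = sum ?t ?L + sum ?t ?R" .
    moreover have "sum ?t ?R = sum ?t ?L"
      by (rule sum.reindex_bij_witness[of _ "\<lambda>(x, y). (x, - y)" "\<lambda>(x, y). (x, - y)"])
        (auto simp: circle_points_def quartic_def)
    ultimately show ?thesis by simp
  qed
  ultimately show ?thesis unfolding K_def[symmetric] c by simp
qed

section \<open>Return to integer coefficients and the congruence modulo 5\<close>

lemma of_int_fps_power:
  fixes F :: "int fps"
  shows "(of_int ((F ^ k) $ n) :: 'a::comm_ring_1) = (Abs_fps (\<lambda>i. of_int (F $ i)) ^ k) $ n"
  by (induction k arbitrary: n) (simp_all add: fps_mult_nth)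

text \<open>Each coefficient is that of the same finite product over either ring.\<close>

lemma of_int_euler_fps: "Abs_fps (\<lambda>i. of_int ((euler_fps :: int fps) $ i)) = (euler_fps :: 'a::comm_ring_1 fps)"
proof (rule fps_ext)
  fix m
  have "of_int ((\<Prod>n<N. 1 - fps_X ^ Suc n :: int fps) $ i) = (\<Prod>n<N. 1 - fps_X ^ Suc n :: 'a fps) $ i" for N i
  proof (induction N arbitrary: i)
    case (Suc N)
    have "of_int ((1 - fps_X ^ Suc N :: int fps) $ j) = (1 - fps_X ^ Suc N :: 'a fps) $ j" for j
      by (simp add: fps_X_power_nth del: power_Suc)
    then show ?case
      using Suc by (simp only: fps_mult_nth of_int_sum of_int_mult prod.lessThan_Suc)
  qed simp
  from this[of "Suc m" m]
  show "Abs_fps (\<lambda>i. of_int ((euler_fps :: int fps) $ i)) $ m = (euler_fps :: 'a fps) $ m"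
    unfolding euler_fps_def fps_prodinf_def fps_nth_Abs_fps .
qed

text \<open>q-adic convergence means that each coefficient of the partial products is eventually
  constant; its final value is the one that \<open>fps_prodinf\<close> reads off.\<close>

lemma euler_f_eq_prodinf:
  assumes "j > 0"
  shows "euler_f j = fps_prodinf (\<lambda>n. 1 - fps_X ^ (j * Suc n))"
proof (rule fps_ext)
  fix m
  let ?u = "\<lambda>n. 1 - fps_X ^ (j * Suc n) :: int fps"
  have "(\<lambda>n. \<Prod>i\<le>n. ?u i) \<longlonglongrightarrow> euler_f j"
    using has_prod_euler_f[OF assms] by (rule has_prod_imp_tendsto)
  then have "\<forall>\<^sub>F n in sequentially. (\<Prod>i\<le>n. ?u i) $ m = euler_f j $ m"
    by (simp add: tendsto_fps_iff)
  then obtain N where N: "\<And>n. n \<ge> N \<Longrightarrow> (\<Prod>i\<le>n. ?u i) $ m = euler_f j $ m"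
    by (auto simp: eventually_sequentially)
  have "fps_agree (Suc m) (fps_prodinf ?u) (\<Prod>i<Suc (max m N). ?u i)"
    using fps_prodinf_agree[of ?u "Suc m" "Suc (max m N)", OF euler_factor_agree[OF assms]] by simp
  then show "euler_f j $ m = fps_prodinf ?u $ m"
    using N[of "max m N"] by (simp add: fps_agree_def lessThan_Suc_atMost)
qed

lemma euler_f_1: "euler_f 1 = euler_fps"
  unfolding euler_fps_def by (subst euler_f_eq_prodinf) simp_all

lemma euler_f_5: "euler_f 5 = euler_fps oo fps_X ^ 5"
proof -
  have "(1 - fps_X ^ Suc n) oo fps_X ^ 5 = (1 - fps_X ^ (5 * Suc n) :: int fps)" for n
    using fps_X_power_compose[of "fps_X ^ 5 :: int fps" "Suc n"]
    by (simp add: fps_compose_sub_distrib power_mult[symmetric] del: power_Suc)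
  then show ?thesis
    unfolding euler_fps_def
    by (simp only: euler_f_eq_prodinf[OF zero_less_numeral] fps_prodinf_compose_X_power[OF euler_factor_agree' zero_less_numeral])
qed

lemma prod_diff_dvd:
  fixes u v :: "nat \<Rightarrow> 'a::comm_ring_1"
  assumes "\<And>n. d dvd u n - v n"
  shows "d dvd (\<Prod>n<N. u n) - (\<Prod>n<N. v n)"
proof (induction N)
  case (Suc N)
  have "(\<Prod>n<Suc N. u n) - (\<Prod>n<Suc N. v n) =
    ((\<Prod>n<N. u n) - (\<Prod>n<N. v n)) * u N + (\<Prod>n<N. v n) * (u N - v N)"
    by (simp add: algebra_simps)
  then show ?case using Suc assms by (metis dvd_add dvd_mult dvd_mult2)
qed simp

text \<open>Factor by factor, (1 - Y)^5 is 1 - Y^5 modulo 5, and a single coefficient sees only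
  finitely many factors.\<close>

lemma euler_f_pow_5_cong: "5 dvd (euler_f 1 ^ 5 - euler_f 5) $ m"
proof -
  let ?u = "\<lambda>n. 1 - fps_X ^ (1 * Suc n) :: int fps"
  let ?v = "\<lambda>n. 1 - fps_X ^ (5 * Suc n) :: int fps"
  have d: "5 dvd ?u n ^ 5 - ?v n" for n
  proof -
    have p: "(1 - Y) ^ 5 - (1 - Y ^ 5) = 5 * (2 * Y ^ 2 - Y - 2 * Y ^ 3 + Y ^ 4)" for Y :: "int fps"
      by (simp add: eval_nat_numeral algebra_simps)
    have e: "fps_X ^ (5 * Suc n) = ((fps_X ^ Suc n) ^ 5 :: int fps)"
      by (simp only: power_mult[symmetric] mult.commute)
    show ?thesis unfolding mult_1 e p by (rule dvd_triv_left)
  qed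
  have agu: "fps_agree n (?u n ^ 5) 1" for n
    using fps_agree_power[OF euler_factor_agree[of 1 n], of 5] by simp
  have agv: "fps_agree n (?v n) 1" for n
    by (rule euler_factor_agree) simp
  have "euler_f 1 ^ 5 = fps_prodinf (\<lambda>n. ?u n ^ 5)"
    by (simp only: euler_f_eq_prodinf[OF zero_less_one] fps_prodinf_power[OF euler_factor_agree[OF zero_less_one]])
  then have "euler_f 1 ^ 5 $ m = (\<Prod>n<Suc m. ?u n ^ 5) $ m"
    by (simp only: fps_prodinf_def fps_nth_Abs_fps)
  moreover have "euler_f 5 $ m = (\<Prod>n<Suc m. ?v n) $ m"
    by (simp only: euler_f_eq_prodinf[OF zero_less_numeral] fps_prodinf_def fps_nth_Abs_fps)
  moreover obtain H where "(\<Prod>n<Suc m. ?u n ^ 5) - (\<Prod>n<Suc m. ?v n) = 5 * H"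
    using prod_diff_dvd[of 5 "\<lambda>n. ?u n ^ 5" ?v "Suc m", OF d] by (elim dvdE)
  ultimately have "(euler_f 1 ^ 5 - euler_f 5) $ m = (5 * H) $ m"
    by (metis fps_sub_nth)
  then show ?thesis by (simp add: fps_numeral_mult_nth)
qed

theorem theorem4p13:
  fixes c d :: "nat \<Rightarrow> int"
  assumes "euler_f 1 ^ 10 = Abs_fps c"
    and "euler_f 1 ^ 5 * euler_f 5 = Abs_fps d"
  shows "\<forall>n. [c n = 0] (mod 25) \<longleftrightarrow> [d n = 0] (mod 25)"
proof
  fix n
  define a :: "nat \<Rightarrow> int" where "a m = (euler_f 1 ^ 2) $ m" for m
  have c: "c n = (euler_f 1 ^ 10) $ n" and d: "d n = (euler_f 1 ^ 5 * euler_f 5) $ n"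
    using assms by simp_all
  have sq: "(euler_f 5 ^ 2) $ n = (if 5 dvd n then a (n div 5) else 0)"
    unfolding a_def euler_f_5 euler_f_1 by (simp add: fps_compose_power fps_nth_compose_X_power)
  \<comment> \<open>Coefficient \<open>n\<close> of the square of f_1^5 - f_5, all of whose
    coefficients are multiples of 5.\<close>
  have cd: "25 dvd c n - 2 * d n + (if 5 dvd n then a (n div 5) else 0)"
  proof -
    define H where "H = euler_f 1 ^ 5 - euler_f 5"
    have "H * H = euler_f 1 ^ 10 - 2 * (euler_f 1 ^ 5 * euler_f 5) + euler_f 5 ^ 2"
      by (simp add: H_def algebra_simps power2_eq_square flip: power_add)
    then have "(H * H) $ n = c n - 2 * d n + (if 5 dvd n then a (n div 5) else 0)"
      by (simp only: c d sq[symmetric] fps_add_nth fps_sub_nth fps_numeral_mult_nth)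
    moreover have "25 dvd H $ i * H $ j" for i j
      using mult_dvd_mono[OF euler_f_pow_5_cong[of i] euler_f_pow_5_cong[of j]] by (simp add: H_def)
    then have "25 dvd (H * H) $ n" unfolding fps_mult_nth by (intro dvd_sum)
    ultimately show ?thesis by simp
  qed
  have two: "25 dvd 2 * d n \<longleftrightarrow> 25 dvd d n"
    by (rule dvd_25_mult_iff) simp
  have "25 dvd c n \<longleftrightarrow> 25 dvd d n"
  proof (cases "5 dvd n")
    case False
    then have cd': "25 dvd c n - 2 * d n" using cd by simp
    show ?thesis unfolding dvd_diff_imp_iff[OF cd'] two ..
  next
    case True
    then obtain m where m: "n = 5 * m" by blast
    let ?K = "24 * int m + 2"
    have cd': "25 dvd c n - 2 * d n + a m" using cd by (simp add: m)
    have "4 * (of_int (a m) :: complex) = of_int (psi_sum ?K)"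
      unfolding a_def euler_f_1 of_int_fps_power of_int_euler_fps by (rule four_times_euler_square_nth)
    then have a: "4 * a m = psi_sum ?K"
      by (metis of_int_eq_iff of_int_mult of_int_numeral)
    have "96 * (of_int (c n) :: complex) = of_int (chi_sum (24 * int n + 10))"
      unfolding c euler_f_1 of_int_fps_power of_int_euler_fps by (rule euler_pow_10_nth)
    then have "96 * c n = chi_sum (24 * int n + 10)"
      by (metis of_int_eq_iff of_int_mult of_int_numeral)
    moreover have "24 * int n + 10 = 5 * ?K" by (simp add: m)
    \<comment> \<open>Here 96 = 6 * 16 and the 6, prime to 5, is cancelled next.\<close>
    ultimately have "25 dvd 6 * (16 * c n + psi_sum4 ?K)" using chi_sum_mod_25[of m] by simp
    then have cG: "25 dvd 16 * c n + psi_sum4 ?K" by (subst (asm) dvd_25_mult_iff) simp_all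
    have "psi_sum ?K = 0 \<or> (\<exists>v. 5 dvd v - 1 \<and> 25 dvd psi_sum4 ?K + 4 * v * psi_sum ?K)"
      by (rule psi_sum4_psi_sum) simp
    then show ?thesis
    proof
      assume "psi_sum ?K = 0"
      then have cd0: "25 dvd c n - 2 * d n" using a cd' by simp
      show ?thesis unfolding dvd_diff_imp_iff[OF cd0] two ..
    next
      assume "\<exists>v. 5 dvd v - 1 \<and> 25 dvd psi_sum4 ?K + 4 * v * psi_sum ?K"
      then obtain v where v: "5 dvd v - 1" "25 dvd psi_sum4 ?K + 4 * v * psi_sum ?K" by blast
      \<comment> \<open>Since \<open>4 * a m\<close> is \<open>psi_sum ?K\<close>, the two
        congruences for \<open>psi_sum4 ?K\<close> combine with common factor 16.\<close>
      have "25 dvd 16 * (c n - v * a m)"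
      proof -
        have "16 * (c n - v * a m) = (16 * c n + psi_sum4 ?K) - (psi_sum4 ?K + 4 * v * psi_sum ?K)"
          unfolding a[symmetric] by (simp add: algebra_simps)
        then show ?thesis using cG v(2) by (metis dvd_diff)
      qed
      then have cv: "25 dvd c n - v * a m" by (subst (asm) dvd_25_mult_iff) simp_all
      have "\<not> 5 dvd v" "\<not> 5 dvd v + 1" using v(1) by presburger+
      have "25 dvd c n \<longleftrightarrow> 25 dvd v * a m" using cv by (rule dvd_diff_imp_iff)
      also have "\<dots> \<longleftrightarrow> 25 dvd a m" using \<open>\<not> 5 dvd v\<close> by (rule dvd_25_mult_iff)
      also have "\<dots> \<longleftrightarrow> 25 dvd (v + 1) * a m" using \<open>\<not> 5 dvd v + 1\<close> by (rule dvd_25_mult_iff[symmetric])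
      \<comment> \<open>Eliminating \<open>c n\<close> from \<open>cd'\<close> and \<open>cv\<close>
        expresses \<open>2 * d n\<close> through \<open>a m\<close>.\<close>
      also have "\<dots> \<longleftrightarrow> 25 dvd 2 * d n"
      proof (rule dvd_diff_imp_iff)
        have "(v + 1) * a m - 2 * d n = (c n - 2 * d n + a m) - (c n - v * a m)"
          by (simp add: algebra_simps)
        then show "25 dvd (v + 1) * a m - 2 * d n" using cd' cv by (metis dvd_diff)
      qed
      also note two
      finally show ?thesis .
    qed
  qed
  then show "[c n = 0] (mod 25) \<longleftrightarrow> [d n = 0] (mod 25)"
    by (simp add: cong_0_iff)
qed

end
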